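(* Let $\mathfrak R=\{\mathbf r_1,\dots,\mathbf r_m\}$ be a partial frame in involution on an open subset $\Omega\subset\mathbb R^n$ with coordinates $(u^1,\dots,u^n)$, and let $\Theta\subset\mathbb R^p$ be an open subset with coordinates $(\phi^1,\dots,\phi^p)$. Let $h^i_j$, $i=1,\dots,p$, $j=1,\dots,m$, be given smooth functions on $\Omega\times\Theta$. Consider the system of differential equations $$\mathbf r_j(\phi^i(u))=h^i_j(u,\phi(u)),\qquad i=1,\dots,p;\ j=1,\dots,m. \quad (\ast)$$ Write $[\mathbf r_j,\mathbf r_k]=\sum_{l=1}^m c^l_{jk}\mathbf r_l$ and assume that the integrability conditions $$\mathbf r_j(\mathbf r_k(\phi^i))-\mathbf r_k(\mathbf r_j(\phi^i))=\sum_{l=1}^m c^l_{jk}\,\mathbf r_l(\phi^i),\qquad i=1,\dots,p;\ j,k=1,\dots,m,$$ are identically satisfied on $\Omega\times\Theta$ after substitution of $h^i_j(u,\phi)$ for $\mathbf r_j(\phi^i)$ as prescribed by $(\ast)$; explicitly, for all $i=1,\dots,p$ and $j,k=1,\dots,m$, on $\Omega\times\Theta$, $$\sum_{l=1}^n\Big(\frac{\partial h^i_k}{\partial u^l}\,\mathbf r_j(u^l)-\frac{\partial h^i_j}{\partial u^l}\,\mathbf r_k(u^l)\Big)+\sum_{s=1}^p\Big(\frac{\partial h^i_k}{\partial\phi^s}\,h^s_j-\frac{\partial h^i_j}{\partial\phi^s}\,h^s_k\Big)=\sum_{l=1}^m c^l_{jk}(u)\,h^i_l(u,\phi).$$ Then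 for any point $\bar u\in\Omega$ and for any smooth initial data prescribed along any embedded submanifold $\Xi\subset\Omega$ of codimension $m$ containing $\bar u$ and transversal to $\mathfrak R$, there is a unique smooth local solution of $(\ast)$. That is, given arbitrary smooth functions $(g^1,\dots,g^p)\colon\Xi\to\Theta$, there are an open subset $\Omega'\subset\Omega$ containing $\bar u$ and (locally unique) smooth functions $(\alpha^1,\dots,\alpha^p)\colon\Omega'\to\Theta$ satisfying $(\ast)$ and such that $\alpha^i|_{\Xi\cap\Omega'}=g^i|_{\Xi\cap\Omega'}$ for $i=1,\dots,p$.
   Context: All objects are $C^\infty$-smooth; $1\le m\le n$. A partial frame on $\Omega$ is a set of smooth vector fields linearly independent at every point of $\Omega$; it is in involution if all Lie brackets $[\mathbf r_i,\mathbf r_j]$ lie in the $C^\infty(\Omega)$-span of $\mathbf r_1,\dots,\mathbf r_m$. A vector field acts on functions as a first-order differential operator. Transversality of $\Xi$ to $\mathfrak R$ means $\operatorname{span}_{\mathbb R}\{\mathbf r_1|_u,\dots,\mathbf r_m|_u\}\oplus T_u\Xi=\mathbb R^n$ at every point $u\in\Xi$. *)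

theory Defs
  imports "HOL-Analysis.Analysis"
begin

(* Smoothness is only meaningful here for open S, since derivatives are taken "at x" and not
   "at x within S". *)
primrec Ck_on :: "nat \<Rightarrow> ('a::real_normed_vector \<Rightarrow> 'b::real_normed_vector) \<Rightarrow> 'a set \<Rightarrow> bool" where
  "Ck_on 0 f S \<longleftrightarrow> continuous_on S f"
| "Ck_on (Suc k) f S \<longleftrightarrow>
     (\<forall>x\<in>S. f differentiable (at x)) \<and> (\<forall>v. Ck_on k (\<lambda>x. frechet_derivative f (at x) v) S)"

definition smooth_on :: "'a::real_normed_vector set \<Rightarrow> ('a \<Rightarrow> 'b::real_normed_vector) \<Rightarrow> bool" where
  "smooth_on S f \<longleftrightarrow> (\<forall>k. Ck_on k f S)"

(* The function X(f); for vector-valued f, X acts on each component. *)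
definition vf_apply :: "('a::real_normed_vector \<Rightarrow> 'a) \<Rightarrow> ('a \<Rightarrow> 'b::real_normed_vector) \<Rightarrow> 'a \<Rightarrow> 'b" where
  "vf_apply X f u = frechet_derivative f (at u) (X u)"

(* In coordinates, [X,Y]^l = X(Y^l) - Y(X^l). *)
definition lie_bracket :: "('a::real_normed_vector \<Rightarrow> 'a) \<Rightarrow> ('a \<Rightarrow> 'a) \<Rightarrow> 'a \<Rightarrow> 'a" where
  "lie_bracket X Y u = vf_apply X Y u - vf_apply Y X u"

definition partial_frame_on :: "(real^'n) set \<Rightarrow> ('m::finite \<Rightarrow> real^'n \<Rightarrow> real^'n) \<Rightarrow> bool" where
  "partial_frame_on \<Omega> r \<longleftrightarrow>
     (\<forall>j. smooth_on \<Omega> (r j)) \<and>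
     (\<forall>u\<in>\<Omega>. inj (\<lambda>j. r j u) \<and> independent (range (\<lambda>j. r j u)))"

definition in_involution_on :: "(real^'n) set \<Rightarrow> ('m::finite \<Rightarrow> real^'n \<Rightarrow> real^'n) \<Rightarrow> bool" where
  "in_involution_on \<Omega> r \<longleftrightarrow>
     (\<forall>j k. \<exists>a::'m \<Rightarrow> real^'n \<Rightarrow> real.
        (\<forall>l. smooth_on \<Omega> (a l)) \<and>
        (\<forall>u\<in>\<Omega>. lie_bracket (r j) (r k) u = (\<Sum>l\<in>UNIV. a l u *\<^sub>R r l u)))"

definition diffeomorphism ::
    "'a::real_normed_vector set \<Rightarrow> 'b::real_normed_vector set \<Rightarrow> ('a \<Rightarrow> 'b) \<Rightarrow> ('b \<Rightarrow> 'a) \<Rightarrow> bool" where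
  "diffeomorphism U V \<psi> \<psi>' \<longleftrightarrow>
     open U \<and> open V \<and> homeomorphism U V \<psi> \<psi>' \<and> smooth_on U \<psi> \<and> smooth_on V \<psi>'"

(* Local slice charts: near each of its points, \<Xi> is the vanishing set of m of the n coordinates. *)
definition embedded_submanifold :: "nat \<Rightarrow> (real^'n) set \<Rightarrow> bool" where
  "embedded_submanifold codim \<Xi> \<longleftrightarrow>
     (\<forall>x\<in>\<Xi>. \<exists>U V \<psi> \<psi>' (K::'n set).
        x \<in> U \<and> diffeomorphism U V \<psi> (\<psi>' :: real^'n \<Rightarrow> real^'n) \<and> card K = codim \<and>
        \<psi> ` (\<Xi> \<inter> U) = {y\<in>V. \<forall>k\<in>K. y $ k = 0})"

(* Velocities at u of smooth curves in \<Xi>. *)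
definition tangent_space :: "(real^'n) set \<Rightarrow> real^'n \<Rightarrow> (real^'n) set" where
  "tangent_space \<Xi> u =
     {v. \<exists>\<gamma> \<epsilon>. \<epsilon> > 0 \<and> smooth_on {-\<epsilon><..<\<epsilon>} \<gamma> \<and> \<gamma> ` {-\<epsilon><..<\<epsilon>} \<subseteq> \<Xi> \<and> \<gamma> 0 = u \<and>
            (\<gamma> has_vector_derivative v) (at (0::real))}"

definition direct_sum_UNIV :: "'a::real_vector set \<Rightarrow> 'a set \<Rightarrow> bool" where
  "direct_sum_UNIV A B \<longleftrightarrow> A \<inter> B = {0} \<and> {a + b | a b. a \<in> A \<and> b \<in> B} = UNIV"

definition transversal :: "(real^'n) set \<Rightarrow> ('m::finite \<Rightarrow> real^'n \<Rightarrow> real^'n) \<Rightarrow> bool" where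
  "transversal \<Xi> r \<longleftrightarrow>
     (\<forall>u\<in>\<Xi>. direct_sum_UNIV (span (range (\<lambda>j. r j u))) (tangent_space \<Xi> u))"

(* A function on an embedded submanifold is smooth iff it extends smoothly to an ambient
   neighbourhood of each point. *)
definition smooth_on_submanifold :: "(real^'n) set \<Rightarrow> (real^'n \<Rightarrow> 'b::real_normed_vector) \<Rightarrow> bool" where
  "smooth_on_submanifold \<Xi> g \<longleftrightarrow>
     (\<forall>x\<in>\<Xi>. \<exists>U G. open U \<and> x \<in> U \<and> smooth_on U G \<and> (\<forall>y\<in>\<Xi> \<inter> U. G y = g y))"

(* Partial derivatives with respect to u^l and \<phi>^s of a function of (u, \<phi>). *)
definition pderiv_u :: "((real^'n) \<times> (real^'p) \<Rightarrow> real) \<Rightarrow> 'n \<Rightarrow> (real^'n) \<times> (real^'p) \<Rightarrow> real" where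
  "pderiv_u f l z = frechet_derivative f (at z) (axis l 1, 0)"

definition pderiv_phi :: "((real^'n) \<times> (real^'p) \<Rightarrow> real) \<Rightarrow> 'p \<Rightarrow> (real^'n) \<times> (real^'p) \<Rightarrow> real" where
  "pderiv_phi f s z = frechet_derivative f (at z) (0, axis s 1)"

definition solves_system ::
    "('m::finite \<Rightarrow> real^'n \<Rightarrow> real^'n) \<Rightarrow> ('p::finite \<Rightarrow> 'm \<Rightarrow> (real^'n) \<times> (real^'p) \<Rightarrow> real) \<Rightarrow>
     (real^'p) set \<Rightarrow> (real^'n) set \<Rightarrow> (real^'n \<Rightarrow> real^'p) \<Rightarrow> bool" where
  "solves_system r h \<Theta> W \<alpha> \<longleftrightarrow>
     smooth_on W \<alpha> \<and> \<alpha> ` W \<subseteq> \<Theta> \<and>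
     (\<forall>u\<in>W. \<forall>i j. vf_apply (r j) (\<lambda>v. \<alpha> v $ i) u = h i j (u, \<alpha> u))"

end

theory Submission
  imports Defs
begin

text \<open>
  Solutions are graphs tangent to the fields \<open>X\<^sub>j = (r\<^sub>j, h\<^sub>j)\<close> on \<open>\<Omega> \<times> \<Theta>\<close>, and the integrability
  conditions say exactly that \<open>[X\<^sub>j, X\<^sub>k] = \<Sum>\<^sub>l c\<^sup>l\<^sub>j\<^sub>k X\<^sub>l\<close>. Let \<open>E(t, z)\<close> be the flow of \<open>\<Sum>\<^sub>j t\<^sub>j X\<^sub>j\<close> started at
  \<open>z\<close>, at a fixed small time. The variational equation and involutivity give
  \<open>\<partial>E/\<partial>t\<^sub>k = \<Sum>\<^sub>l A\<^sub>k\<^sub>l X\<^sub>l(E)\<close>, where \<open>A\<close> solves a linear ODE and is invertible near \<open>t = 0\<close>.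
  Starting at the points \<open>(y, g y)\<close> of the graph over \<open>\<Xi>\<close>, transversality makes the
  \<open>\<Omega>\<close>-component of \<open>E\<close> a local diffeomorphism of \<open>(t, y)\<close>; the \<open>\<Theta>\<close>-component, expressed in
  these coordinates, is the solution. Any other solution satisfies the same ODE along the segments
  \<open>s \<mapsto> (s t, y)\<close>, so it agrees by Gronwall's inequality.
\<close>

subsection \<open>Calculus of \<open>C\<^sup>k\<close> functions\<close>

text \<open>Using the flow of the combinations \<Sum> t_j X_j avoids first replacing the frame by a
  commuting one. The price is the matrix A, which at t = 0 is a positive multiple of the identity.
  The main obstacle is smooth dependence of ODE solutions on parameters. \<open>Ck_on\<close>
  differentiates in fixed directions only, so a derivative of any order is again a map into the same
  space, but a derivative in a varying direction must first be expanded over a basis. The parameter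
  derivative of a solution is not extracted as a limit: it is constructed by solving the linearised
  equation and then verified with Gronwall. The bounds on the linearised coefficients are uniform
  only on compact sets, so neighbourhoods shrink at each order and regularity is proved locally. For
  the inverse function theorem, t and the point of \<Xi> must be packed into one point of R^n; the m
  slice coordinates that vanish on \<Xi> are reused to hold t.\<close>

lemma Ck_on_imp_continuous_on: "Ck_on k f S \<Longrightarrow> continuous_on S f"
  by (cases k) (auto intro!: continuous_at_imp_continuous_on differentiable_imp_continuous_within)

lemma Ck_on_Suc_imp: "Ck_on (Suc k) f S \<Longrightarrow> Ck_on k f S"
proof (induction k arbitrary: f)
  case 0
  then show ?case using Ck_on_imp_continuous_on[of "Suc 0" f S] by simp
next
  case (Suc k)
  then show ?case by simp
qed

lemma Ck_on_mono: "Ck_on k f S \<Longrightarrow> l \<le> k \<Longrightarrow> Ck_on l f S"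
proof (induction "k - l" arbitrary: l)
  case (Suc n)
  then have "Ck_on (Suc l) f S" by (metis Suc_diff_Suc Suc_leI diff_Suc_1 zero_less_Suc zero_less_diff)
  then show ?case by (rule Ck_on_Suc_imp)
qed simp

lemma Ck_on_subset: "Ck_on k f S \<Longrightarrow> T \<subseteq> S \<Longrightarrow> Ck_on k f T"
  by (induction k arbitrary: f) (auto intro: continuous_on_subset)

text \<open>On an open set a derivative depends only on the germ of the function, so equality on
  \<open>S\<close> is inherited by the derivatives of every order.\<close>

lemma Ck_on_cong:
  assumes "open S" "\<And>x. x \<in> S \<Longrightarrow> f x = g x"
  shows "Ck_on k f S = Ck_on k g S"
  using assms(2)
proof (induction k arbitrary: f g)
  case 0
  then show ?case by (auto cong: continuous_on_cong)
next
  case (Suc k)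
  have tr: "(f has_derivative f') (at x) \<longleftrightarrow> (g has_derivative f') (at x)" if "x \<in> S" for x f'
    using has_derivative_transform_within_open[OF _ assms(1) that] Suc.prems by metis
  \<comment> \<open>Holds even where neither function is differentiable: both sides are choices from
    the same predicate.\<close>
  then have fd: "frechet_derivative f (at x) = frechet_derivative g (at x)" if "x \<in> S" for x
    using that by (simp add: frechet_derivative_def)
  have "Ck_on k (\<lambda>x. frechet_derivative f (at x) v) S = Ck_on k (\<lambda>x. frechet_derivative g (at x) v) S" for v
    by (rule Suc.IH) (simp add: fd)
  moreover have "(\<forall>x\<in>S. f differentiable (at x)) = (\<forall>x\<in>S. g differentiable (at x))"
    using tr by (simp add: differentiable_def)
  ultimately show ?case by simp
qed

lemma Ck_on_localI:
  assumes "\<And>x. x \<in> S \<Longrightarrow> \<exists>U. open U \<and> x \<in> U \<and> Ck_on k f U"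
  shows "Ck_on k f S"
  using assms
proof (induction k arbitrary: f)
  case 0
  show ?case
    unfolding Ck_on.simps
    by (rule continuous_at_imp_continuous_on)
      (metis 0 Ck_on.simps(1) continuous_on_eq_continuous_at)
next
  case (Suc k)
  show ?case
  proof (clarsimp, intro conjI ballI allI)
    show "f differentiable (at x)" if "x \<in> S" for x using Suc.prems[OF that] by auto
    show "Ck_on k (\<lambda>x. frechet_derivative f (at x) v) S" for v
      by (rule Suc.IH) (use Suc.prems in force)
  qed
qed

text \<open>The introduction rule behind most inductions on \<open>k\<close>: uniqueness of
  derivatives lets a hand-computed \<open>f'\<close> stand in for
  \<open>frechet_derivative\<close>.\<close>

lemma Ck_on_SucI:
  assumes "\<And>x. x \<in> S \<Longrightarrow> (f has_derivative f' x) (at x)" "open S"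
    and "\<And>v. Ck_on k (\<lambda>x. f' x v) S"
  shows "Ck_on (Suc k) f S"
proof -
  have "Ck_on k (\<lambda>x. frechet_derivative f (at x) v) S = Ck_on k (\<lambda>x. f' x v) S" for v
    by (rule Ck_on_cong[OF assms(2)]) (metis assms(1) frechet_derivative_at)
  then show ?thesis using assms by (auto simp: differentiable_def)
qed
lemma Ck_on_SucD:
  assumes "Ck_on (Suc k) f S" "x \<in> S"
  shows "(f has_derivative frechet_derivative f (at x)) (at x)"
  using assms by (simp add: frechet_derivative_works)

lemma Ck_on_derivative: "Ck_on (Suc k) f S \<Longrightarrow> Ck_on k (\<lambda>x. frechet_derivative f (at x) v) S"
  by simp

lemma Ck_on_const: "open S \<Longrightarrow> Ck_on k (\<lambda>x. c) S"
proof (induction k arbitrary: c)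
  case (Suc k)
  show ?case by (rule Ck_on_SucI[where f'="\<lambda>_ _. 0"]) (use Suc in auto)
qed simp

lemma Ck_on_bounded_linear:
  assumes f: "bounded_linear f" and "open S" and g: "Ck_on k g S"
  shows "Ck_on k (\<lambda>x. f (g x)) S"
  using g
proof (induction k arbitrary: g)
  case 0
  then show ?case by (auto intro: bounded_linear.continuous_on[OF f])
next
  case (Suc k)
  show ?case
  proof (rule Ck_on_SucI[OF _ \<open>open S\<close>])
    show "((\<lambda>x. f (g x)) has_derivative (\<lambda>v. f (frechet_derivative g (at x) v))) (at x)" if "x \<in> S" for x
      by (rule bounded_linear.has_derivative[OF f Ck_on_SucD[OF Suc.prems that]])
    show "Ck_on k (\<lambda>x. f (frechet_derivative g (at x) v)) S" for v
      by (rule Suc.IH) (use Suc.prems in simp)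
  qed
qed

lemma Ck_on_ident: "open S \<Longrightarrow> Ck_on k (\<lambda>x. x) S"
  by (cases k) (auto intro!: Ck_on_SucI[where f'="\<lambda>_ v. v"] Ck_on_const)

lemma Ck_on_linear: "bounded_linear f \<Longrightarrow> open S \<Longrightarrow> Ck_on k f S"
  using Ck_on_bounded_linear[OF _ _ Ck_on_ident] by blast

lemma Ck_on_add:
  assumes "open S" "Ck_on k f S" "Ck_on k g S"
  shows "Ck_on k (\<lambda>x. f x + g x) S"
  using assms(2,3)
proof (induction k arbitrary: f g)
  case 0
  then show ?case by (auto intro: continuous_intros)
next
  case (Suc k)
  show ?case
  proof (rule Ck_on_SucI[OF _ \<open>open S\<close>])
    show "((\<lambda>x. f x + g x) has_derivative
        (\<lambda>v. frechet_derivative f (at x) v + frechet_derivative g (at x) v)) (at x)" if "x \<in> S" for x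
      by (intro has_derivative_add Ck_on_SucD[OF Suc.prems(1) that] Ck_on_SucD[OF Suc.prems(2) that])
    show "Ck_on k (\<lambda>x. frechet_derivative f (at x) v + frechet_derivative g (at x) v) S" for v
      by (rule Suc.IH) (use Suc.prems in simp_all)
  qed
qed

lemma Ck_on_sum:
  assumes "open S" "\<And>i. i \<in> I \<Longrightarrow> Ck_on k (f i) S"
  shows "Ck_on k (\<lambda>x. \<Sum>i\<in>I. f i x) S"
  using assms(2)
  by (induction I rule: infinite_finite_induct) (auto intro!: Ck_on_const Ck_on_add assms(1))

lemma Ck_on_bounded_bilinear:
  assumes p: "bounded_bilinear p" and "open S" and "Ck_on k f S" "Ck_on k g S"
  shows "Ck_on k (\<lambda>x. p (f x) (g x)) S"
  using assms(3,4)
proof (induction k arbitrary: f g)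
  case 0
  then show ?case by (auto intro: bounded_bilinear.continuous_on[OF p])
next
  case (Suc k)
  show ?case
  proof (rule Ck_on_SucI[OF _ \<open>open S\<close>])
    show "((\<lambda>x. p (f x) (g x)) has_derivative
        (\<lambda>v. p (f x) (frechet_derivative g (at x) v) + p (frechet_derivative f (at x) v) (g x))) (at x)"
      if "x \<in> S" for x
      by (rule bounded_bilinear.FDERIV[OF p Ck_on_SucD[OF Suc.prems(1) that] Ck_on_SucD[OF Suc.prems(2) that]])
    show "Ck_on k (\<lambda>x. p (f x) (frechet_derivative g (at x) v) + p (frechet_derivative f (at x) v) (g x)) S" for v
      by (intro Ck_on_add Suc.IH \<open>open S\<close>) (use Suc.prems in \<open>simp_all add: Ck_on_Suc_imp\<close>)
  qed
qed

lemmas Ck_on_scaleR = Ck_on_bounded_bilinear[OF bounded_bilinear_scaleR]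
lemmas Ck_on_mult = Ck_on_bounded_bilinear[OF bounded_bilinear_mult]

lemma Ck_on_Pair:
  assumes "open S" "Ck_on k f S" "Ck_on k g S"
  shows "Ck_on k (\<lambda>x. (f x, g x)) S"
proof -
  have "bounded_linear (\<lambda>x::'b. (x, 0::'c))" "bounded_linear (\<lambda>y::'c. (0::'b, y))"
    by (intro bounded_linear_Pair bounded_linear_ident bounded_linear_zero)+
  from Ck_on_add[OF assms(1) Ck_on_bounded_linear[OF this(1) assms(1,2)] Ck_on_bounded_linear[OF this(2) assms(1,3)]]
  show ?thesis by simp
qed

lemmas Ck_on_fst = Ck_on_bounded_linear[OF bounded_linear_fst]
lemmas Ck_on_snd = Ck_on_bounded_linear[OF bounded_linear_snd]
lemmas Ck_on_vec_nth = Ck_on_bounded_linear[OF bounded_linear_vec_nth]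

lemma Ck_on_vec_lambda:
  assumes "open S" "\<And>i. Ck_on k (\<lambda>x. f x i) S"
  shows "Ck_on k (\<lambda>x. (\<chi> i. f x i) :: 'b::euclidean_space ^ 'n) S"
proof -
  have "linear (axis i :: 'b \<Rightarrow> 'b ^ 'n)" for i
    by (intro linearI) (auto simp: axis_def vec_eq_iff)
  then have "Ck_on k (\<lambda>x. \<Sum>i\<in>UNIV. axis i (f x i) :: 'b ^ 'n) S"
    by (intro Ck_on_sum assms(1) Ck_on_bounded_linear[OF _ assms]) (simp add: linear_conv_bounded_linear)
  moreover have "(\<Sum>i\<in>UNIV. axis i (f x i)) = (\<chi> i. f x i)" for x
    by (auto simp: vec_eq_iff axis_def sum.delta)
  ultimately show ?thesis by simp
qed

text \<open>Reduces a derivative in a moving direction to finitely many derivatives in fixed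
  directions, the only ones that \<open>Ck_on\<close> controls.\<close>

lemma linear_euclidean_expand:
  fixes f :: "'a::euclidean_space \<Rightarrow> 'b::real_normed_vector"
  assumes "linear f"
  shows "f v = (\<Sum>b\<in>Basis. (v \<bullet> b) *\<^sub>R f b)"
  by (subst euclidean_representation[symmetric, of v])
    (simp only: linear_sum[OF assms] linear_scale[OF assms])

text \<open>The chain rule produces Dg(f x) in the direction Df(x) v, which moves with x. Over a
  basis it becomes a sum of products, and the induction hypothesis applies to the outer maps y
  \<mapsto> Dg(y) b; this is why \<open>g\<close> is generalised.\<close>

lemma Ck_on_compose:
  fixes f :: "'a::real_normed_vector \<Rightarrow> 'b::euclidean_space"
  assumes "open S" "open T" "Ck_on k f S" "Ck_on k g T" "f ` S \<subseteq> T"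
  shows "Ck_on k (\<lambda>x. g (f x)) S"
  using assms(3-)
proof (induction k arbitrary: g)
  case 0
  then show ?case by (auto intro: continuous_on_compose2)
next
  case (Suc k)
  let ?D = "\<lambda>x v. frechet_derivative g (at (f x)) (frechet_derivative f (at x) v)"
  show ?case
  proof (rule Ck_on_SucI[OF _ \<open>open S\<close>])
    have d: "(f has_derivative frechet_derivative f (at x)) (at x)"
      "(g has_derivative frechet_derivative g (at (f x))) (at (f x))" if "x \<in> S" for x
      using Ck_on_SucD[OF Suc.prems(1)] Ck_on_SucD[OF Suc.prems(2)] Suc.prems(3) that by auto
    then show "((\<lambda>x. g (f x)) has_derivative ?D x) (at x)" if "x \<in> S" for x
      using diff_chain_at[OF d[OF that]] by (simp add: o_def)
    have "Ck_on k (\<lambda>x. \<Sum>b\<in>Basis. (frechet_derivative f (at x) v \<bullet> b) *\<^sub>R frechet_derivative g (at (f x)) b) S" for v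
      using Suc.prems
      by (intro Ck_on_sum Ck_on_scaleR Ck_on_bounded_linear[OF bounded_linear_inner_left] Suc.IH \<open>open S\<close>)
        (auto simp: Ck_on_Suc_imp simp del: Ck_on.simps, auto)
    moreover have "(\<Sum>b\<in>Basis. (frechet_derivative f (at x) v \<bullet> b) *\<^sub>R frechet_derivative g (at (f x)) b) = ?D x v"
      if "x \<in> S" for x v
      by (rule linear_euclidean_expand[symmetric]) (rule has_derivative_linear[OF d(2)[OF that]])
    ultimately show "Ck_on k (\<lambda>x. ?D x v) S" for v
      by (subst Ck_on_cong[OF \<open>open S\<close>]) (auto simp: eq_commute)
  qed
qed

text \<open>The derivative of the reciprocal is a polynomial in the reciprocal itself, so the
  induction closes.\<close>

lemma Ck_on_inverse: "Ck_on k (inverse :: real \<Rightarrow> real) (- {0})"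
proof (induction k)
  case 0
  then show ?case by (auto intro!: continuous_intros)
next
  case (Suc k)
  have o: "open (- {0::real})" by auto
  show ?case
  proof (rule Ck_on_SucI[OF _ o])
    show "(inverse has_derivative (\<lambda>v. (inverse x * inverse x) * (- v))) (at x)" if "x \<in> - {0}" for x :: real
      using that by (auto intro!: derivative_eq_intros)
    show "Ck_on k (\<lambda>x. (inverse x * inverse x) * (- v)) (- {0})" for v :: real
      by (intro Ck_on_mult Suc o Ck_on_const)
  qed
qed

lemma Ck_on_divide:
  fixes f g :: "'a::real_normed_vector \<Rightarrow> real"
  assumes "open S" "Ck_on k f S" "Ck_on k g S" "\<And>x. x \<in> S \<Longrightarrow> g x \<noteq> 0"
  shows "Ck_on k (\<lambda>x. f x / g x) S"
  unfolding divide_inverse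
  by (intro Ck_on_mult Ck_on_compose[OF _ _ _ Ck_on_inverse]) (use assms in auto)

lemma Ck_on_prod:
  fixes f :: "'i \<Rightarrow> 'a::real_normed_vector \<Rightarrow> real"
  assumes "open S" "\<And>i. i \<in> I \<Longrightarrow> Ck_on k (f i) S"
  shows "Ck_on k (\<lambda>x. \<Prod>i\<in>I. f i x) S"
  using assms(2)
  by (induction I rule: infinite_finite_induct) (auto intro!: Ck_on_const Ck_on_mult assms(1))

lemma Ck_on_det:
  fixes A :: "'a::real_normed_vector \<Rightarrow> real^'n^'n"
  assumes "open S" "\<And>i j. Ck_on k (\<lambda>x. A x $ i $ j) S"
  shows "Ck_on k (\<lambda>x. det (A x)) S"
  unfolding det_def by (intro Ck_on_sum Ck_on_mult Ck_on_const Ck_on_prod assms)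

text \<open>By Cramer's rule the solution is a quotient of determinants, hence as regular as the
  entries of the matrix.\<close>

lemma Ck_on_linear_system_solution:
  fixes A :: "'a::real_normed_vector \<Rightarrow> real^'n^'n"
  assumes "open S" "\<And>i j. Ck_on k (\<lambda>x. A x $ i $ j) S" "\<And>x. x \<in> S \<Longrightarrow> det (A x) \<noteq> 0"
    and "\<And>x. x \<in> S \<Longrightarrow> A x *v w x = v"
  shows "Ck_on k w S"
proof -
  let ?w = "\<lambda>x. \<chi> l. det (\<chi> i j. if j = l then v $ i else A x $ i $ j) / det (A x)"
  have "Ck_on k (\<lambda>x. if j = l then v $ i else A x $ i $ j) S" for i j l
    using assms(1,2) by (cases "j = l") (auto intro: Ck_on_const)
  then have "Ck_on k ?w S"
    using assms(1-3) by (intro Ck_on_vec_lambda Ck_on_divide Ck_on_det) auto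
  moreover have "w x = ?w x" if "x \<in> S" for x
    using cramer[OF assms(3)[OF that]] assms(4)[OF that] by auto
  ultimately show ?thesis using Ck_on_cong[OF assms(1), of w ?w] by blast
qed

section \<open>Smooth maps and smoothness of inverse maps\<close>

lemma smooth_onD: "smooth_on S f \<Longrightarrow> Ck_on k f S"
  by (simp add: smooth_on_def)

lemma smooth_on_imp_continuous_on: "smooth_on S f \<Longrightarrow> continuous_on S f"
  using Ck_on_imp_continuous_on smooth_onD by blast

lemma smooth_on_has_derivative:
  "smooth_on S f \<Longrightarrow> x \<in> S \<Longrightarrow> (f has_derivative frechet_derivative f (at x)) (at x)"
  using Ck_on_SucD smooth_onD by blast

lemma smooth_on_subset: "smooth_on S f \<Longrightarrow> T \<subseteq> S \<Longrightarrow> smooth_on T f"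
  unfolding smooth_on_def using Ck_on_subset by blast

lemma smooth_on_frechet_derivative: "smooth_on S f \<Longrightarrow> smooth_on S (\<lambda>x. frechet_derivative f (at x) v)"
  unfolding smooth_on_def by (metis Ck_on.simps(2))

text \<open>A bootstrap: differentiating f (g y) = y shows that g' y v solves a linear system with
  matrix Df(g y). If g is C^k, so are the entries, hence g' is C^k and g is C^(k+1).\<close>

lemma smooth_local_inverse:
  fixes f g :: "real^'n \<Rightarrow> real^'n"
  assumes f: "smooth_on U f" and "open U" "open V" and hom: "homeomorphism U V f g"
    and g: "\<And>y. y \<in> V \<Longrightarrow> (g has_derivative g' y) (at y)"
  shows "smooth_on V g"
  unfolding smooth_on_def
proof
  have gU: "g ` V \<subseteq> U" and fg: "f (g y) = y" if "y \<in> V" for y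
    using hom that by (auto simp: homeomorphism_def)
  have ident: "frechet_derivative f (at (g y)) (g' y v) = v" if "y \<in> V" for y v
  proof -
    have "(f has_derivative frechet_derivative f (at (g y))) (at (g y))"
      using smooth_on_has_derivative[OF f] hom that by (auto simp: homeomorphism_def)
    from diff_chain_at[OF g[OF that] this]
    have "((\<lambda>y. y) has_derivative frechet_derivative f (at (g y)) \<circ> g' y) (at y)"
      by (rule has_derivative_transform_within_open[OF _ \<open>open V\<close> that]) (simp add: fg)
    from has_derivative_unique[OF this has_derivative_ident] show ?thesis by (simp add: fun_eq_iff)
  qed
  fix k show "Ck_on k g V"
  proof (induction k)
    case 0
    then show ?case using hom by (simp add: homeomorphism_def)
  next
    case (Suc k)
    show ?case
    proof (rule Ck_on_SucI[OF g \<open>open V\<close>])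
      fix v
      have lin: "linear (frechet_derivative f (at (g y)))" if "y \<in> V" for y
        using smooth_on_has_derivative[OF f] gU that has_derivative_linear by blast
      let ?A = "\<lambda>y. matrix (frechet_derivative f (at (g y)))"
      have A: "?A y *v w = frechet_derivative f (at (g y)) w" if "y \<in> V" for y w
        by (rule matrix_works[OF lin[OF that, folded linear_matrix_vector_mul_eq]])
      show "Ck_on k (\<lambda>y. g' y v) V"
      proof (rule Ck_on_linear_system_solution[OF \<open>open V\<close>, where A="?A" and v=v])
        show "Ck_on k (\<lambda>x. ?A x $ i $ j) V" for i j
          unfolding matrix_def using smooth_onD[OF smooth_on_frechet_derivative[OF f]]
          by (auto intro!: Ck_on_vec_nth \<open>open V\<close> \<open>open U\<close> Ck_on_compose[OF \<open>open V\<close> \<open>open U\<close> Suc] gU[THEN subsetD])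
        show "det (?A y) \<noteq> 0" if "y \<in> V" for y
        proof -
          have "surj ((*v) (?A y))"
            unfolding A[OF that, abs_def] using ident[OF that] by (metis surj_def)
          then have "invertible (?A y)"
            using matrix_right_invertible_surjective invertible_right_inverse by blast
          then show ?thesis by (simp add: invertible_det_nz)
        qed
        show "?A y *v g' y v = v" if "y \<in> V" for y
          by (simp add: A ident that)
      qed
    qed
  qed
qed

subsection \<open>Gronwall's inequality and uniform linearization\<close>

text \<open>What matters is that the bound is proportional to \<epsilon>. With \<epsilon> = 0 it
  yields uniqueness; with \<epsilon> a small multiple of a parameter increment it yields
  differentiability in the parameter.\<close>

lemma gronwall_right:
  fixes e :: "real \<Rightarrow> 'b::real_inner"
  assumes e: "\<And>s. s \<in> {0..T} \<Longrightarrow> (e has_vector_derivative e' s) (at s within {0..T})"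
    and "e 0 = 0" and le: "\<And>s. s \<in> {0..T} \<Longrightarrow> norm (e' s) \<le> L * norm (e s) + \<epsilon>"
    and s: "s \<in> {0..T}" and "L \<ge> 0" "\<epsilon> \<ge> 0"
  shows "norm (e s) \<le> \<epsilon> * exp ((2 * L + 1) * T)"
proof -
  let ?k = "2 * L + 1"
  \<comment> \<open>The squared norm is used because the norm is not differentiable at 0. The rate
    \<open>2 * L + 1\<close> comes from 2 L |e|^2 + 2 \<epsilon> |e| \<le> (2 L + 1) |e|^2 +
    \<epsilon>^2, and adding \<epsilon>^2 to the energy makes \<open>?f\<close>
    nonincreasing.\<close>
  let ?f = "\<lambda>s. (e s \<bullet> e s + \<epsilon>\<^sup>2) * exp (- ?k * s)"
  have "?f s \<le> ?f 0"
  proof (rule DERIV_nonpos_imp_decreasing_open[of 0 s ?f])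
    show "0 \<le> s" using s by simp
    have "continuous_on {0..T} e"
      using e has_vector_derivative_continuous continuous_on_eq_continuous_within by blast
    then have "continuous_on {0..s} e" by (rule continuous_on_subset) (use s in auto)
    then show "continuous_on {0..s} ?f" by (intro continuous_intros)
    fix x assume x: "0 < x" "x < s"
    have "at x within {0..T} = at x" using x s by (intro at_within_interior) auto
    then have d: "(e has_vector_derivative e' x) (at x)" using e[of x] x s by auto
    have "((\<lambda>s. e s \<bullet> e s) has_real_derivative 2 * (e x \<bullet> e' x)) (at x)"
      using has_derivative_inner[OF d[unfolded has_vector_derivative_def] d[unfolded has_vector_derivative_def]]
      unfolding has_field_derivative_def
      by (rule has_derivative_eq_rhs) (auto simp: fun_eq_iff inner_commute algebra_simps)
    then have "(?f has_real_derivative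
        2 * (e x \<bullet> e' x) * exp (- ?k * x) + (e x \<bullet> e x + \<epsilon>\<^sup>2) * (- ?k * exp (- ?k * x))) (at x)"
      by (auto intro!: derivative_eq_intros)
    moreover have "2 * (e x \<bullet> e' x) \<le> (e x \<bullet> e x + \<epsilon>\<^sup>2) * ?k"
    proof -
      have "2 * (e x \<bullet> e' x) \<le> 2 * (norm (e x) * norm (e' x))"
        using norm_cauchy_schwarz[of "e x" "e' x"] by simp
      also have "\<dots> \<le> 2 * (norm (e x) * (L * norm (e x) + \<epsilon>))"
        using le[of x] x s by (intro mult_left_mono) auto
      also have "\<dots> = 2 * L * (e x \<bullet> e x) + 2 * norm (e x) * \<epsilon>"
        by (simp add: dot_square_norm power2_eq_square algebra_simps)
      also have "2 * norm (e x) * \<epsilon> \<le> e x \<bullet> e x + \<epsilon>\<^sup>2"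
        using sum_squares_bound[of "norm (e x)" \<epsilon>] by (simp add: dot_square_norm)
      also have "2 * L * (e x \<bullet> e x) + (e x \<bullet> e x + \<epsilon>\<^sup>2) \<le> (e x \<bullet> e x + \<epsilon>\<^sup>2) * ?k"
        using \<open>L \<ge> 0\<close> by (simp add: algebra_simps)
      finally show ?thesis by simp
    qed
    then have "2 * (e x \<bullet> e' x) * exp (- ?k * x) + (e x \<bullet> e x + \<epsilon>\<^sup>2) * (- ?k * exp (- ?k * x)) \<le> 0"
      using mult_right_mono[of "2 * (e x \<bullet> e' x)" "(e x \<bullet> e x + \<epsilon>\<^sup>2) * ?k" "exp (- ?k * x)"]
      by (simp add: algebra_simps)
    ultimately show "\<exists>y. (?f has_real_derivative y) (at x) \<and> y \<le> 0" by blast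
  qed
  then have "(e s \<bullet> e s + \<epsilon>\<^sup>2) * exp (- ?k * s) * exp (?k * s) \<le> \<epsilon>\<^sup>2 * exp (?k * s)"
    using \<open>e 0 = 0\<close> by (intro mult_right_mono) auto
  moreover have "exp (- ?k * s) * exp (?k * s) = 1" by (simp add: algebra_simps flip: exp_add)
  ultimately have "e s \<bullet> e s + \<epsilon>\<^sup>2 \<le> \<epsilon>\<^sup>2 * exp (?k * s)"
    by (simp only: mult.assoc mult_1_right)
  moreover have "0 \<le> \<epsilon>\<^sup>2" by simp
  ultimately have "(norm (e s))\<^sup>2 \<le> \<epsilon>\<^sup>2 * exp (?k * s)"
    unfolding dot_square_norm by linarith
  \<comment> \<open>The exponent is doubled so that the right side becomes a perfect square and the
    root can be taken.\<close>
  also have "\<dots> \<le> \<epsilon>\<^sup>2 * (exp (?k * T))\<^sup>2"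
  proof -
    have "?k * s \<le> ?k * T" "0 \<le> ?k * T" using s \<open>L \<ge> 0\<close> by (simp_all add: mult_left_mono)
    then have "?k * s \<le> 2 * (?k * T)" by linarith
    then have "exp (?k * s) \<le> exp (2 * (?k * T))" by simp
    then show ?thesis by (intro mult_left_mono) (simp_all add: exp_double)
  qed
  finally have "(norm (e s))\<^sup>2 \<le> (\<epsilon> * exp (?k * T))\<^sup>2" by (simp only: power_mult_distrib)
  then show ?thesis by (rule power2_le_imp_le) (use \<open>\<epsilon> \<ge> 0\<close> in simp)
qed

lemma gronwall:
  fixes e :: "real \<Rightarrow> 'b::real_inner"
  assumes e: "\<And>s. s \<in> {-T..T} \<Longrightarrow> (e has_vector_derivative e' s) (at s within {-T..T})"
    and "e 0 = 0" and le: "\<And>s. s \<in> {-T..T} \<Longrightarrow> norm (e' s) \<le> L * norm (e s) + \<epsilon>"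
    and s: "s \<in> {-T..T}" and "L \<ge> 0" "\<epsilon> \<ge> 0"
  shows "norm (e s) \<le> \<epsilon> * exp ((2 * L + 1) * T)"
proof (cases "s \<ge> 0")
  case True
  show ?thesis
  proof (rule gronwall_right[where e=e and e'=e'])
    show "(e has_vector_derivative e' s) (at s within {0..T})" if "s \<in> {0..T}" for s
      using e[of s] that by (auto intro: has_vector_derivative_within_subset)
  qed (use assms True in auto)
next
  case False
  have "norm (e (- (- s))) \<le> \<epsilon> * exp ((2 * L + 1) * T)"
  proof (rule gronwall_right[where e="\<lambda>s. e (- s)" and e'="\<lambda>s. - e' (- s)"])
    fix s assume s: "s \<in> {0..T}"
    have "((e \<circ> uminus) has_vector_derivative (-1) *\<^sub>R e' (- s)) (at s within {0..T})"
    proof (rule vector_diff_chain_within)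
      show "(uminus has_vector_derivative -1) (at s within {0..T})"
        by (auto intro!: derivative_eq_intros)
      show "(e has_vector_derivative e' (- s)) (at (- s) within uminus ` {0..T})"
        by (rule has_vector_derivative_within_subset[OF e]) (use s in auto)
    qed
    then show "((\<lambda>s. e (- s)) has_vector_derivative - e' (- s)) (at s within {0..T})"
      by (simp add: o_def)
  qed (use assms False in auto)
  then show ?thesis by simp
qed

text \<open>The mean value inequality for G minus its linear part at \<open>q\<close>: the
  derivative of the difference has norm at most \<epsilon> on a small ball.\<close>

lemma Ck_on_local_linearization:
  fixes G :: "'a::euclidean_space \<Rightarrow> 'b::real_normed_vector"
  assumes G: "Ck_on (Suc 0) G S" and "open S" "q \<in> S" "\<epsilon> > 0"
  obtains \<rho> where "\<rho> > 0" "ball q \<rho> \<subseteq> S"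
    "\<And>a b. a \<in> ball q \<rho> \<Longrightarrow> b \<in> ball q \<rho> \<Longrightarrow>
       norm (G b - G a - frechet_derivative G (at q) (b - a)) \<le> \<epsilon> * norm (b - a)"
    "\<And>a v. a \<in> ball q \<rho> \<Longrightarrow>
       norm (frechet_derivative G (at a) v - frechet_derivative G (at q) v) \<le> \<epsilon> * norm v"
proof -
  let ?D = "\<lambda>y. frechet_derivative G (at y)"
  have D: "(G has_derivative ?D y) (at y)" if "y \<in> S" for y
    using Ck_on_SucD[OF G that] .
  \<comment> \<open>Bounds the operator norm of \<open>?D y - ?D q\<close> by finitely many fixed
    directions, whose derivatives are known to be continuous.\<close>
  let ?h = "\<lambda>y. \<Sum>b\<in>Basis. norm (?D y b - ?D q b)"
  have "continuous_on S ?h"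
    using G by (intro continuous_intros) auto
  then have "isCont ?h q" using \<open>open S\<close> \<open>q \<in> S\<close> continuous_on_eq_continuous_at by blast
  then have "\<forall>\<^sub>F y in at q. ?h y < \<epsilon>"
    using \<open>\<epsilon> > 0\<close> unfolding isCont_def by (auto dest!: order_tendstoD(2)[where a=\<epsilon>])
  moreover have "\<forall>\<^sub>F y in at q. y \<in> S" using \<open>open S\<close> \<open>q \<in> S\<close> by (rule eventually_at_in_open')
  ultimately have "\<forall>\<^sub>F y in at q. ?h y < \<epsilon> \<and> y \<in> S" by eventually_elim simp
  then obtain \<rho> where \<rho>: "\<rho> > 0" "\<And>y. y \<noteq> q \<Longrightarrow> dist y q < \<rho> \<Longrightarrow> ?h y < \<epsilon> \<and> y \<in> S"
    unfolding eventually_at by blast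
  then have sub: "ball q \<rho> \<subseteq> S" using \<open>q \<in> S\<close> by (auto simp: dist_commute) metis
  have h: "?h y \<le> \<epsilon>" if "y \<in> ball q \<rho>" for y
    using \<rho>(2)[of y] that \<open>\<epsilon> > 0\<close> by (cases "y = q") (auto simp: dist_commute less_imp_le)
  have n: "norm (?D y v - ?D q v) \<le> \<epsilon> * norm v" if y: "y \<in> ball q \<rho>" for y v
  proof -
    have lin: "linear (\<lambda>v. ?D y v - ?D q v)"
      using D[THEN has_derivative_linear] y sub \<open>q \<in> S\<close> by (intro linear_compose_sub) auto
    have "norm (?D y v - ?D q v) = norm (\<Sum>b\<in>Basis. (v \<bullet> b) *\<^sub>R (?D y b - ?D q b))"
      using linear_euclidean_expand[OF lin] by metis
    also have "\<dots> \<le> (\<Sum>b\<in>Basis. norm v * norm (?D y b - ?D q b))"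
      by (intro sum_norm_le) (auto intro!: mult_right_mono simp: Basis_le_norm)
    also have "\<dots> = norm v * ?h y" by (simp add: sum_distrib_left)
    also have "\<dots> \<le> norm v * \<epsilon>" using h[OF y] by (intro mult_left_mono) auto
    finally show ?thesis by (simp add: mult.commute)
  qed
  have "norm (G b - G a - ?D q (b - a)) \<le> norm (b - a) * \<epsilon>"
    if "a \<in> ball q \<rho>" "b \<in> ball q \<rho>" for a b
  proof (rule differentiable_bound_linearization[where S="ball q \<rho>"])
    show "a + t *\<^sub>R (b - a) \<in> ball q \<rho>" if "t \<in> {0..1}" for t
    proof -
      have "a + t *\<^sub>R (b - a) = (1 - t) *\<^sub>R a + t *\<^sub>R b" by (simp add: algebra_simps)
      then show ?thesis
        using convexD[OF convex_ball \<open>a \<in> ball q \<rho>\<close> \<open>b \<in> ball q \<rho>\<close>, of "1 - t" t] that by simp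
    qed
    show "(G has_derivative ?D x) (at x within ball q \<rho>)" if "x \<in> ball q \<rho>" for x
      using D sub that has_derivative_at_withinI by blast
    show "onorm (?D x - ?D q) \<le> \<epsilon>" if "x \<in> ball q \<rho>" for x
      using n[OF that] by (intro onorm_le) simp
    show "q \<in> ball q \<rho>" using \<rho> by simp
  qed
  then show thesis using that[of \<rho>] \<rho>(1) sub n by (metis mult.commute)
qed

lemma Ck_on_locally_lipschitz:
  fixes G :: "'a::euclidean_space \<Rightarrow> 'b::real_normed_vector"
  assumes G: "Ck_on (Suc 0) G S" and "open S" "q \<in> S"
  obtains \<rho> L where "\<rho> > 0" "L \<ge> 0" "ball q \<rho> \<subseteq> S"
    "\<And>a b. a \<in> ball q \<rho> \<Longrightarrow> b \<in> ball q \<rho> \<Longrightarrow> norm (G b - G a) \<le> L * norm (b - a)"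
proof -
  let ?D = "frechet_derivative G (at q)"
  obtain \<rho> where \<rho>: "\<rho> > 0" "ball q \<rho> \<subseteq> S"
    "\<And>a b. a \<in> ball q \<rho> \<Longrightarrow> b \<in> ball q \<rho> \<Longrightarrow> norm (G b - G a - ?D (b - a)) \<le> 1 * norm (b - a)"
    using Ck_on_local_linearization[OF assms zero_less_one] by metis
  have "bounded_linear ?D" using Ck_on_SucD[OF G \<open>q \<in> S\<close>] by (rule has_derivative_bounded_linear)
  then obtain K where K: "\<And>v. norm (?D v) \<le> norm v * K" "K \<ge> 0"
    using bounded_linear.nonneg_bounded by metis
  have "norm (G b - G a) \<le> (1 + K) * norm (b - a)" if "a \<in> ball q \<rho>" "b \<in> ball q \<rho>" for a b
    using \<rho>(3)[OF that] K(1)[of "b - a"] norm_triangle_ineq[of "G b - G a - ?D (b - a)" "?D (b - a)"]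
    by (simp add: algebra_simps)
  then show thesis using that[of \<rho> "1 + K"] \<rho> K by simp
qed

text \<open>Here the derivative is taken at the moving point q, not at the centre of a ball; the
  change of base point costs a second \<epsilon>/2. A Lebesgue number of the resulting cover of C
  serves as \<eta>.\<close>

lemma Ck_on_uniform_linearization:
  fixes G :: "'a::euclidean_space \<Rightarrow> 'b::real_normed_vector"
  assumes G: "Ck_on (Suc 0) G S" and "open S" "compact C" "C \<subseteq> S" "\<epsilon> > 0"
  obtains \<eta> where "\<eta> > 0"
    "\<And>q q'. q \<in> C \<Longrightarrow> norm (q' - q) < \<eta> \<Longrightarrow>
       norm (G q' - G q - frechet_derivative G (at q) (q' - q)) \<le> \<epsilon> * norm (q' - q)"
proof -
  let ?D = "\<lambda>q. frechet_derivative G (at q)"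
  let ?ok = "\<lambda>U. \<forall>a\<in>U. \<forall>b\<in>U. norm (G b - G a - ?D a (b - a)) \<le> \<epsilon> * norm (b - a)"
  have "\<exists>U. open U \<and> q \<in> U \<and> ?ok U" if q: "q \<in> C" for q
  proof -
    obtain \<rho> where \<rho>: "\<rho> > 0"
      "\<And>a b. a \<in> ball q \<rho> \<Longrightarrow> b \<in> ball q \<rho> \<Longrightarrow> norm (G b - G a - ?D q (b - a)) \<le> \<epsilon> / 2 * norm (b - a)"
      "\<And>a v. a \<in> ball q \<rho> \<Longrightarrow> norm (?D a v - ?D q v) \<le> \<epsilon> / 2 * norm v"
      using Ck_on_local_linearization[OF G \<open>open S\<close> subsetD[OF \<open>C \<subseteq> S\<close> q] half_gt_zero[OF \<open>\<epsilon> > 0\<close>]]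
      by metis
    have "norm (G b - G a - ?D a (b - a)) \<le> \<epsilon> * norm (b - a)" if "a \<in> ball q \<rho>" "b \<in> ball q \<rho>" for a b
      using \<rho>(2)[OF that] \<rho>(3)[OF that(1), of "b - a"]
        norm_triangle_ineq4[of "G b - G a - ?D q (b - a)" "?D a (b - a) - ?D q (b - a)"]
      by (simp add: algebra_simps)
    then show ?thesis using \<rho>(1) by (intro exI[of _ "ball q \<rho>"]) auto
  qed
  then have "C \<subseteq> \<Union>{U. open U \<and> ?ok U}" by blast
  then obtain \<eta> where "0 < \<eta>" and \<eta>: "\<And>q. q \<in> C \<Longrightarrow> \<exists>U\<in>{U. open U \<and> ?ok U}. ball q \<eta> \<subseteq> U"
    by (rule Heine_Borel_lemma[OF \<open>compact C\<close>, of "{U. open U \<and> ?ok U}"]) auto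
  show thesis
  proof (rule that[OF \<open>0 < \<eta>\<close>])
    fix q q' assume "q \<in> C" and q': "norm (q' - q) < \<eta>"
    then obtain U where "?ok U" "ball q \<eta> \<subseteq> U" using \<eta> by blast
    moreover have "q \<in> ball q \<eta>" "q' \<in> ball q \<eta>"
      using \<open>0 < \<eta>\<close> q' by (auto simp: dist_norm norm_minus_commute)
    ultimately show "norm (G q' - G q - ?D q (q' - q)) \<le> \<epsilon> * norm (q' - q)" by blast
  qed
qed

subsection \<open>Picard iteration with parameters\<close>

text \<open>The substitution \<sigma> = \<tau> s turns the scaled Picard integral into a difference
  of values of a primitive, so that a fixed point can be differentiated in s.\<close>

lemma scaled_integral_eq_primitive:
  fixes J :: "real \<Rightarrow> 'b::banach"
  assumes J: "\<And>\<sigma>. \<sigma> \<in> {-T..T} \<Longrightarrow> (J has_vector_derivative f \<sigma>) (at \<sigma> within {-T..T})"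
    and s: "s \<in> {-T..T}"
  shows "s *\<^sub>R integral {0..1} (\<lambda>\<tau>. f (\<tau> * s)) = J s - J 0"
proof -
  have m: "\<tau> * s \<in> {-T..T}" if "\<tau> \<in> {0..1}" for \<tau>
  proof -
    have "\<bar>\<tau> * s\<bar> \<le> 1 * T"
      unfolding abs_mult using s that by (intro mult_mono) auto
    then show ?thesis by auto
  qed
  have "((\<lambda>\<tau>. s *\<^sub>R f (\<tau> * s)) has_integral (J \<circ> (\<lambda>\<tau>. \<tau> * s)) 1 - (J \<circ> (\<lambda>\<tau>. \<tau> * s)) 0) {0..1}"
  proof (rule fundamental_theorem_of_calculus)
    fix \<tau> :: real assume \<tau>: "\<tau> \<in> {0..1}"
    show "(J \<circ> (\<lambda>\<tau>. \<tau> * s) has_vector_derivative s *\<^sub>R f (\<tau> * s)) (at \<tau> within {0..1})"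
    proof (rule vector_diff_chain_within)
      show "((\<lambda>\<tau>. \<tau> * s) has_vector_derivative s) (at \<tau> within {0..1})"
        by (auto intro!: derivative_eq_intros)
      show "(J has_vector_derivative f (\<tau> * s)) (at (\<tau> * s) within (\<lambda>\<tau>. \<tau> * s) ` {0..1})"
        by (rule has_vector_derivative_within_subset[OF J[OF m[OF \<tau>]]]) (use m in auto)
    qed
  qed simp
  from integral_unique[OF this] show ?thesis by simp
qed

text \<open>
  The Picard operator is written as \<open>s \<integral>\<^sub>0\<^sup>1 G((x, \<tau> s), z(x, \<tau> s)) d\<tau>\<close>, which treats both signs
  of \<open>s\<close> at once and makes joint continuity in \<open>(x, s)\<close> a statement about parameter integrals.
  The invariant set \<open>W\<close> is a ball for local existence and the whole space for linear equations.
\<close>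

lemma picard_exists:
  fixes G :: "('p::topological_space \<times> real) \<times> 'b::euclidean_space \<Rightarrow> 'b"
  assumes "closed W" "0 \<in> W" and contG: "continuous_on ((P \<times> {-T..T}) \<times> W) G"
    and invariant: "\<And>y q. continuous_on (P \<times> {-T..T}) y \<Longrightarrow> y ` (P \<times> {-T..T}) \<subseteq> W \<Longrightarrow> q \<in> P \<times> {-T..T} \<Longrightarrow>
      snd q *\<^sub>R integral {0..1} (\<lambda>\<tau>. G ((fst q, \<tau> * snd q), y (fst q, \<tau> * snd q))) \<in> W"
    and bound: "\<And>q. q \<in> P \<times> {-T..T} \<Longrightarrow> norm (G (q, 0)) \<le> M"
    and lip: "\<And>q a b. q \<in> P \<times> {-T..T} \<Longrightarrow> a \<in> W \<Longrightarrow> b \<in> W \<Longrightarrow>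
      norm (G (q, a) - G (q, b)) \<le> L * norm (a - b)"
    and T: "T \<ge> 0" "M \<ge> 0" "L \<ge> 0"
  obtains z where "continuous_on (P \<times> {-T..T}) z" "\<And>x. x \<in> P \<Longrightarrow> z (x, 0) = 0"
    "\<And>q. q \<in> P \<times> {-T..T} \<Longrightarrow> z q \<in> W"
    "\<And>x s. x \<in> P \<Longrightarrow> s \<in> {-T..T} \<Longrightarrow>
      ((\<lambda>s. z (x, s)) has_vector_derivative G ((x, s), z (x, s))) (at s within {-T..T})"
proof -
  let ?K = "P \<times> {-T..T}"
  define I where "I = (\<lambda>(y :: 'p \<times> real \<Rightarrow> 'b) q. integral {0..1} (\<lambda>\<tau>. G ((fst q, \<tau> * snd q), y (fst q, \<tau> * snd q))))"
  define z where "z = rec_nat (\<lambda>_. 0) (\<lambda>_ y q. snd q *\<^sub>R I y q)"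
  have z0: "z 0 = (\<lambda>_. 0)" and zS: "z (Suc n) = (\<lambda>q. snd q *\<^sub>R I (z n) q)" for n
    by (simp_all add: z_def)
  define ok where "ok = (\<lambda>y :: 'p \<times> real \<Rightarrow> 'b. continuous_on ?K y \<and> y ` ?K \<subseteq> W)"
  have m: "(fst q, \<tau> * snd q) \<in> ?K" if "q \<in> ?K" "\<tau> \<in> {0..1}" for q and \<tau> :: real
  proof -
    have "\<bar>\<tau> * snd q\<bar> \<le> 1 * T"
      unfolding abs_mult using that by (intro mult_mono) auto
    then show ?thesis using that by auto
  qed
  have okD: "y q \<in> W" if "ok y" "q \<in> ?K" for y q
    using that unfolding ok_def by blast
  have contI: "continuous_on (?K \<times> {0..1}) (\<lambda>(q, \<tau>). G ((fst q, \<tau> * snd q), y (fst q, \<tau> * snd q)))"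
    if "ok y" for y
  proof -
    let ?g = "\<lambda>p :: ('p \<times> real) \<times> real. (fst (fst p), snd p * snd (fst p))"
    have g: "continuous_on (?K \<times> {0..1}) ?g" "?g ` (?K \<times> {0..1}) \<subseteq> ?K"
      using m by (auto intro!: continuous_intros)
    have "continuous_on (?K \<times> {0..1}) (\<lambda>p. y (?g p))"
      using that continuous_on_compose2[OF _ g, of y] by (simp add: ok_def)
    moreover have "(\<lambda>p. (?g p, y (?g p))) ` (?K \<times> {0..1}) \<subseteq> ?K \<times> W"
      using g(2) that unfolding ok_def by fastforce
    ultimately have "continuous_on (?K \<times> {0..1}) (\<lambda>p. G (?g p, y (?g p)))"
      using continuous_on_compose2[OF contG continuous_on_Pair[OF g(1)]] by blast
    then show ?thesis by (simp add: split_beta)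
  qed
  have contI1: "continuous_on {0..1} (\<lambda>\<tau>. G ((fst q, \<tau> * snd q), y (fst q, \<tau> * snd q)))"
    if "ok y" "q \<in> ?K" for y q
    using continuous_on_compose2[OF contI[OF that(1)], of "{0..1}" "\<lambda>\<tau>. (q, \<tau>)"] that(2)
    by (force intro: continuous_intros)
  have intI: "(\<lambda>\<tau>. G ((fst q, \<tau> * snd q), y (fst q, \<tau> * snd q))) integrable_on {0..1}" if "ok y" "q \<in> ?K" for y q
    using contI1[OF that] by (rule integrable_continuous_real)
  have ok: "ok (z n)" for n
  proof (induction n)
    case 0
    show ?case using \<open>0 \<in> W\<close> by (auto simp: ok_def z0)
  next
    case (Suc n)
    have "continuous_on ?K (I (z n))"
      using integral_continuous_on_param[of ?K 0 "1::real" "\<lambda>q \<tau>. G ((fst q, \<tau> * snd q), z n (fst q, \<tau> * snd q))"]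
        contI[OF Suc] by (simp add: I_def)
    moreover have "snd q *\<^sub>R I (z n) q \<in> W" if "q \<in> ?K" for q
      using invariant[of "z n" q] Suc that unfolding ok_def I_def by blast
    ultimately show ?case unfolding ok_def zS by (auto intro!: continuous_intros)
  qed
  \<comment> \<open>The factorial bound makes the iteration converge for every T, with no smallness
    condition. Integrating \<tau>^(n+1) would even give 1/(n+2) in the step; weakening it to 1/(n+1)
    reproduces exactly this shape.\<close>
  let ?A = "\<lambda>n s. M * \<bar>s\<bar> * (L * \<bar>s\<bar>) ^ n / fact n"
  have step: "norm (z (Suc n) q - z n q) \<le> ?A n (snd q)" if "q \<in> ?K" for n q
    using that
  proof (induction n arbitrary: q)
    case 0
    have "\<bar>snd q\<bar> * norm (I (z 0) q) \<le> \<bar>snd q\<bar> * M"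
      using integral_bound[OF zero_le_one contI1[OF ok 0, of 0], of M] bound m[OF 0]
      by (intro mult_left_mono) (auto simp: I_def z0)
    then show ?case by (simp add: zS z0 mult.commute)
  next
    case (Suc n)
    let ?s = "snd q"
    have hp: "((\<lambda>\<tau>::real. L * ?A n ?s * \<tau> ^ Suc n) has_integral (L * ?A n ?s * (1 / (n + 2)))) {0..1}"
    proof (rule has_integral_mult_right)
      have "((\<lambda>\<tau>::real. \<tau> ^ Suc n) has_integral 1 ^ (n + 2) / (n + 2) - 0 ^ (n + 2) / (n + 2)) {0..1}"
      proof (rule fundamental_theorem_of_calculus)
        fix x :: real
        show "((\<lambda>\<tau>. \<tau> ^ (n + 2) / real (n + 2)) has_vector_derivative x ^ Suc n) (at x within {0..1})"
          using DERIV_cdivide[OF DERIV_pow[of "n + 2" x "{0..1}"], of "real (n + 2)"]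
          by (simp flip: has_real_derivative_iff_has_vector_derivative)
      qed simp
      then show "((\<lambda>\<tau>::real. \<tau> ^ Suc n) has_integral 1 / (n + 2)) {0..1}" by simp
    qed
    have "norm (I (z (Suc n)) q - I (z n) q) \<le> L * ?A n ?s * (1 / (n + 2))"
      unfolding I_def integral_diff[OF intI[OF ok Suc.prems] intI[OF ok Suc.prems], symmetric]
        integral_unique[OF hp, symmetric]
    proof (rule integral_norm_bound_integral)
      fix \<tau> :: real assume \<tau>: "\<tau> \<in> {0..1}"
      let ?q = "(fst q, \<tau> * snd q)"
      have "norm (G (?q, z (Suc n) ?q) - G (?q, z n ?q)) \<le> L * norm (z (Suc n) ?q - z n ?q)"
        by (intro lip m[OF Suc.prems \<tau>] okD[OF ok])
      also have "\<dots> \<le> L * ?A n (\<tau> * ?s)"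
        using Suc.IH[OF m[OF Suc.prems \<tau>]] T by (intro mult_left_mono) auto
      also have "\<dots> = L * ?A n ?s * \<tau> ^ Suc n"
        using \<tau> by (simp add: abs_mult power_mult_distrib)
      finally show "norm (G (?q, z (Suc n) ?q) - G (?q, z n ?q)) \<le> L * ?A n ?s * \<tau> ^ Suc n" .
    qed (use hp in \<open>auto intro!: integrable_diff intI ok Suc.prems\<close>)
    then have "\<bar>?s\<bar> * norm (I (z (Suc n)) q - I (z n) q) \<le> \<bar>?s\<bar> * (L * ?A n ?s * (1 / (n + 2)))"
      by (intro mult_left_mono) auto
    also have "\<dots> \<le> \<bar>?s\<bar> * (L * ?A n ?s * (1 / (n + 1)))"
    proof -
      have "0 \<le> L * ?A n ?s" using T by simp
      moreover have "1 / real (n + 2) \<le> 1 / (n + 1)" by (simp add: field_simps)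
      ultimately show ?thesis by (intro mult_left_mono) auto
    qed
    also have "\<dots> = ?A (Suc n) ?s" by (simp add: field_simps)
    finally have "norm (?s *\<^sub>R (I (z (Suc n)) q - I (z n) q)) \<le> ?A (Suc n) ?s" by simp
    moreover have "z (Suc (Suc n)) q - z (Suc n) q = ?s *\<^sub>R (I (z (Suc n)) q - I (z n) q)"
      by (subst zS, subst (2) zS) (simp only: scaleR_diff_right)
    ultimately show ?case by simp
  qed
  define zl where "zl = (\<lambda>q. \<Sum>n. z (Suc n) q - z n q)"
  \<comment> \<open>The increments telescope to the iterates and are dominated by the exponential
    series of L T.\<close>
  have "uniform_limit ?K (\<lambda>n q. \<Sum>i<n. z (Suc i) q - z i q) zl sequentially"
    unfolding zl_def
  proof (rule Weierstrass_m_test)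
    show "norm (z (Suc n) q - z n q) \<le> M * T * ((L * T) ^ n /\<^sub>R fact n)" if "q \<in> ?K" for n q
    proof -
      have s: "0 \<le> \<bar>snd q\<bar>" "\<bar>snd q\<bar> \<le> T" using that by auto
      have "M * \<bar>snd q\<bar> \<le> M * T" using s(2) T(2) by (rule mult_left_mono)
      moreover have "(L * \<bar>snd q\<bar>) ^ n \<le> (L * T) ^ n"
        using s T by (intro power_mono mult_left_mono mult_nonneg_nonneg)
      ultimately have "?A n (snd q) \<le> M * T * (L * T) ^ n / fact n"
        using s T by (intro divide_right_mono mult_mono) auto
      also have "\<dots> = M * T * ((L * T) ^ n /\<^sub>R fact n)" by (simp add: divide_inverse)
      finally show ?thesis using step[OF that, of n] by linarith
    qed
    show "summable (\<lambda>n. M * T * ((L * T) ^ n /\<^sub>R fact n))"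
      by (rule summable_mult[OF summable_exp_generic])
  qed
  moreover have "(\<Sum>i<n. z (Suc i) q - z i q) = z n q" for n q
    by (induction n) (simp_all add: z0)
  ultimately have lim: "uniform_limit ?K z zl sequentially" by (simp only:)
  have okl: "ok zl"
    unfolding ok_def
  proof
    show "continuous_on ?K zl"
      by (rule uniform_limit_theorem[OF _ lim]) (use ok in \<open>auto simp: ok_def\<close>)
    show "zl ` ?K \<subseteq> W"
    proof (rule image_subsetI)
      fix q assume q: "q \<in> ?K"
      show "zl q \<in> W"
        by (rule Lim_in_closed_set[OF \<open>closed W\<close> _ _ tendsto_uniform_limitI[OF lim q]])
          (simp_all add: okD[OF ok q])
    qed
  qed
  \<comment> \<open>The limit passes through the integral because G is Lipschitz on W and the
    iterates converge uniformly.\<close>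
  have fixpoint: "zl q = snd q *\<^sub>R I zl q" if q: "q \<in> ?K" for q
  proof -
    have "norm (I (z n) q - I zl q) \<le> L * \<epsilon>"
      if le: "\<And>q. q \<in> ?K \<Longrightarrow> norm (z n q - zl q) \<le> \<epsilon>" for n \<epsilon>
    proof -
      have "norm (G ((fst q, \<tau> * snd q), z n (fst q, \<tau> * snd q)) - G ((fst q, \<tau> * snd q), zl (fst q, \<tau> * snd q))) \<le> L * \<epsilon>"
        if \<tau>: "\<tau> \<in> {0..1}" for \<tau>
      proof -
        let ?q = "(fst q, \<tau> * snd q)"
        have "norm (G (?q, z n ?q) - G (?q, zl ?q)) \<le> L * norm (z n ?q - zl ?q)"
          by (intro lip m[OF q \<tau>] okD[OF ok] okD[OF okl])
        also have "\<dots> \<le> L * \<epsilon>" using le[OF m[OF q \<tau>]] T by (intro mult_left_mono)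
        finally show ?thesis .
      qed
      from integral_bound[OF zero_le_one continuous_on_diff[OF contI1[OF ok q] contI1[OF okl q]] this]
      show ?thesis
        unfolding I_def integral_diff[OF intI[OF ok q] intI[OF okl q], symmetric] by simp
    qed
    note close = this
    have "(\<lambda>n. I (z n) q) \<longlonglongrightarrow> I zl q"
    proof (rule tendstoI)
      fix e :: real assume e: "e > 0"
      \<comment> \<open>Dividing by L + 1 rather than L covers L = 0 as well.\<close>
      define \<epsilon> where "\<epsilon> = e / (L + 1)"
      have \<epsilon>: "\<epsilon> > 0" "L * \<epsilon> < e"
        using e T by (auto simp: \<epsilon>_def field_simps)
      have "\<forall>\<^sub>F n in sequentially. \<forall>q\<in>?K. dist (z n q) (zl q) < \<epsilon>"
        using lim \<epsilon>(1) by (rule uniform_limitD)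
      then show "\<forall>\<^sub>F n in sequentially. dist (I (z n) q) (I zl q) < e"
      proof eventually_elim
        case (elim n)
        then show ?case using close[of n \<epsilon>] \<epsilon>(2) by (force simp: dist_norm)
      qed
    qed
    then have "(\<lambda>n. z (Suc n) q) \<longlonglongrightarrow> snd q *\<^sub>R I zl q"
      unfolding zS by (intro tendsto_intros)
    moreover have "(\<lambda>n. z (Suc n) q) \<longlonglongrightarrow> zl q"
      using tendsto_uniform_limitI[OF lim q] by (rule LIMSEQ_Suc)
    ultimately show ?thesis using LIMSEQ_unique by blast
  qed
  show thesis
  proof
    show "continuous_on ?K zl" using okl by (simp add: ok_def)
    show "zl q \<in> W" if "q \<in> ?K" for q using okl that by (auto simp: ok_def)
    show "zl (x, 0) = 0" if "x \<in> P" for x using fixpoint[of "(x, 0)"] that T by simp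
    fix x s assume x: "x \<in> P" and s: "s \<in> {-T..T}"
    let ?f = "\<lambda>s. G ((x, s), zl (x, s))"
    have cz: "continuous_on {-T..T} (\<lambda>s. zl (x, s))"
      by (rule continuous_on_compose2[of ?K zl]) (use okl x in \<open>auto simp: ok_def intro!: continuous_intros\<close>)
    have "continuous_on {-T..T} ?f"
      by (rule continuous_on_compose2[OF contG]) (use okl x in \<open>auto simp: ok_def intro!: continuous_intros cz\<close>)
    then obtain J where J: "\<And>\<sigma>. \<sigma> \<in> {-T..T} \<Longrightarrow> (J has_vector_derivative ?f \<sigma>) (at \<sigma> within {-T..T})"
      using antiderivative_continuous by blast
    have eq: "zl (x, s) = J s - J 0" if "s \<in> {-T..T}" for s
      using fixpoint[of "(x, s)"] scaled_integral_eq_primitive[OF J that] x that by (simp add: I_def)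
    have "((\<lambda>s. J s - J 0) has_vector_derivative ?f s) (at s within {-T..T})"
      using has_vector_derivative_diff[OF J[OF s] has_vector_derivative_const[of "J 0"]] by simp
    from has_vector_derivative_transform[OF s eq this]
    show "((\<lambda>s. zl (x, s)) has_vector_derivative ?f s) (at s within {-T..T})" by simp
  qed
qed

subsection \<open>Smooth dependence of solutions on parameters\<close>

text \<open>In finite dimension, continuity for each fixed argument gives a bound on the operator
  norm that is uniform over a compact set.\<close>

lemma bounded_on_compact_linear_family:
  fixes A :: "'a::euclidean_space \<Rightarrow> 'q::topological_space \<Rightarrow> 'b::real_normed_vector"
  assumes "compact K" and cont: "\<And>c. continuous_on K (A c)"
    and lin: "\<And>q. q \<in> K \<Longrightarrow> linear (\<lambda>c. A c q)"
  obtains L where "L \<ge> 0" "\<And>q c. q \<in> K \<Longrightarrow> norm (A c q) \<le> L * norm c"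
proof -
  have "\<exists>B. \<forall>q\<in>K. norm (A b q) \<le> B" for b
    using compact_imp_bounded[OF compact_continuous_image[OF cont \<open>compact K\<close>]]
    by (auto simp: bounded_iff)
  then obtain B where B: "\<And>b q. q \<in> K \<Longrightarrow> norm (A b q) \<le> B b" by metis
  show thesis
  proof (rule that[of "\<Sum>b\<in>Basis. \<bar>B b\<bar>"])
    fix q c assume q: "q \<in> K"
    have "norm (A c q) = norm (\<Sum>b\<in>Basis. (c \<bullet> b) *\<^sub>R A b q)"
      using linear_euclidean_expand[OF lin[OF q]] by metis
    also have "\<dots> \<le> (\<Sum>b\<in>Basis. norm c * \<bar>B b\<bar>)"
      by (intro sum_norm_le)
        (use B[OF q] in \<open>auto intro!: mult_mono simp: Basis_le_norm intro: order_trans[OF B[OF q] abs_ge_self]\<close>)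
    finally show "norm (A c q) \<le> (\<Sum>b\<in>Basis. \<bar>B b\<bar>) * norm c"
      by (simp add: sum_distrib_left mult.commute)
  qed (simp add: sum_nonneg)
qed

text \<open>A linear right side is Lipschitz on the whole space, so W = UNIV is invariant and the
  solution lives on the entire given interval. That is what the linearisation along an existing
  solution requires.\<close>

lemma linear_ode_exists:
  fixes A :: "'b::euclidean_space \<Rightarrow> 'p::metric_space \<times> real \<Rightarrow> 'b"
  assumes "compact P" "T \<ge> 0" and A: "\<And>w. continuous_on (P \<times> {-T..T}) (A w)" "continuous_on (P \<times> {-T..T}) c"
    and lin: "\<And>q. q \<in> P \<times> {-T..T} \<Longrightarrow> linear (\<lambda>w. A w q)"
  obtains z where "continuous_on (P \<times> {-T..T}) z" "\<And>x. x \<in> P \<Longrightarrow> z (x, 0) = 0"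
    "\<And>x s. x \<in> P \<Longrightarrow> s \<in> {-T..T} \<Longrightarrow>
      ((\<lambda>s. z (x, s)) has_vector_derivative A (z (x, s)) (x, s) + c (x, s)) (at s within {-T..T})"
proof -
  let ?K = "P \<times> {-T..T}"
  have K: "compact ?K" using \<open>compact P\<close> by (intro compact_Times) auto
  obtain L where L: "L \<ge> 0" "\<And>q w. q \<in> ?K \<Longrightarrow> norm (A w q) \<le> L * norm w"
    using bounded_on_compact_linear_family[OF K A(1) lin] by metis
  obtain M where M: "\<And>q. q \<in> ?K \<Longrightarrow> norm (c q) \<le> M"
    using compact_imp_bounded[OF compact_continuous_image[OF A(2) K]] by (auto simp: bounded_iff)
  let ?G = "\<lambda>p. A (snd p) (fst p) + c (fst p)"
  have exp: "A w q = (\<Sum>b\<in>Basis. (w \<bullet> b) *\<^sub>R A b q)" if "q \<in> ?K" for w q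
    using linear_euclidean_expand[OF lin[OF that]] .
  have fst: "continuous_on (?K \<times> UNIV) (\<lambda>p::('p \<times> real) \<times> 'b. h (fst p))" if "continuous_on ?K h" for h :: "_ \<Rightarrow> 'b"
    by (rule continuous_on_compose2[OF that]) (auto intro!: continuous_intros)
  \<comment> \<open>Joint continuity in (q, w) follows from continuity in q at each basis
    vector.\<close>
  have "continuous_on (?K \<times> UNIV) (\<lambda>p. (\<Sum>b\<in>Basis. (snd p \<bullet> b) *\<^sub>R A b (fst p)) + c (fst p))"
    by (intro continuous_intros fst A)
  then have contG: "continuous_on (?K \<times> UNIV) ?G"
    by (rule continuous_on_cong[THEN iffD1, rotated -1]) (auto simp: exp)
  obtain z where "continuous_on ?K z" "\<And>x. x \<in> P \<Longrightarrow> z (x, 0) = 0"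
    "\<And>x s. x \<in> P \<Longrightarrow> s \<in> {-T..T} \<Longrightarrow>
      ((\<lambda>s. z (x, s)) has_vector_derivative ?G ((x, s), z (x, s))) (at s within {-T..T})"
  proof (rule picard_exists[of UNIV P T ?G "\<bar>M\<bar>" L])
    show "norm (?G (q, 0)) \<le> \<bar>M\<bar>" if "q \<in> ?K" for q
      using M[OF that] linear_0[OF lin[OF that]] by simp
    show "norm (?G (q, a) - ?G (q, b)) \<le> L * norm (a - b)" if "q \<in> ?K" for q a b
      using L(2)[OF that, of "a - b"] linear_diff[OF lin[OF that], of a b] by simp
  qed (use contG L \<open>T \<ge> 0\<close> in auto)
  then show thesis using that by simp
qed

text \<open>The candidate \<omega> v for the derivative of z in the parameter direction v solves the
  linearised equation along the graph of z. Gronwall applied to z y - z x - \<omega> (y - x) shows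
  that the error is of smaller order than |y - x|. Shrinking to V and T' provides the compact set on
  which all constants are uniform.\<close>

lemma ode_C1_dependence:
  fixes G :: "('p::euclidean_space \<times> real) \<times> 'b::euclidean_space \<Rightarrow> 'b"
  assumes G: "Ck_on (Suc 0) G S" and "open S" "open U" and contz: "continuous_on (U \<times> {-T<..<T}) z"
    and z0: "\<And>x. x \<in> U \<Longrightarrow> z (x, 0) = 0"
    and graph: "\<And>q. q \<in> U \<times> {-T<..<T} \<Longrightarrow> (q, z q) \<in> S"
    and ode: "\<And>x s. x \<in> U \<Longrightarrow> s \<in> {-T<..<T} \<Longrightarrow>
      ((\<lambda>s. z (x, s)) has_vector_derivative G ((x, s), z (x, s))) (at s)"
    and x1: "x1 \<in> U" and s1: "s1 \<in> {-T<..<T}"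
  obtains V T' \<omega> where "open V" "x1 \<in> V" "V \<subseteq> U" "s1 \<in> {-T'<..<T'}" "T' < T"
    "\<And>v. continuous_on (V \<times> {-T'<..<T'}) (\<omega> v)"
    "\<And>v x. x \<in> V \<Longrightarrow> \<omega> v (x, 0) = 0"
    "\<And>v x s. x \<in> V \<Longrightarrow> s \<in> {-T'<..<T'} \<Longrightarrow> ((\<lambda>s. \<omega> v (x, s)) has_vector_derivative
      frechet_derivative G (at ((x, s), z (x, s))) ((v, 0), \<omega> v (x, s))) (at s)"
    "\<And>x s. x \<in> V \<Longrightarrow> s \<in> {-T'<..<T'} \<Longrightarrow>
      (z has_derivative (\<lambda>(v, \<sigma>). \<omega> v (x, s) + \<sigma> *\<^sub>R G ((x, s), z (x, s)))) (at (x, s))"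
proof -
  obtain \<rho> where \<rho>: "\<rho> > 0" "cball x1 \<rho> \<subseteq> U"
    using \<open>open U\<close> x1 open_contains_cball by blast
  \<comment> \<open>Midpoint of |s1| and T, so the closed interval of radius T' contains s1 and
    stays inside the domain.\<close>
  define T' where "T' = (\<bar>s1\<bar> + T) / 2"
  have T': "s1 \<in> {-T'<..<T'}" "T' < T" "T' > 0" using s1 by (auto simp: T'_def abs_if field_simps)
  define V where "V = ball x1 \<rho>"
  let ?K = "cball x1 \<rho> \<times> {-T'..T'}"
  have V: "open V" "x1 \<in> V" "V \<subseteq> cball x1 \<rho>" using \<rho> by (auto simp: V_def)
  have sub: "?K \<subseteq> U \<times> {-T<..<T}" using \<rho> T' by auto
  have K: "compact ?K" by (intro compact_Times) auto
  have contzK: "continuous_on ?K z" using contz sub by (rule continuous_on_subset)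
  define A where "A = (\<lambda>c q. frechet_derivative G (at (q, z q)) c)"
  have DG: "(G has_derivative frechet_derivative G (at Q)) (at Q)" if "Q \<in> S" for Q
    using Ck_on_SucD[OF G that] .
  have linA: "linear (\<lambda>c. A c q)" if "q \<in> ?K" for q
    unfolding A_def using has_derivative_linear[OF DG[OF graph[OF subsetD[OF sub that]]]] .
  have contA: "continuous_on ?K (A c)" for c
    unfolding A_def
  proof (rule continuous_on_compose2[where f="\<lambda>q. (q, z q)" and s="?K" and t=S
        and g="\<lambda>Q. frechet_derivative G (at Q) c"])
    show "continuous_on S (\<lambda>Q. frechet_derivative G (at Q) c)"
      using Ck_on_derivative[OF G] by simp
    show "continuous_on ?K (\<lambda>q. (q, z q))" by (intro continuous_intros contzK)
    show "(\<lambda>q. (q, z q)) ` ?K \<subseteq> S" using graph sub by blast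
  qed
  obtain L where L: "L \<ge> 0" "\<And>q c. q \<in> ?K \<Longrightarrow> norm (A c q) \<le> L * norm c"
    using bounded_on_compact_linear_family[OF K contA linA] by metis
  have "\<exists>w. continuous_on ?K w \<and> (\<forall>x\<in>cball x1 \<rho>. w (x, 0) = 0) \<and>
      (\<forall>x\<in>cball x1 \<rho>. \<forall>s\<in>{-T'..T'}. ((\<lambda>s. w (x, s)) has_vector_derivative
        A ((0, 0), w (x, s)) (x, s) + A ((b, 0), 0) (x, s)) (at s within {-T'..T'}))" for b
  proof -
    have "linear (\<lambda>w::'b. ((0::'p, 0::real), w))" by (intro linearI) auto
    then have lin: "linear (\<lambda>w. A ((0, 0), w) q)" if "q \<in> ?K" for q
      using linear_compose[OF _ linA[OF that]] by (simp add: o_def)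
    show ?thesis
      by (rule linear_ode_exists[where A="\<lambda>w. A ((0, 0), w)" and c="A ((b, 0), 0)",
            OF compact_cball less_imp_le[OF T'(3)] contA contA lin]) blast+
  qed
  then obtain w where w: "\<And>b. continuous_on ?K (w b)" "\<And>b x. x \<in> cball x1 \<rho> \<Longrightarrow> w b (x, 0) = 0"
    "\<And>b x s. x \<in> cball x1 \<rho> \<Longrightarrow> s \<in> {-T'..T'} \<Longrightarrow> ((\<lambda>s. w b (x, s)) has_vector_derivative
        A ((0, 0), w b (x, s)) (x, s) + A ((b, 0), 0) (x, s)) (at s within {-T'..T'})"
    by metis
  \<comment> \<open>Only the basis directions are solved for; combining them makes \<omega> linear
    in v by construction, without a uniqueness argument.\<close>
  define \<omega> where "\<omega> = (\<lambda>v q. \<Sum>b\<in>Basis. (v \<bullet> b) *\<^sub>R w b q)"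
  have cont\<omega>: "continuous_on ?K (\<omega> v)" for v
    unfolding \<omega>_def by (intro continuous_intros w)
  have lin\<omega>: "linear (\<lambda>v. \<omega> v q)" for q
    unfolding \<omega>_def
    by (intro linearI) (simp_all add: inner_add_left scaleR_add_left sum.distrib scaleR_sum_right)
  have \<omega>0: "\<omega> v (x, 0) = 0" if "x \<in> cball x1 \<rho>" for v x
    using w(2)[OF that] by (simp add: \<omega>_def)
  have d\<omega>: "((\<lambda>s. \<omega> v (x, s)) has_vector_derivative A ((v, 0), \<omega> v (x, s)) (x, s)) (at s within {-T'..T'})"
    if x: "x \<in> cball x1 \<rho>" and s: "s \<in> {-T'..T'}" for v x s
  proof -
    have lin: "linear (\<lambda>c. A c (x, s))" using linA x s by auto
    have "((\<lambda>s. \<omega> v (x, s)) has_vector_derivative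
        (\<Sum>b\<in>Basis. (v \<bullet> b) *\<^sub>R (A ((0, 0), w b (x, s)) (x, s) + A ((b, 0), 0) (x, s)))) (at s within {-T'..T'})"
      unfolding \<omega>_def
      by (intro has_vector_derivative_sum bounded_linear.has_vector_derivative[OF bounded_linear_scaleR_right] w(3) x s)
    also have "(\<Sum>b\<in>Basis. (v \<bullet> b) *\<^sub>R (A ((0, 0), w b (x, s)) (x, s) + A ((b, 0), 0) (x, s)))
        = A (\<Sum>b\<in>Basis. (v \<bullet> b) *\<^sub>R ((b, 0), w b (x, s))) (x, s)"
    proof -
      have "A ((0, 0), w b (x, s)) (x, s) + A ((b, 0), 0) (x, s) = A ((b, 0), w b (x, s)) (x, s)" for b
        using linear_add[OF lin, of "((0, 0), w b (x, s))" "((b, 0), 0)"] by simp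
      then show ?thesis
        by (simp only: linear_sum[OF lin] linear_scale[OF lin])
    qed
    also have "(\<Sum>b\<in>Basis. (v \<bullet> b) *\<^sub>R ((b, 0::real), w b (x, s))) = ((v, 0), \<omega> v (x, s))"
      by (simp add: prod_eq_iff fst_sum snd_sum euclidean_representation \<omega>_def)
    finally show ?thesis .
  qed
  obtain C where C: "C \<ge> 0" "\<And>q v. q \<in> ?K \<Longrightarrow> norm (\<omega> v q) \<le> C * norm v"
    using bounded_on_compact_linear_family[OF K cont\<omega> lin\<omega>] by metis
  have dzx: "((\<lambda>x. z (x, s)) has_derivative (\<lambda>v. \<omega> v (x, s))) (at x)"
    if x: "x \<in> V" and s: "s \<in> {-T'<..<T'}" for x s
    unfolding has_derivative_at_alt
  proof (intro conjI allI impI)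
    show "bounded_linear (\<lambda>v. \<omega> v (x, s))" using lin\<omega> by (simp add: linear_conv_bounded_linear)
    fix e :: real assume "e > 0"
    \<comment> \<open>The factor 1 + C comes from bounding the distance of the two graph points by
      (1 + C) |v| + |E|. In the rate, L is the linearised coefficient and the extra 1 absorbs
      \<epsilon> |E|, which is why \<epsilon> \<le> 1 is imposed.\<close>
    define \<kappa> where "\<kappa> = (1 + C) * exp ((2 * (L + 1) + 1) * T')"
    define \<epsilon> where "\<epsilon> = min 1 (e / \<kappa>)"
    have "\<kappa> > 0" unfolding \<kappa>_def using C(1) by (intro mult_pos_pos) auto
    then have \<epsilon>: "\<epsilon> > 0" "\<epsilon> \<le> 1" "\<epsilon> * \<kappa> \<le> e"
      using \<open>e > 0\<close> by (auto simp: \<epsilon>_def min_def field_simps)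
    have gr: "compact ((\<lambda>q. (q, z q)) ` ?K)"
      by (intro compact_continuous_image continuous_intros contzK K)
    have grS: "(\<lambda>q. (q, z q)) ` ?K \<subseteq> S" using graph sub by blast
    obtain \<eta> where "\<eta> > 0" and \<eta>: "\<And>Q Q'. Q \<in> (\<lambda>q. (q, z q)) ` ?K \<Longrightarrow> norm (Q' - Q) < \<eta> \<Longrightarrow>
       norm (G Q' - G Q - frechet_derivative G (at Q) (Q' - Q)) \<le> \<epsilon> * norm (Q' - Q)"
      by (rule Ck_on_uniform_linearization[OF G \<open>open S\<close> gr grS \<epsilon>(1)]) blast
    obtain d1 where "d1 > 0" and d1: "\<And>q q'. q \<in> ?K \<Longrightarrow> q' \<in> ?K \<Longrightarrow> dist q' q < d1 \<Longrightarrow> dist (z q') (z q) < \<eta> / 2"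
      using compact_uniformly_continuous[OF contzK K, unfolded uniformly_continuous_on_def, rule_format,
          OF half_gt_zero[OF \<open>\<eta> > 0\<close>]]
      by blast
    obtain d2 where "d2 > 0" and d2: "ball x d2 \<subseteq> V" using V(1) x open_contains_ball by blast
    define d where "d = min (min d1 d2) (\<eta> / 2)"
    have d: "d > 0" "d \<le> d1" "d \<le> d2" "d \<le> \<eta> / 2" using \<open>d1 > 0\<close> \<open>d2 > 0\<close> \<open>\<eta> > 0\<close> by (auto simp: d_def)
    show "\<exists>d>0. \<forall>y. norm (y - x) < d \<longrightarrow> norm (z (y, s) - z (x, s) - \<omega> (y - x) (x, s)) \<le> e * norm (y - x)"
    proof (intro exI[of _ d] conjI allI impI)
      fix y assume y: "norm (y - x) < d"
      then have "y \<in> V" using d d2 by (auto simp: dist_norm norm_minus_commute)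
      then have xy: "x \<in> cball x1 \<rho>" "y \<in> cball x1 \<rho>" "x \<in> U" "y \<in> U" using x V(3) \<rho>(2) by auto
      let ?v = "y - x"
      let ?E = "\<lambda>s. z (y, s) - z (x, s) - \<omega> ?v (x, s)"
      let ?E' = "\<lambda>s. G ((y, s), z (y, s)) - G ((x, s), z (x, s)) - A ((?v, 0), \<omega> ?v (x, s)) (x, s)"
      have "norm (?E s) \<le> \<epsilon> * (1 + C) * norm ?v * exp ((2 * (L + 1) + 1) * T')"
      proof (rule gronwall[where e="?E" and e'="?E'"])
        show "?E 0 = 0" using z0 \<omega>0 xy by simp
        show "s \<in> {-T'..T'}" using s by auto
        show "0 \<le> L + 1" using L by simp
        show "0 \<le> \<epsilon> * (1 + C) * norm ?v" using \<epsilon> C by simp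
        fix t assume t: "t \<in> {-T'..T'}"
        then have tT: "t \<in> {-T<..<T}" using T' by auto
        show "(?E has_vector_derivative ?E' t) (at t within {-T'..T'})"
          by (intro has_vector_derivative_diff d\<omega> has_vector_derivative_at_within[OF ode] xy t tT)
        let ?Q = "((x, t), z (x, t))" and ?Q' = "((y, t), z (y, t))"
        have Q: "?Q \<in> (\<lambda>q. (q, z q)) ` ?K" using xy t by auto
        have QQ: "?Q' - ?Q = ((?v, 0), z (y, t) - z (x, t))" by simp
        have nQ: "norm (?Q' - ?Q) \<le> norm ?v + norm (z (y, t) - z (x, t))"
          unfolding QQ using norm_Pair_le[of "(?v, 0::real)" "z (y, t) - z (x, t)"] norm_Pair_le[of ?v "0::real"] by simp
        have "dist (y, t) (x, t) < d1" using y d by (simp add: dist_Pair_Pair dist_norm)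
        then have "norm (z (y, t) - z (x, t)) < \<eta> / 2"
          using d1[of "(x, t)" "(y, t)"] xy t by (auto simp: dist_norm)
        then have "norm (?Q' - ?Q) < \<eta>" using nQ y d by linarith
        from \<eta>[OF Q this]
        have 1: "norm (G ?Q' - G ?Q - A (?Q' - ?Q) (x, t)) \<le> \<epsilon> * norm (?Q' - ?Q)" by (simp add: A_def)
        have lin: "linear (\<lambda>c. A c (x, t))" using linA xy t by auto
        have AE: "A (?Q' - ?Q) (x, t) - A ((?v, 0), \<omega> ?v (x, t)) (x, t) = A ((0, 0), ?E t) (x, t)"
          using linear_diff[OF lin, of "?Q' - ?Q" "((?v, 0), \<omega> ?v (x, t))"] by (simp add: zero_prod_def)
        \<comment> \<open>Splits the error's derivative into the Taylor remainder of G, controlled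
          by \<epsilon>, and the linearisation applied to the error itself, controlled by L.\<close>
        have eq: "?E' t = (G ?Q' - G ?Q - A (?Q' - ?Q) (x, t)) + A ((0, 0), ?E t) (x, t)"
          unfolding AE[symmetric] by (simp only: add_diff_eq diff_add_cancel)
        have 2: "norm (A ((0, 0), ?E t) (x, t)) \<le> L * norm (?E t)"
          using L(2)[of "(x, t)" "((0, 0), ?E t)"] xy t by (simp add: norm_Pair flip: zero_prod_def)
        have "norm (z (y, t) - z (x, t)) \<le> norm (?E t) + C * norm ?v"
          using norm_triangle_ineq[of "?E t" "\<omega> ?v (x, t)"] C(2)[of "(x, t)" ?v] xy t by simp
        then have "norm (?Q' - ?Q) \<le> (1 + C) * norm ?v + norm (?E t)"
          using nQ by (simp add: algebra_simps)
        then have "\<epsilon> * norm (?Q' - ?Q) \<le> \<epsilon> * ((1 + C) * norm ?v + norm (?E t))"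
          using \<epsilon>(1) by (intro mult_left_mono) auto
        also have "\<dots> \<le> \<epsilon> * (1 + C) * norm ?v + 1 * norm (?E t)"
          using mult_right_mono[OF \<epsilon>(2), of "norm (?E t)"] by (simp add: algebra_simps)
        finally have 3: "\<epsilon> * norm (?Q' - ?Q) \<le> \<epsilon> * (1 + C) * norm ?v + norm (?E t)" by simp
        show "norm (?E' t) \<le> (L + 1) * norm (?E t) + \<epsilon> * (1 + C) * norm ?v"
          unfolding eq using norm_triangle_ineq[of "G ?Q' - G ?Q - A (?Q' - ?Q) (x, t)" "A ((0, 0), ?E t) (x, t)"] 1 2 3
          by (simp add: distrib_right)
      qed
      also have "\<dots> = \<epsilon> * \<kappa> * norm ?v" by (simp add: \<kappa>_def)
      also have "\<dots> \<le> e * norm ?v" using \<epsilon>(3) by (intro mult_right_mono) auto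
      finally show "norm (z (y, s) - z (x, s) - \<omega> (y - x) (x, s)) \<le> e * norm (y - x)" .
    qed (use d in auto)
  qed
  have dz: "(z has_derivative (\<lambda>(v, \<sigma>). \<omega> v (x, s) + \<sigma> *\<^sub>R G ((x, s), z (x, s)))) (at (x, s))"
    if x: "x \<in> V" and s: "s \<in> {-T'<..<T'}" for x s
  proof -
    have VI: "V \<times> {-T'<..<T'} \<subseteq> U \<times> {-T<..<T}" using V \<rho> T' by auto
    \<comment> \<open>Joint differentiability at a point needs continuity of one partial derivative
      only: the one in s, which the equation gives explicitly as G along the graph.\<close>
    have "((\<lambda>(x, s). z (x, s)) has_derivative
        (\<lambda>(v, \<sigma>). \<omega> v (x, s) + blinfun_scaleR_left (G ((x, s), z (x, s))) \<sigma>)) (at (x, s) within V \<times> {-T'<..<T'})"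
    proof (rule has_derivative_partialsI[where f="\<lambda>x s. z (x, s)"
          and fy="\<lambda>x s. blinfun_scaleR_left (G ((x, s), z (x, s)))"])
      show "((\<lambda>x. z (x, s)) has_derivative (\<lambda>v. \<omega> v (x, s))) (at x within V)"
        using dzx[OF x s] by (rule has_derivative_at_withinI)
      show "((\<lambda>s. z (x, s)) has_derivative blinfun_scaleR_left (G ((x, s), z (x, s)))) (at s within {-T'<..<T'})"
        if "x \<in> V" "s \<in> {-T'<..<T'}" for x s
      proof -
        have "x \<in> U" "s \<in> {-T<..<T}" using subsetD[OF VI, of "(x, s)"] that by auto
        from ode[OF this] show ?thesis
          unfolding has_vector_derivative_def blinfun_scaleR_left.rep_eq by (rule has_derivative_at_withinI)
      qed
      have "continuous_on (U \<times> {-T<..<T}) (\<lambda>q. (q, z q))" by (intro continuous_intros contz)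
      from continuous_on_compose2[OF Ck_on_imp_continuous_on[OF G] this] graph
      have "continuous_on (U \<times> {-T<..<T}) (\<lambda>q. G (q, z q))" by blast
      then have "continuous_on (V \<times> {-T'<..<T'}) (\<lambda>q. G (q, z q))" by (rule continuous_on_subset[OF _ VI])
      then have "continuous_on (V \<times> {-T'<..<T'}) (\<lambda>q. blinfun_scaleR_left (G (q, z q)))"
        by (intro continuous_intros)
      then have "continuous (at (x, s) within V \<times> {-T'<..<T'}) (\<lambda>q. blinfun_scaleR_left (G (q, z q)))"
        using x s by (simp add: continuous_on_eq_continuous_within)
      moreover have "(\<lambda>q. blinfun_scaleR_left (G (q, z q))) = (\<lambda>(x, s). blinfun_scaleR_left (G ((x, s), z (x, s))))"
        by (simp add: fun_eq_iff)
      ultimately show "continuous (at (x, s) within V \<times> {-T'<..<T'})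
          (\<lambda>(x, s). blinfun_scaleR_left (G ((x, s), z (x, s))))" by simp
    qed (use s in auto)
    moreover have "at (x, s) within V \<times> {-T'<..<T'} = at (x, s)"
      by (rule at_within_open) (use x s V in \<open>auto intro!: open_Times\<close>)
    ultimately show ?thesis by (simp add: case_prod_unfold)
  qed
  show thesis
  proof (rule that[of V T' \<omega>])
    have sub: "V \<times> {-T'<..<T'} \<subseteq> ?K" using V by auto
    show "continuous_on (V \<times> {-T'<..<T'}) (\<omega> v)" for v
      using cont\<omega> sub by (rule continuous_on_subset)
    show "((\<lambda>s. \<omega> v (x, s)) has_vector_derivative
      frechet_derivative G (at ((x, s), z (x, s))) ((v, 0), \<omega> v (x, s))) (at s)"
      if "x \<in> V" "s \<in> {-T'<..<T'}" for v x s
    proof -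
      have "at s within {-T'..T'} = at s" using that by (intro at_within_interior) auto
      then show ?thesis using d\<omega>[of x s v] V that by (auto simp: A_def)
    qed
  qed (use V \<rho> T' \<omega>0 dz in auto)
qed

text \<open>
  The derivative of a solution in a parameter direction solves an equation of the same form over the
  same types. Allowing \<open>G\<close> to depend on \<open>x\<close> and \<open>s\<close> is what makes this induction on \<open>k\<close> possible.
\<close>

theorem ode_Ck_dependence:
  fixes G :: "('p::euclidean_space \<times> real) \<times> 'b::euclidean_space \<Rightarrow> 'b"
  assumes "Ck_on k G S" "open S" "open U" "continuous_on (U \<times> {-T<..<T}) z"
    and "\<And>x. x \<in> U \<Longrightarrow> z (x, 0) = 0"
    and "\<And>q. q \<in> U \<times> {-T<..<T} \<Longrightarrow> (q, z q) \<in> S"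
    and "\<And>x s. x \<in> U \<Longrightarrow> s \<in> {-T<..<T} \<Longrightarrow>
      ((\<lambda>s. z (x, s)) has_vector_derivative G ((x, s), z (x, s))) (at s)"
  shows "Ck_on k z (U \<times> {-T<..<T})"
  using assms
proof (induction k arbitrary: G S U T z)
  case 0
  then show ?case by simp
next
  case (Suc k)
  show ?case
  proof (rule Ck_on_localI, clarify)
    fix x1 s1 assume p: "x1 \<in> U" "s1 \<in> {-T<..<T}"
    have C1: "Ck_on (Suc 0) G S" using Suc.prems(1) by (rule Ck_on_mono) simp
    show "\<exists>N. open N \<and> (x1, s1) \<in> N \<and> Ck_on (Suc k) z N"
    proof (rule ode_C1_dependence[of G S U T z x1 s1])
      fix V T' \<omega>
      assume V: "open V" "x1 \<in> V" "V \<subseteq> U" "s1 \<in> {-T'<..<T'}" "T' < T"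
        and \<omega>: "\<And>v. continuous_on (V \<times> {-T'<..<T'}) (\<omega> v)"
        "\<And>v x. x \<in> V \<Longrightarrow> \<omega> v (x, 0) = 0"
        "\<And>v x s. x \<in> V \<Longrightarrow> s \<in> {-T'<..<T'} \<Longrightarrow> ((\<lambda>s. \<omega> v (x, s)) has_vector_derivative
          frechet_derivative G (at ((x, s), z (x, s))) ((v, 0), \<omega> v (x, s))) (at s)"
        and dz: "\<And>x s. x \<in> V \<Longrightarrow> s \<in> {-T'<..<T'} \<Longrightarrow>
          (z has_derivative (\<lambda>(v, \<sigma>). \<omega> v (x, s) + \<sigma> *\<^sub>R G ((x, s), z (x, s)))) (at (x, s))"
      let ?N = "V \<times> {-T'<..<T'}"
      have N: "open ?N" "?N \<subseteq> U \<times> {-T<..<T}" using V by (auto intro!: open_Times)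
      \<comment> \<open>First use of the induction hypothesis: z is C^k, hence so are the
        coefficients of the linearised equation along its graph.\<close>
      have "Ck_on k z (U \<times> {-T<..<T})"
        by (rule Suc.IH[of G S U T z], rule Ck_on_Suc_imp[OF Suc.prems(1)]) (fact Suc.prems)+
      then have "Ck_on k z ?N" by (rule Ck_on_subset[OF _ N(2)])
      then have Q: "Ck_on k (\<lambda>q. (q, z q)) ?N" by (intro Ck_on_Pair Ck_on_ident N)
      have QS: "(\<lambda>q. (q, z q)) ` ?N \<subseteq> S" using Suc.prems(6) N(2) by blast
      let ?A = "\<lambda>c q. frechet_derivative G (at (q, z q)) c"
      have A: "Ck_on k (?A c) ?N" for c
        by (rule Ck_on_compose[OF N(1) Suc.prems(2) Q Ck_on_derivative[OF Suc.prems(1)] QS])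
      have linA: "linear (\<lambda>c. ?A c q)" if "q \<in> ?N" for q
        using has_derivative_linear[OF Ck_on_SucD[OF Suc.prems(1)]] QS that by blast
      have "Ck_on (Suc k) z ?N"
      proof (rule Ck_on_SucI[OF _ N(1)])
        show "(z has_derivative (\<lambda>v. \<omega> (fst v) q + snd v *\<^sub>R G (q, z q))) (at q)" if "q \<in> ?N" for q
          using dz[of "fst q" "snd q"] that by (simp add: case_prod_unfold mem_Times_iff)
        \<comment> \<open>Second use, for the linearised equation with \<omega> v as its solution.
          Expanding the unknown over the basis exhibits the right side as C^k jointly in point, time
          and unknown.\<close>
        have "Ck_on k (\<omega> v) ?N" for v
        proof (rule Suc.IH[of "\<lambda>p. ?A ((v, 0), 0) (fst p) + (\<Sum>e\<in>Basis. (snd p \<bullet> e) *\<^sub>R ?A ((0, 0), e) (fst p))" "?N \<times> UNIV"])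
          have o: "open (?N \<times> (UNIV :: 'b set))" using V(1) by (intro open_Times) auto
          have cf: "Ck_on k (\<lambda>p. ?A c (fst p)) (?N \<times> (UNIV :: 'b set))" for c
            by (rule Ck_on_compose[OF o N(1) Ck_on_linear[OF bounded_linear_fst o] A]) auto
          show "Ck_on k (\<lambda>p. ?A ((v, 0), 0) (fst p) + (\<Sum>e\<in>Basis. (snd p \<bullet> e) *\<^sub>R ?A ((0, 0), e) (fst p))) (?N \<times> UNIV)"
            by (intro Ck_on_add Ck_on_sum Ck_on_scaleR cf o
                Ck_on_bounded_linear[OF bounded_linear_inner_left] Ck_on_linear[OF bounded_linear_snd])
          show "open (?N \<times> (UNIV :: 'b set))" by (rule o)
          fix x s assume xs: "x \<in> V" "s \<in> {-T'<..<T'}"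
          then have lin: "linear (\<lambda>c. ?A c (x, s))" using linA by auto
          have eq: "?A ((v, 0), y) (x, s) = ?A ((v, 0), 0) (x, s) + (\<Sum>e\<in>Basis. (y \<bullet> e) *\<^sub>R ?A ((0, 0), e) (x, s))" for y
          proof -
            have "linear (\<lambda>w::'b. ((0::'p, 0::real), w))" by (intro linearI) auto
            from linear_compose[OF this lin] have "linear (\<lambda>w. ?A ((0, 0), w) (x, s))" by (simp add: o_def)
            from linear_euclidean_expand[OF this, of y] linear_add[OF lin, of "((v, 0), 0)" "((0, 0), y)"]
            show ?thesis by simp
          qed
          show "((\<lambda>s. \<omega> v (x, s)) has_vector_derivative
            (?A ((v, 0), 0) (fst ((x, s), \<omega> v (x, s))) + (\<Sum>e\<in>Basis. (snd ((x, s), \<omega> v (x, s)) \<bullet> e) *\<^sub>R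
              ?A ((0, 0), e) (fst ((x, s), \<omega> v (x, s)))))) (at s)"
            using \<omega>(3)[OF xs, of v, unfolded eq[of "\<omega> v (x, s)"]] by (simp only: fst_conv snd_conv)
        qed (use V \<omega> in auto)
        moreover have "Ck_on k (\<lambda>q. G (q, z q)) ?N"
          by (rule Ck_on_compose[OF N(1) Suc.prems(2) Q Ck_on_Suc_imp[OF Suc.prems(1)] QS])
        ultimately show "Ck_on k (\<lambda>q. \<omega> (fst v) q + snd v *\<^sub>R G (q, z q)) ?N" for v
          by (intro Ck_on_add Ck_on_scaleR Ck_on_const N)
      qed
      then show "\<exists>N. open N \<and> (x1, s1) \<in> N \<and> Ck_on (Suc k) z N" using N V by blast
    qed (fact C1 Suc.prems p)+
  qed
qed

text \<open>Uniqueness of derivatives identifies the \<omega> of \<open>ode_C1_dependence\<close>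
  with the actual derivative of z, so the equation no longer mentions an auxiliary map.\<close>

lemma ode_variational_equation:
  fixes G :: "('p::euclidean_space \<times> real) \<times> 'b::euclidean_space \<Rightarrow> 'b"
  assumes "Ck_on (Suc 0) G S" "open S" "open U" "continuous_on (U \<times> {-T<..<T}) z"
    and "\<And>x. x \<in> U \<Longrightarrow> z (x, 0) = 0"
    and "\<And>q. q \<in> U \<times> {-T<..<T} \<Longrightarrow> (q, z q) \<in> S"
    and "\<And>x s. x \<in> U \<Longrightarrow> s \<in> {-T<..<T} \<Longrightarrow>
      ((\<lambda>s. z (x, s)) has_vector_derivative G ((x, s), z (x, s))) (at s)"
    and "x \<in> U" "s \<in> {-T<..<T}"
  shows "((\<lambda>s. frechet_derivative z (at (x, s)) (v, 0)) has_vector_derivative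
    frechet_derivative G (at ((x, s), z (x, s))) ((v, 0), frechet_derivative z (at (x, s)) (v, 0))) (at s)"
proof (rule ode_C1_dependence[of G S U T z x s])
  fix V T' \<omega>
  assume V: "x \<in> V" "s \<in> {-T'<..<T'}"
    and \<omega>: "\<And>v x s. x \<in> V \<Longrightarrow> s \<in> {-T'<..<T'} \<Longrightarrow> ((\<lambda>s. \<omega> v (x, s)) has_vector_derivative
      frechet_derivative G (at ((x, s), z (x, s))) ((v, 0), \<omega> v (x, s))) (at s)"
    and dz: "\<And>x s. x \<in> V \<Longrightarrow> s \<in> {-T'<..<T'} \<Longrightarrow>
      (z has_derivative (\<lambda>(v, \<sigma>). \<omega> v (x, s) + \<sigma> *\<^sub>R G ((x, s), z (x, s)))) (at (x, s))"
  have eq: "\<omega> v (x, t) = frechet_derivative z (at (x, t)) (v, 0)" if "t \<in> {-T'<..<T'}" for t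
    using frechet_derivative_at[OF dz[OF V(1) that], symmetric] by simp
  from has_vector_derivative_transform_within_open[OF \<omega>[OF V, of v] _ V(2) eq]
  show ?thesis using eq[OF V(2)] by simp
qed (fact assms)+

text \<open>The unknown is the displacement z = \<phi> - x: it starts at 0, as the Picard lemma
  demands, and satisfies z' = F (x + z) with the starting point as parameter.\<close>

theorem local_flow:
  fixes F :: "'e::euclidean_space \<Rightarrow> 'e"
  assumes F: "smooth_on D F" and "open D" and x0: "x0 \<in> D"
  obtains T U \<phi> where "T > 0" "open U" "x0 \<in> U" "smooth_on (U \<times> {-T<..<T}) \<phi>"
    "\<And>x. x \<in> U \<Longrightarrow> \<phi> (x, 0) = x" "\<And>q. q \<in> U \<times> {-T<..<T} \<Longrightarrow> \<phi> q \<in> D"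
    "\<And>x s. x \<in> U \<Longrightarrow> s \<in> {-T<..<T} \<Longrightarrow> ((\<lambda>s. \<phi> (x, s)) has_vector_derivative F (\<phi> (x, s))) (at s)"
    "\<And>x s v. x \<in> U \<Longrightarrow> s \<in> {-T<..<T} \<Longrightarrow> ((\<lambda>s. frechet_derivative \<phi> (at (x, s)) (v, 0)) has_vector_derivative
       frechet_derivative F (at (\<phi> (x, s))) (frechet_derivative \<phi> (at (x, s)) (v, 0))) (at s)"
    "\<And>x v. x \<in> U \<Longrightarrow> frechet_derivative \<phi> (at (x, 0)) (v, 0) = v"
proof -
  obtain \<rho> L where \<rho>: "\<rho> > 0" "L \<ge> 0" "ball x0 \<rho> \<subseteq> D"
    and L: "\<And>a b. a \<in> ball x0 \<rho> \<Longrightarrow> b \<in> ball x0 \<rho> \<Longrightarrow> norm (F b - F a) \<le> L * norm (b - a)"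
    using Ck_on_locally_lipschitz[OF smooth_onD[OF F] \<open>open D\<close> x0] by blast
  \<comment> \<open>A start within R of x0 and a displacement of length at most R together stay
    within \<rho>/2, inside the Lipschitz ball.\<close>
  define R where "R = \<rho> / 4"
  define U where "U = ball x0 R"
  define M where "M = norm (F x0) + L * \<rho>"
  \<comment> \<open>The speed is at most M on that ball, so T M \<le> R keeps the displacement in
    \<open>cball 0 R\<close>; the 1 guards against M = 0.\<close>
  define T where "T = R / (M + 1)"
  have R: "R > 0" and M: "M \<ge> 0" using \<rho> by (simp_all add: R_def M_def)
  have T: "T > 0" "T * M \<le> R" using R M by (simp_all add: T_def field_simps)
  have U: "open U" "x0 \<in> U" using R by (simp_all add: U_def)
  have in\<rho>: "x + w \<in> ball x0 \<rho>" if "x \<in> U" "w \<in> cball 0 R" for x w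
    using that norm_triangle_ineq[of "x - x0" w] R
    by (simp add: U_def R_def dist_norm norm_minus_commute[of x0]) (simp add: algebra_simps)
  have FM: "norm (F y) \<le> M" if "y \<in> ball x0 \<rho>" for y
  proof -
    have "norm (F y - F x0) \<le> L * norm (y - x0)" using L[of x0 y] that \<rho>(1) by simp
    also have "\<dots> \<le> L * \<rho>" using that \<rho>(2) by (intro mult_left_mono) (auto simp: dist_norm norm_minus_commute)
    finally show ?thesis using norm_triangle_ineq2[of "F y" "F x0"] by (simp add: M_def)
  qed
  have contF: "continuous_on (ball x0 \<rho>) F"
    using smooth_on_imp_continuous_on[OF F] \<rho>(3) continuous_on_subset by blast
  let ?G = "\<lambda>p :: ('e \<times> real) \<times> 'e. F (fst (fst p) + snd p)"
  have contG: "continuous_on ((U \<times> {-T..T}) \<times> cball 0 R) ?G"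
    by (rule continuous_on_compose2[OF contF]) (use in\<rho> in \<open>auto intro!: continuous_intros\<close>)
  have G: "continuous_on (U \<times> {-T..T}) z \<Longrightarrow> z ` (U \<times> {-T..T}) \<subseteq> cball 0 R \<Longrightarrow> q \<in> U \<times> {-T..T} \<Longrightarrow>
      snd q *\<^sub>R integral {0..1} (\<lambda>\<tau>. ?G ((fst q, \<tau> * snd q), z (fst q, \<tau> * snd q))) \<in> cball 0 R" for z q
  proof -
    assume z: "continuous_on (U \<times> {-T..T}) z" "z ` (U \<times> {-T..T}) \<subseteq> cball 0 R" and q: "q \<in> U \<times> {-T..T}"
    have m: "(fst q, \<tau> * snd q) \<in> U \<times> {-T..T}" if "\<tau> \<in> {0..1}" for \<tau> :: real
    proof -
      have "\<bar>\<tau> * snd q\<bar> \<le> 1 * T"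
        unfolding abs_mult using q that by (intro mult_mono) auto
      then show ?thesis using q by auto
    qed
    have "continuous_on {0..1} (\<lambda>\<tau>. z (fst q, \<tau> * snd q))"
      by (rule continuous_on_compose2[OF z(1)]) (use m in \<open>auto intro!: continuous_intros\<close>)
    then have "continuous_on {0..1} (\<lambda>\<tau>. ((fst q, \<tau> * snd q), z (fst q, \<tau> * snd q)))"
      by (intro continuous_intros)
    from continuous_on_compose2[OF contG this] z(2) m
    have "continuous_on {0..1} (\<lambda>\<tau>. ?G ((fst q, \<tau> * snd q), z (fst q, \<tau> * snd q)))" by blast
    moreover have "norm (?G ((fst q, \<tau> * snd q), z (fst q, \<tau> * snd q))) \<le> M" if "\<tau> \<in> {0..1}" for \<tau>
    proof -
      have "z (fst q, \<tau> * snd q) \<in> cball 0 R" using z(2) m[OF that] by blast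
      then show ?thesis using FM[OF in\<rho>] q by auto
    qed
    ultimately have "norm (integral {0..1} (\<lambda>\<tau>. ?G ((fst q, \<tau> * snd q), z (fst q, \<tau> * snd q)))) \<le> M"
      using integral_bound[OF zero_le_one, of "\<lambda>\<tau>. ?G ((fst q, \<tau> * snd q), z (fst q, \<tau> * snd q))" M] by simp
    then have "\<bar>snd q\<bar> * norm (integral {0..1} (\<lambda>\<tau>. ?G ((fst q, \<tau> * snd q), z (fst q, \<tau> * snd q)))) \<le> T * M"
      using q T by (intro mult_mono) auto
    then show ?thesis using T by simp
  qed
  obtain z where z: "continuous_on (U \<times> {-T..T}) z" "\<And>x. x \<in> U \<Longrightarrow> z (x, 0) = 0"
    "\<And>q. q \<in> U \<times> {-T..T} \<Longrightarrow> z q \<in> cball 0 R"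
    "\<And>x s. x \<in> U \<Longrightarrow> s \<in> {-T..T} \<Longrightarrow>
      ((\<lambda>s. z (x, s)) has_vector_derivative ?G ((x, s), z (x, s))) (at s within {-T..T})"
  proof (rule picard_exists[of "cball 0 R" U T ?G M L])
    show "norm (?G (q, 0)) \<le> M" if "q \<in> U \<times> {-T..T}" for q
      using FM[OF in\<rho>[of "fst q" 0]] that R by auto
    show "norm (?G (q, a) - ?G (q, b)) \<le> L * norm (a - b)"
      if "q \<in> U \<times> {-T..T}" "a \<in> cball 0 R" "b \<in> cball 0 R" for q a b
      using L[OF in\<rho>[of "fst q" b] in\<rho>[of "fst q" a]] that by auto
  qed (use contG G R M T \<rho> in auto)
  let ?I = "{-T<..<T}"
  let ?S = "{p :: ('e \<times> real) \<times> 'e. fst (fst p) + snd p \<in> D}"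
  have S: "open ?S" by (rule open_vimage[OF \<open>open D\<close>, unfolded vimage_def]) (intro continuous_intros)
  have "bounded_linear (\<lambda>p :: ('e \<times> real) \<times> 'e. fst (fst p) + snd p)"
    by (intro bounded_linear_add bounded_linear_compose[OF bounded_linear_fst] bounded_linear_fst bounded_linear_snd)
  note lin = this
  have GS: "Ck_on k ?G ?S" for k
    by (rule Ck_on_compose[OF S \<open>open D\<close> Ck_on_linear[OF lin S] smooth_onD[OF F]]) auto
  have cz: "continuous_on (U \<times> ?I) z" using z(1) by (rule continuous_on_subset) auto
  have graph: "(q, z q) \<in> ?S" if "q \<in> U \<times> ?I" for q
    using in\<rho>[of "fst q" "z q"] z(3)[of q] that \<rho>(3) by auto
  have ode: "((\<lambda>s. z (x, s)) has_vector_derivative ?G ((x, s), z (x, s))) (at s)" if "x \<in> U" "s \<in> ?I" for x s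
  proof -
    have "at s within {-T..T} = at s" using that by (intro at_within_interior) auto
    then show ?thesis using z(4)[of x s] that by auto
  qed
  have oUI: "open (U \<times> ?I)" using U by (intro open_Times) auto
  have zk: "Ck_on k z (U \<times> ?I)" for k
    by (rule ode_Ck_dependence[OF GS S U(1) cz z(2) graph ode])
  define \<phi> where "\<phi> = (\<lambda>q. fst q + z q)"
  have fd\<phi>: "frechet_derivative \<phi> (at q) c = fst c + frechet_derivative z (at q) c" if "q \<in> U \<times> ?I" for q c
  proof -
    have "(\<phi> has_derivative (\<lambda>c. fst c + frechet_derivative z (at q) c)) (at q)"
      unfolding \<phi>_def
      by (intro has_derivative_add bounded_linear_imp_has_derivative bounded_linear_fst Ck_on_SucD[OF zk that])
    from frechet_derivative_at[OF this, symmetric] show ?thesis by simp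
  qed
  have var: "((\<lambda>s. frechet_derivative z (at (x, s)) (v, 0)) has_vector_derivative
      frechet_derivative F (at (\<phi> (x, s))) (v + frechet_derivative z (at (x, s)) (v, 0))) (at s)"
    if "x \<in> U" "s \<in> ?I" for x s v
  proof -
    have q: "(x, s) \<in> U \<times> ?I" using that by simp
    have "\<phi> (x, s) \<in> D" using graph[OF q] by (simp add: \<phi>_def)
    from smooth_on_has_derivative[OF F this]
    have "(F has_derivative frechet_derivative F (at (\<phi> (x, s)))) (at (fst (fst ((x, s), z (x, s))) + snd ((x, s), z (x, s))))"
      by (simp add: \<phi>_def)
    from diff_chain_at[OF bounded_linear_imp_has_derivative[OF lin] this]
    have "(?G has_derivative (\<lambda>c. frechet_derivative F (at (\<phi> (x, s))) (fst (fst c) + snd c))) (at ((x, s), z (x, s)))"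
      by (simp add: o_def)
    from frechet_derivative_at[OF this, symmetric]
    have "frechet_derivative ?G (at ((x, s), z (x, s))) ((v, 0), w) = frechet_derivative F (at (\<phi> (x, s))) (v + w)" for w
      by simp
    with ode_variational_equation[OF GS S U(1) cz z(2) graph ode that, of v]
    show ?thesis by simp
  qed
  show thesis
  proof (rule that[OF T(1) U, of \<phi>])
    show "smooth_on (U \<times> ?I) \<phi>"
      unfolding smooth_on_def \<phi>_def by (intro allI Ck_on_add oUI Ck_on_linear bounded_linear_fst zk)
    show "\<phi> (x, 0) = x" if "x \<in> U" for x using z(2)[OF that] by (simp add: \<phi>_def)
    show "\<phi> q \<in> D" if "q \<in> U \<times> ?I" for q using graph[OF that] by (simp add: \<phi>_def)
    show "((\<lambda>s. \<phi> (x, s)) has_vector_derivative F (\<phi> (x, s))) (at s)" if "x \<in> U" "s \<in> ?I" for x s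
      using has_vector_derivative_add[OF has_vector_derivative_const[of x] ode[OF that]] by (simp add: \<phi>_def)
    show "((\<lambda>s. frechet_derivative \<phi> (at (x, s)) (v, 0)) has_vector_derivative
       frechet_derivative F (at (\<phi> (x, s))) (frechet_derivative \<phi> (at (x, s)) (v, 0))) (at s)"
      if xs: "x \<in> U" "s \<in> ?I" for x s v
    proof -
      have eq: "v + frechet_derivative z (at (x, t)) (v, 0) = frechet_derivative \<phi> (at (x, t)) (v, 0)" if "t \<in> ?I" for t
        using fd\<phi>[of "(x, t)" "(v, 0)"] xs that by simp
      have "((\<lambda>s. v + frechet_derivative z (at (x, s)) (v, 0)) has_vector_derivative
          frechet_derivative F (at (\<phi> (x, s))) (frechet_derivative \<phi> (at (x, s)) (v, 0))) (at s)"
        using has_vector_derivative_add[OF has_vector_derivative_const[of v] var[OF xs, of v]] eq[OF xs(2)] by simp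
      then show ?thesis
        by (rule has_vector_derivative_transform_within_open[OF _ _ xs(2) eq]) simp_all
    qed
    show "frechet_derivative \<phi> (at (x, 0)) (v, 0) = v" if "x \<in> U" for x v
    proof -
      have q: "(x, 0) \<in> U \<times> ?I" using that T by simp
      have "((\<lambda>y. (y, 0::real)) has_derivative (\<lambda>v. (v, 0))) (at x)"
        by (intro has_derivative_Pair has_derivative_ident has_derivative_const)
      from diff_chain_at[OF this Ck_on_SucD[OF zk q]]
      have "((\<lambda>y. z (y, 0)) has_derivative (\<lambda>v. frechet_derivative z (at (x, 0)) (v, 0))) (at x)"
        by (simp add: o_def)
      moreover have "((\<lambda>y. z (y, 0)) has_derivative (\<lambda>v. 0)) (at x)"
        by (rule has_derivative_transform_within_open[OF has_derivative_const U(1) that]) (simp add: z)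
      ultimately have "frechet_derivative z (at (x, 0)) (v, 0) = 0"
        using has_derivative_unique by metis
      then show ?thesis using fd\<phi>[OF q] by simp
    qed
  qed
qed

subsection \<open>The exponential map of an involutive family of vector fields\<close>

lemma has_vector_derivative_fst:
  "(f has_vector_derivative f') F \<Longrightarrow> ((\<lambda>s. fst (f s)) has_vector_derivative fst f') F"
  by (rule bounded_linear.has_vector_derivative[OF bounded_linear_fst])

lemma has_vector_derivative_snd:
  "(f has_vector_derivative f') F \<Longrightarrow> ((\<lambda>s. snd (f s)) has_vector_derivative snd f') F"
  by (rule bounded_linear.has_vector_derivative[OF bounded_linear_snd])

lemma has_vector_derivative_chain_at:
  "(f has_derivative f') (at (w s)) \<Longrightarrow> (w has_vector_derivative w') (at s) \<Longrightarrow>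
    ((\<lambda>s. f (w s)) has_vector_derivative f' w') (at s)"
  using diff_chain_at[of w "\<lambda>h. h *\<^sub>R w'" s f f'] has_derivative_linear[of f f']
  by (simp add: has_vector_derivative_def o_def linear_scale)

lemma linear_ode_zero:
  fixes e :: "real \<Rightarrow> 'b::real_inner"
  assumes "\<And>s. s \<in> {-T<..<T} \<Longrightarrow> (e has_vector_derivative e' s) (at s)" "e 0 = 0"
    and "L \<ge> 0" "\<And>s. s \<in> {-S..S} \<Longrightarrow> norm (e' s) \<le> L * norm (e s)" and S: "0 \<le> S" "S < T"
  shows "e S = 0"
proof -
  have "norm (e S) \<le> 0 * exp ((2 * L + 1) * S)"
    by (rule gronwall[where e=e and e'=e'])
      (use assms in \<open>auto intro: has_vector_derivative_at_within\<close>)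
  then show ?thesis by simp
qed

lemma ode_zero_imp_const:
  fixes e :: "real \<Rightarrow> 'b::real_inner"
  assumes "\<And>s. s \<in> {-T<..<T} \<Longrightarrow> (e has_vector_derivative 0) (at s)" and s: "s \<in> {-T<..<T}"
  shows "e s = e 0"
proof -
  have "\<exists>c. \<forall>s\<in>{-T<..<T}. e s = c"
  proof (rule has_derivative_zero_constant)
    show "(e has_derivative (\<lambda>h. 0)) (at s within {-T<..<T})" if "s \<in> {-T<..<T}" for s
      using has_derivative_at_withinI[OF assms(1)[OF that, unfolded has_vector_derivative_def]] by simp
  qed (rule convex_real_interval)
  moreover have "0 \<in> {-T<..<T}" using s by simp
  ultimately show ?thesis using s by metis
qed

text \<open>Suppose the t_k-derivative of w is \<Sum>_l B_kl X_l(w). Comparing the time derivatives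
  of both sides leaves X_k and the terms B_kq t_j [X_q, X_j]; involutivity rewrites these in the
  X_l, and this dictates the equation for B. Adjoining B to the state lets one flow deliver E and A
  together, smooth in all parameters.\<close>

lemma involutive_exponential:
  fixes X :: "'m::finite \<Rightarrow> 'w::euclidean_space \<Rightarrow> 'w" and c :: "'m \<Rightarrow> 'm \<Rightarrow> 'm \<Rightarrow> 'w \<Rightarrow> real"
  assumes X: "\<And>j. smooth_on D (X j)" and c: "\<And>l j k. smooth_on D (c l j k)" and "open D" and w0: "w0 \<in> D"
    and bracket: "\<And>j k w. w \<in> D \<Longrightarrow> lie_bracket (X j) (X k) w = (\<Sum>l\<in>UNIV. c l j k w *\<^sub>R X l w)"
  obtains N E and A :: "(real^'m) \<times> 'w \<Rightarrow> real^'m^'m" where "open N" "(0, w0) \<in> N" "smooth_on N E"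
    "\<And>q. q \<in> N \<Longrightarrow> E q \<in> D" "\<And>w. (0, w) \<in> N \<Longrightarrow> E (0, w) = w"
    "\<And>q k. q \<in> N \<Longrightarrow> frechet_derivative E (at q) (axis k 1, 0) = (\<Sum>l\<in>UNIV. (A q $ k $ l) *\<^sub>R X l (E q))"
    "continuous_on N A" "\<And>q. q \<in> N \<Longrightarrow> invertible (A q)"
proof -
  let ?D = "{p :: (real^'m) \<times> 'w \<times> (real^'m^'m). fst (snd p) \<in> D}"
  have oD: "open ?D"
    by (rule open_vimage[OF \<open>open D\<close>, unfolded vimage_def]) (intro continuous_intros)
  let ?Fw = "\<lambda>p :: (real^'m) \<times> 'w \<times> (real^'m^'m). \<Sum>j\<in>UNIV. (fst p $ j) *\<^sub>R X j (fst (snd p))"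
  let ?FB = "\<lambda>p :: (real^'m) \<times> 'w \<times> (real^'m^'m). \<chi> k l. (if k = l then 1 else 0) +
    (\<Sum>q\<in>UNIV. \<Sum>j\<in>UNIV. snd (snd p) $ k $ q * (fst p $ j) * c l q j (fst (snd p)))"
  \<comment> \<open>The state is \<open>(t, w, B)\<close>: \<open>t\<close> is constant and row \<open>k\<close> of \<open>B\<close> holds the coefficients of
    \<open>\<partial>w/\<partial>t\<^sub>k\<close> with respect to the fields \<open>X\<^sub>l\<close>.\<close>
  define F where "F = (\<lambda>p. (0 :: real^'m, ?Fw p, ?FB p))"
  have smF: "smooth_on ?D F"
    unfolding smooth_on_def F_def
  proof
    fix n
    have w: "Ck_on n (\<lambda>p. fst (snd p)) ?D" by (intro Ck_on_fst Ck_on_linear bounded_linear_snd oD)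
    have t: "Ck_on n (\<lambda>p. fst p $ j) ?D" for j
      by (intro Ck_on_vec_nth Ck_on_linear bounded_linear_fst oD)
    have B: "Ck_on n (\<lambda>p. snd (snd p) $ k $ q) ?D" for k q
      by (intro Ck_on_vec_nth Ck_on_snd Ck_on_linear bounded_linear_snd oD)
    have Xw: "Ck_on n (\<lambda>p. X j (fst (snd p))) ?D" for j
      by (rule Ck_on_compose[OF oD \<open>open D\<close> w smooth_onD[OF X]]) auto
    have cw: "Ck_on n (\<lambda>p. c l q j (fst (snd p))) ?D" for l q j
      by (rule Ck_on_compose[OF oD \<open>open D\<close> w smooth_onD[OF c]]) auto
    have "Ck_on n ?Fw ?D" by (intro Ck_on_sum Ck_on_scaleR t Xw oD)
    moreover have "Ck_on n ?FB ?D"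
      by (intro Ck_on_vec_lambda Ck_on_add Ck_on_const Ck_on_sum Ck_on_mult B t cw oD)
    ultimately show "Ck_on n (\<lambda>p. (0, ?Fw p, ?FB p)) ?D"
      by (intro Ck_on_Pair Ck_on_const oD)
  qed
  have p0: "(0, w0, 0) \<in> ?D" using w0 by simp
  obtain T U \<phi> where "T > 0" and U: "open U" "(0, w0, 0) \<in> U" and \<phi>: "smooth_on (U \<times> {-T<..<T}) \<phi>"
    and \<phi>0: "\<And>x. x \<in> U \<Longrightarrow> \<phi> (x, 0) = x" and \<phi>D: "\<And>q. q \<in> U \<times> {-T<..<T} \<Longrightarrow> \<phi> q \<in> ?D"
    and flow: "\<And>x s. x \<in> U \<Longrightarrow> s \<in> {-T<..<T} \<Longrightarrow> ((\<lambda>s. \<phi> (x, s)) has_vector_derivative F (\<phi> (x, s))) (at s)"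
    and var: "\<And>x s v. x \<in> U \<Longrightarrow> s \<in> {-T<..<T} \<Longrightarrow> ((\<lambda>s. frechet_derivative \<phi> (at (x, s)) (v, 0)) has_vector_derivative
       frechet_derivative F (at (\<phi> (x, s))) (frechet_derivative \<phi> (at (x, s)) (v, 0))) (at s)"
    and d\<phi>0: "\<And>x v. x \<in> U \<Longrightarrow> frechet_derivative \<phi> (at (x, 0)) (v, 0) = v"
    using local_flow[OF smF oD p0] by blast
  \<comment> \<open>The flow exists for short time only, so it is read off at S instead of 1; this
    merely rescales t.\<close>
  define S where "S = T / 2"
  have S: "S > 0" "S < T" "S \<in> {-T<..<T}" "0 \<in> {-T<..<T}" using \<open>T > 0\<close> by (auto simp: S_def)
  let ?I = "{-T<..<T}"
  define \<iota> where "\<iota> = (\<lambda>q :: (real^'m) \<times> 'w. ((fst q, snd q, 0 :: real^'m^'m), S))"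
  have blin\<iota>: "bounded_linear (\<lambda>q :: (real^'m) \<times> 'w. (fst q, snd q, 0 :: real^'m^'m))"
    by (intro bounded_linear_Pair bounded_linear_fst bounded_linear_snd bounded_linear_zero)
  define E where "E = (\<lambda>q. fst (snd (\<phi> (\<iota> q))))"
  define A where "A = (\<lambda>q. snd (snd (\<phi> (\<iota> q))))"
  define N0 where "N0 = {q :: (real^'m) \<times> 'w. (fst q, snd q, 0) \<in> U}"
  have N0: "open N0" "(0, w0) \<in> N0"
    unfolding N0_def using U
    by (auto intro!: open_vimage[OF U(1), unfolded vimage_def] continuous_intros)
  have oUI: "open (U \<times> ?I)" using U by (intro open_Times) auto
  have \<iota>N: "\<iota> ` N0 \<subseteq> U \<times> ?I" using S by (auto simp: \<iota>_def N0_def)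
  have \<phi>\<iota>: "Ck_on n (\<lambda>q. \<phi> (\<iota> q)) N0" for n
  proof (rule Ck_on_compose[OF N0(1) oUI _ smooth_onD[OF \<phi>] \<iota>N])
    show "Ck_on n \<iota> N0" unfolding \<iota>_def by (intro Ck_on_Pair Ck_on_linear blin\<iota> Ck_on_const N0)
  qed
  have E: "smooth_on N0 E"
    unfolding smooth_on_def E_def by (intro allI Ck_on_fst Ck_on_snd \<phi>\<iota> N0)
  have contA: "continuous_on N0 A"
    unfolding A_def by (intro Ck_on_imp_continuous_on[of 0] Ck_on_snd \<phi>\<iota> N0)
  have t_const: "fst (\<phi> (x, s)) = fst x" if "x \<in> U" "s \<in> ?I" for x s
  proof -
    have "fst (\<phi> (x, s)) = fst (\<phi> (x, 0))"
      using has_vector_derivative_fst[OF flow[OF that(1)]]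
      by (intro ode_zero_imp_const[where e="\<lambda>s. fst (\<phi> (x, s))", OF _ that(2)]) (simp add: F_def)
    then show ?thesis using \<phi>0[OF that(1)] by simp
  qed
  have w_const: "fst (snd (\<phi> (x, s))) = fst (snd x)" if "x \<in> U" "s \<in> ?I" "fst x = 0" for x s
  proof -
    have "fst (snd (\<phi> (x, s))) = fst (snd (\<phi> (x, 0)))"
      using has_vector_derivative_fst[OF has_vector_derivative_snd[OF flow[OF that(1)]]] t_const[OF that(1)] that(3)
      by (intro ode_zero_imp_const[where e="\<lambda>s. fst (snd (\<phi> (x, s)))", OF _ that(2)]) (simp add: F_def)
    then show ?thesis using \<phi>0[OF that(1)] by simp
  qed
  have wD: "fst (snd (\<phi> (x, s))) \<in> D" if "x \<in> U" "s \<in> ?I" for x s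
    using \<phi>D[of "(x, s)"] that by simp
  have dX: "(X j has_derivative frechet_derivative (X j) (at w)) (at w)" if "w \<in> D" for j w
    using smooth_on_has_derivative[OF X that] .
  have dF: "fst (frechet_derivative F (at p) v) = 0"
    "fst (snd (frechet_derivative F (at p) v)) = (\<Sum>j\<in>UNIV. (fst p $ j) *\<^sub>R frechet_derivative (X j) (at (fst (snd p))) (fst (snd v))
        + (fst v $ j) *\<^sub>R X j (fst (snd p)))" if "p \<in> ?D" for p v
  proof -
    have F: "(F has_derivative frechet_derivative F (at p)) (at p)"
      using smooth_on_has_derivative[OF smF that] .
    from has_derivative_fst[OF F] have "((\<lambda>p. 0) has_derivative (\<lambda>v. fst (frechet_derivative F (at p) v))) (at p)"
      by (simp add: F_def)
    from has_derivative_unique[OF this has_derivative_const] show "fst (frechet_derivative F (at p) v) = 0"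
      by metis
    have "((\<lambda>p. X j (fst (snd p))) has_derivative (\<lambda>v. frechet_derivative (X j) (at (fst (snd p))) (fst (snd v)))) (at p)" for j
      using diff_chain_at[OF _ dX, of "\<lambda>p. fst (snd p)" "\<lambda>p. fst (snd p)" p j] that
      by (simp add: o_def bounded_linear_imp_has_derivative bounded_linear_compose[OF bounded_linear_fst bounded_linear_snd])
    moreover have "((\<lambda>p. fst p $ j) has_derivative (\<lambda>v. fst v $ j)) (at p)" for j
      by (intro bounded_linear_imp_has_derivative bounded_linear_compose[OF bounded_linear_vec_nth bounded_linear_fst])
    ultimately have Fw: "(?Fw has_derivative (\<lambda>v. \<Sum>j\<in>UNIV. (fst p $ j) *\<^sub>R frechet_derivative (X j) (at (fst (snd p))) (fst (snd v))
        + (fst v $ j) *\<^sub>R X j (fst (snd p)))) (at p)"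
      by (intro has_derivative_sum has_derivative_scaleR)
    from has_derivative_fst[OF has_derivative_snd[OF F]]
    have "(?Fw has_derivative (\<lambda>v. fst (snd (frechet_derivative F (at p) v)))) (at p)"
      by (simp add: F_def)
    from fun_cong[OF has_derivative_unique[OF this Fw], of v]
    show "fst (snd (frechet_derivative F (at p) v)) = (\<Sum>j\<in>UNIV. (fst p $ j) *\<^sub>R frechet_derivative (X j) (at (fst (snd p))) (fst (snd v))
        + (fst v $ j) *\<^sub>R X j (fst (snd p)))" .
  qed
  \<comment> \<open>The identity holds at time 0, where the w-component of the initial direction and
    the matrix part of the state both vanish, and it is propagated to time S along the
    trajectory.\<close>
  have key: "fst (snd (frechet_derivative \<phi> (at (x, S)) ((axis k 1, 0, 0), 0))) =
      (\<Sum>l\<in>UNIV. (snd (snd (\<phi> (x, S))) $ k $ l) *\<^sub>R X l (fst (snd (\<phi> (x, S)))))"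
    if x: "x \<in> U" "snd (snd x) = 0" for x k
  proof -
    let ?t = "fst x"
    define w where "w = (\<lambda>s. fst (snd (\<phi> (x, s))))"
    define B where "B = (\<lambda>s. snd (snd (\<phi> (x, s))))"
    define V where "V = (\<lambda>s. frechet_derivative \<phi> (at (x, s)) ((axis k 1, 0, 0), 0))"
    let ?DX = "\<lambda>j s. frechet_derivative (X j) (at (w s))"
    have wD: "w s \<in> D" if "s \<in> ?I" for s using wD[OF x(1) that] by (simp add: w_def)
    have dw: "(w has_vector_derivative (\<Sum>j\<in>UNIV. (?t $ j) *\<^sub>R X j (w s))) (at s)" if "s \<in> ?I" for s
      using has_vector_derivative_fst[OF has_vector_derivative_snd[OF flow[OF x(1) that]]] t_const[OF x(1) that]
      by (simp add: w_def F_def)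
    let ?B' = "\<lambda>s l. (if k = l then 1 else 0) + (\<Sum>q\<in>UNIV. \<Sum>j\<in>UNIV. B s $ k $ q * (?t $ j) * c l q j (w s))"
    have dB: "((\<lambda>s. B s $ k $ l) has_vector_derivative ?B' s l) (at s)" if "s \<in> ?I" for s l
      using bounded_linear.has_vector_derivative[OF bounded_linear_compose[OF bounded_linear_vec_nth bounded_linear_vec_nth]
          has_vector_derivative_snd[OF has_vector_derivative_snd[OF flow[OF x(1) that]]], of k l] t_const[OF x(1) that]
      by (simp add: B_def w_def F_def)
    have V0: "V 0 = (axis k 1, 0, 0)" using d\<phi>0[OF x(1)] by (simp add: V_def)
    have dV: "(V has_vector_derivative frechet_derivative F (at (\<phi> (x, s))) (V s)) (at s)" if "s \<in> ?I" for s
      unfolding V_def by (rule var[OF x(1) that])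
    have pD: "\<phi> (x, s) \<in> ?D" if "s \<in> ?I" for s using \<phi>D x(1) that by blast
    have Vt: "fst (V s) = axis k 1" if "s \<in> ?I" for s
    proof -
      have "fst (V s) = fst (V 0)"
        using has_vector_derivative_fst[OF dV] dF(1)[OF pD]
        by (intro ode_zero_imp_const[where e="\<lambda>s. fst (V s)", OF _ that]) simp
      then show ?thesis using V0 by simp
    qed
    have axis_sum: "(\<Sum>j\<in>UNIV. (axis k 1 $ j) *\<^sub>R Y j) = Y k" for Y :: "'m \<Rightarrow> 'w"
      by (simp add: axis_def if_distrib[where f="\<lambda>a. a *\<^sub>R _"] cong: if_cong)
    define V' where "V' = (\<lambda>s. (\<Sum>j\<in>UNIV. (?t $ j) *\<^sub>R ?DX j s (fst (snd (V s)))) + X k (w s))"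
    have dVw: "((\<lambda>s. fst (snd (V s))) has_vector_derivative V' s) (at s)" if "s \<in> ?I" for s
      using has_vector_derivative_fst[OF has_vector_derivative_snd[OF dV[OF that]]]
      by (simp add: dF(2)[OF pD[OF that]] t_const[OF x(1) that] Vt[OF that] sum.distrib axis_sum V'_def w_def)
    \<comment> \<open>By involutivity the defect \<open>e\<close> solves a homogeneous linear equation.\<close>
    define e where "e = (\<lambda>s. fst (snd (V s)) - (\<Sum>l\<in>UNIV. (B s $ k $ l) *\<^sub>R X l (w s)))"
    define M where "M = (\<lambda>v s. \<Sum>j\<in>UNIV. (?t $ j) *\<^sub>R ?DX j s v)"
    have linDX: "linear (?DX j s)" if "s \<in> ?I" for j s
      using has_derivative_linear[OF dX[OF wD[OF that]]] .
    have linM: "linear (\<lambda>v. M v s)" if "s \<in> ?I" for s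
      unfolding M_def
      by (intro linear_compose_sum ballI linear_compose_scale_right linDX that)
    have de: "(e has_vector_derivative M (e s) s) (at s)" if s: "s \<in> ?I" for s
    proof -
      have "((\<lambda>s. X l (w s)) has_vector_derivative ?DX l s (\<Sum>j\<in>UNIV. (?t $ j) *\<^sub>R X j (w s))) (at s)" for l
        by (rule has_vector_derivative_chain_at[OF dX[OF wD[OF s]] dw[OF s]])
      then have "((\<lambda>s. (B s $ k $ l) *\<^sub>R X l (w s)) has_vector_derivative
          (B s $ k $ l) *\<^sub>R ?DX l s (\<Sum>j\<in>UNIV. (?t $ j) *\<^sub>R X j (w s)) + ?B' s l *\<^sub>R X l (w s)) (at s)" for l
        using has_vector_derivative_scaleR[OF dB[OF s, unfolded has_real_derivative_iff_has_vector_derivative[symmetric]]]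
        by blast
      then have "(e has_vector_derivative V' s - (\<Sum>l\<in>UNIV.
          (B s $ k $ l) *\<^sub>R ?DX l s (\<Sum>j\<in>UNIV. (?t $ j) *\<^sub>R X j (w s)) + ?B' s l *\<^sub>R X l (w s))) (at s)"
        unfolding e_def by (intro has_vector_derivative_diff has_vector_derivative_sum dVw s)
      \<comment> \<open>The terms DX_q(X_j) from differentiating X_q(w) cancel against half of the
        bracket in \<open>?B'\<close>. The other half, subtracted from M applied to the w-part of V,
        leaves M applied to e.\<close>
      also have "V' s - (\<Sum>l\<in>UNIV. (B s $ k $ l) *\<^sub>R ?DX l s (\<Sum>j\<in>UNIV. (?t $ j) *\<^sub>R X j (w s)) + ?B' s l *\<^sub>R X l (w s)) = M (e s) s"
      proof -
        let ?b = "\<lambda>q. B s $ k $ q"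
        have br: "(\<Sum>l\<in>UNIV. c l q j (w s) *\<^sub>R X l (w s)) = ?DX j s (X q (w s)) - ?DX q s (X j (w s))" for q j
          using bracket[OF wD[OF s], of q j] by (simp add: lie_bracket_def vf_apply_def)
        have "(\<Sum>l\<in>UNIV. ?B' s l *\<^sub>R X l (w s))
            = X k (w s) + (\<Sum>l\<in>UNIV. \<Sum>q\<in>UNIV. \<Sum>j\<in>UNIV. (?b q * (?t $ j) * c l q j (w s)) *\<^sub>R X l (w s))"
          by (simp add: scaleR_add_left sum.distrib scaleR_sum_left if_distrib[where f="\<lambda>a. a *\<^sub>R _"] cong: if_cong)
        also have "(\<Sum>l\<in>UNIV. \<Sum>q\<in>UNIV. \<Sum>j\<in>UNIV. (?b q * (?t $ j) * c l q j (w s)) *\<^sub>R X l (w s))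
            = (\<Sum>q\<in>UNIV. \<Sum>l\<in>UNIV. \<Sum>j\<in>UNIV. (?b q * (?t $ j) * c l q j (w s)) *\<^sub>R X l (w s))"
          by (rule sum.swap)
        also have "\<dots> = (\<Sum>q\<in>UNIV. \<Sum>j\<in>UNIV. \<Sum>l\<in>UNIV. (?b q * (?t $ j) * c l q j (w s)) *\<^sub>R X l (w s))"
          by (intro sum.cong refl sum.swap)
        also have "\<dots> = (\<Sum>q\<in>UNIV. \<Sum>j\<in>UNIV. (?b q * (?t $ j)) *\<^sub>R (\<Sum>l\<in>UNIV. c l q j (w s) *\<^sub>R X l (w s)))"
          by (simp add: scaleR_sum_right)
        also have "\<dots> = (\<Sum>q\<in>UNIV. \<Sum>j\<in>UNIV. (?b q * (?t $ j)) *\<^sub>R ?DX j s (X q (w s)))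
            - (\<Sum>q\<in>UNIV. \<Sum>j\<in>UNIV. (?b q * (?t $ j)) *\<^sub>R ?DX q s (X j (w s)))"
          by (simp add: br scaleR_diff_right sum_subtractf)
        finally have 1: "(\<Sum>l\<in>UNIV. ?B' s l *\<^sub>R X l (w s)) = X k (w s)
            + ((\<Sum>q\<in>UNIV. \<Sum>j\<in>UNIV. (?b q * (?t $ j)) *\<^sub>R ?DX j s (X q (w s)))
            - (\<Sum>q\<in>UNIV. \<Sum>j\<in>UNIV. (?b q * (?t $ j)) *\<^sub>R ?DX q s (X j (w s))))" .
        have 2: "(\<Sum>l\<in>UNIV. ?b l *\<^sub>R ?DX l s (\<Sum>j\<in>UNIV. (?t $ j) *\<^sub>R X j (w s)))
            = (\<Sum>q\<in>UNIV. \<Sum>j\<in>UNIV. (?b q * (?t $ j)) *\<^sub>R ?DX q s (X j (w s)))"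
          by (simp add: linear_sum[OF linDX[OF s]] linear_scale[OF linDX[OF s]] scaleR_sum_right)
        have "M (\<Sum>q\<in>UNIV. ?b q *\<^sub>R X q (w s)) s = (\<Sum>q\<in>UNIV. ?b q *\<^sub>R M (X q (w s)) s)"
          by (simp only: linear_sum[OF linM[OF s]] linear_scale[OF linM[OF s]])
        also have "\<dots> = (\<Sum>q\<in>UNIV. \<Sum>j\<in>UNIV. (?b q * (?t $ j)) *\<^sub>R ?DX j s (X q (w s)))"
          by (simp add: M_def scaleR_sum_right)
        finally have 3: "M (e s) s = M (fst (snd (V s))) s - (\<Sum>q\<in>UNIV. \<Sum>j\<in>UNIV. (?b q * (?t $ j)) *\<^sub>R ?DX j s (X q (w s)))"
          unfolding e_def by (simp only: linear_diff[OF linM[OF s]])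
        show ?thesis
          unfolding 3 sum.distrib 1 2 by (simp add: V'_def M_def)
      qed
      finally show ?thesis .
    qed
    have contM: "continuous_on {-S..S} (M v)" for v
    proof -
      have "continuous_on {-S..S} w"
      proof (rule continuous_at_imp_continuous_on, rule ballI)
        fix s assume "s \<in> {-S..S}"
        then have "s \<in> ?I" using S by auto
        from has_vector_derivative_continuous[OF dw[OF this]] show "isCont w s" .
      qed
      then have "continuous_on {-S..S} (\<lambda>s. ?DX j s v)" for j
        by (rule continuous_on_compose2[OF smooth_on_imp_continuous_on[OF smooth_on_frechet_derivative[OF X]]])
          (use wD S in auto)
      then show ?thesis unfolding M_def by (intro continuous_intros)
    qed
    have "linear (\<lambda>v. M v s)" if "s \<in> {-S..S}" for s using linM[of s] that S by auto
    from bounded_on_compact_linear_family[OF compact_Icc contM this]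
    obtain L where L: "L \<ge> 0" "\<And>s v. s \<in> {-S..S} \<Longrightarrow> norm (M v s) \<le> L * norm v" by metis
    have "e 0 = 0" using V0 \<phi>0[OF x(1)] x(2) by (simp add: e_def B_def)
    then have "e S = 0" using linear_ode_zero[OF de _ L(1) L(2)] S by simp
    then show ?thesis by (simp add: e_def V_def B_def w_def)
  qed
  define N where "N = N0 \<inter> (\<lambda>q. det (A q)) -` (- {0})"
  show thesis
  proof (rule that[of N E A])
    show "open N"
      unfolding N_def
      by (rule continuous_open_preimage[OF _ N0(1)]) (auto simp: det_def intro!: continuous_intros contA)
    show "(0, w0) \<in> N"
    proof -
      let ?x = "(0, w0, 0) :: (real^'m) \<times> 'w \<times> (real^'m^'m)"
      \<comment> \<open>At t = 0 the equation for the matrix part reduces to B' = 1, so A is S times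
        the identity there. Its determinant is a power of S, hence nonzero, and it stays nonzero
        nearby.\<close>
      have "A (0, w0) - S *\<^sub>R mat 1 = snd (snd (\<phi> (?x, 0))) - 0 *\<^sub>R mat 1"
        unfolding A_def \<iota>_def fst_conv snd_conv
      proof (rule ode_zero_imp_const[where e="\<lambda>s. snd (snd (\<phi> (?x, s))) - s *\<^sub>R mat 1", OF _ S(3)])
        fix s assume s: "s \<in> ?I"
        have "snd (snd (F (\<phi> (?x, s)))) = mat 1"
          using t_const[OF U(2) s] by (simp add: F_def mat_def vec_eq_iff)
        with has_vector_derivative_snd[OF has_vector_derivative_snd[OF flow[OF U(2) s]]]
        have "((\<lambda>s. snd (snd (\<phi> (?x, s)))) has_vector_derivative mat 1) (at s)" by simp
        from has_vector_derivative_diff[OF this has_vector_derivative_scaleR[OF DERIV_ident has_vector_derivative_const[of "mat 1"]]]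
        show "((\<lambda>s. snd (snd (\<phi> (?x, s))) - s *\<^sub>R mat 1) has_vector_derivative 0) (at s)" by simp
      qed
      then have "A (0, w0) = S *\<^sub>R mat 1" using \<phi>0[OF U(2)] by simp
      moreover have "det (S *\<^sub>R mat 1 :: real^'m^'m) = S ^ CARD('m)"
        by (subst det_diagonal) (auto simp: mat_def)
      ultimately show ?thesis using N0 S by (simp add: N_def)
    qed
    have N: "N \<subseteq> N0" by (auto simp: N_def)
    show "smooth_on N E" "continuous_on N A"
      using smooth_on_subset[OF E N] continuous_on_subset[OF contA N] .
    show "E q \<in> D" if "q \<in> N" for q
      using \<phi>D[of "\<iota> q"] \<iota>N N that by (auto simp: E_def)
    show "E (0, w) = w" if "(0, w) \<in> N" for w
      using w_const[OF _ S(3), of "(0, w, 0)"] N that by (auto simp: E_def \<iota>_def N0_def)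
    show "invertible (A q)" if "q \<in> N" for q using that by (simp add: N_def invertible_det_nz)
    show "frechet_derivative E (at q) (axis k 1, 0) = (\<Sum>l\<in>UNIV. (A q $ k $ l) *\<^sub>R X l (E q))" if q: "q \<in> N" for q k
    proof -
      have "(\<iota> has_derivative (\<lambda>v. ((fst v, snd v, 0), 0))) (at q)"
        unfolding \<iota>_def by (intro has_derivative_Pair bounded_linear_imp_has_derivative[OF blin\<iota>] has_derivative_const)
      moreover have "(\<phi> has_derivative frechet_derivative \<phi> (at (\<iota> q))) (at (\<iota> q))"
        using smooth_on_has_derivative[OF \<phi>] \<iota>N N q by blast
      ultimately have "((\<lambda>q. \<phi> (\<iota> q)) has_derivative (\<lambda>v. frechet_derivative \<phi> (at (\<iota> q)) ((fst v, snd v, 0), 0))) (at q)"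
        using diff_chain_at[of \<iota> _ q \<phi>] by (simp add: o_def)
      then have "(E has_derivative (\<lambda>v. fst (snd (frechet_derivative \<phi> (at (\<iota> q)) ((fst v, snd v, 0), 0))))) (at q)"
        unfolding E_def by (intro has_derivative_fst has_derivative_snd)
      from frechet_derivative_at[OF this, symmetric]
      have "frechet_derivative E (at q) (axis k 1, 0) = fst (snd (frechet_derivative \<phi> (at (\<iota> q)) ((axis k 1, 0, 0), 0)))"
        by simp
      then show ?thesis
        using key[of "(fst q, snd q, 0)" k] N q by (auto simp: E_def A_def \<iota>_def N0_def)
    qed
  qed
qed

subsection \<open>Coordinates adapted to the frame\<close>

text \<open>Continuity of the derivative in operator norm is checked on fixed vectors, and a linear
  left inverse of the injective derivative is all the invertibility required.
  \<open>smooth_local_inverse\<close> then upgrades the inverse from differentiable to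
  smooth.\<close>

lemma smooth_inverse_function:
  fixes f :: "real^'n \<Rightarrow> real^'n"
  assumes f: "smooth_on S f" and "open S" "x0 \<in> S" and inj: "\<And>v. frechet_derivative f (at x0) v = 0 \<Longrightarrow> v = 0"
  obtains U V g where "open U" "U \<subseteq> S" "x0 \<in> U" "open V" "homeomorphism U V f g" "smooth_on V g"
proof -
  let ?D = "\<lambda>x. frechet_derivative f (at x)"
  have D: "(f has_derivative ?D x) (at x)" if "x \<in> S" for x
    using smooth_on_has_derivative[OF f that] .
  have bl: "bounded_linear (?D x)" if "x \<in> S" for x
    using D[OF that] by (rule has_derivative_bounded_linear)
  have app: "blinfun_apply (Blinfun (?D x)) = ?D x" if "x \<in> S" for x
    using bounded_linear_Blinfun_apply[OF bl[OF that]] .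
  have "continuous_on S (\<lambda>x. blinfun_apply (Blinfun (?D x)) v)" for v
    using smooth_on_imp_continuous_on[OF smooth_on_frechet_derivative[OF f, of v]]
    by (rule continuous_on_cong[THEN iffD1, rotated -1]) (simp_all add: app)
  then have cont: "continuous_on S (\<lambda>x. Blinfun (?D x))"
    by (intro continuous_on_blinfun_componentwise)
  have lin: "linear (?D x0)" using D[OF \<open>x0 \<in> S\<close>] by (rule has_derivative_linear)
  have "inj (?D x0)" using inj by (auto simp: linear_injective_0[OF lin])
  then obtain h where h: "linear h" "h \<circ> ?D x0 = id"
    using linear_injective_left_inverse[OF lin] by blast
  have "blinfun_apply (Blinfun h) = h"
    using h(1) by (simp add: bounded_linear_Blinfun_apply linear_conv_bounded_linear)
  then have inv: "Blinfun h o\<^sub>L Blinfun (?D x0) = id_blinfun"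
    using h(2) by (intro blinfun_eqI) (simp add: app[OF \<open>x0 \<in> S\<close>] fun_eq_iff)
  have Db: "(f has_derivative blinfun_apply (Blinfun (?D x))) (at x)" if "x \<in> S" for x
    unfolding app[OF that] by (rule D[OF that])
  show thesis
  proof (rule inverse_function_theorem[OF \<open>open S\<close> Db cont \<open>x0 \<in> S\<close> inv])
    fix U V g g'
    assume UV: "open U" "U \<subseteq> S" "x0 \<in> U" "open V" "homeomorphism U V f g"
      and g: "\<And>y. y \<in> V \<Longrightarrow> (g has_derivative g' y) (at y)"
    show thesis
      by (rule that[OF UV smooth_local_inverse[OF smooth_on_subset[OF f UV(2)] UV(1,4,5) g]])
  qed
qed

section \<open>Linear algebra of frames and uniqueness along adapted segments\<close>

lemma independent_family_sum_eq_0: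
  fixes f :: "'m::finite \<Rightarrow> 'a::real_vector"
  assumes "inj f" "independent (range f)" "(\<Sum>l\<in>UNIV. x l *\<^sub>R f l) = 0"
  shows "x l = 0"
proof -
  have "(\<Sum>v\<in>range f. x (inv f v) *\<^sub>R v) = 0"
    using assms(1,3) by (simp add: sum.reindex)
  from independentD[OF assms(2) _ subset_refl this, of "f l"] show ?thesis
    using assms(1) by simp
qed

text \<open>Multiplication by the inverse matrix, with vectors as unknowns. It passes from equations
  along the combinations \<Sum>_l A_kl X_l to equations along each X_l.\<close>

lemma invertible_sum_eq_0:
  fixes A :: "real^'m^'m" and d :: "'m \<Rightarrow> 'a::real_vector"
  assumes "invertible A" "\<And>k. (\<Sum>l\<in>UNIV. (A $ k $ l) *\<^sub>R d l) = 0"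
  shows "d l = 0"
proof -
  obtain B where "B ** A = mat 1" using assms(1) by (auto simp: invertible_def)
  then have B: "(\<Sum>k\<in>UNIV. B $ l $ k * A $ k $ m) = (if l = m then 1 else 0)" for m
    by (simp add: matrix_matrix_mult_def mat_def vec_eq_iff)
  have "0 = (\<Sum>k\<in>UNIV. (B $ l $ k) *\<^sub>R (\<Sum>m\<in>UNIV. (A $ k $ m) *\<^sub>R d m))"
    using assms(2) by simp
  also have "\<dots> = (\<Sum>m\<in>UNIV. \<Sum>k\<in>UNIV. (B $ l $ k * A $ k $ m) *\<^sub>R d m)"
    by (subst sum.swap) (simp add: scaleR_sum_right)
  also have "\<dots> = (\<Sum>m\<in>UNIV. (if l = m then 1 else 0) *\<^sub>R d m)"
    by (simp only: B flip: scaleR_sum_left)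
  also have "\<dots> = d l" by (simp add: if_distrib[where f="\<lambda>a. a *\<^sub>R _"] cong: if_cong)
  finally show ?thesis by simp
qed

text \<open>Links the total derivative of h to the coordinate form in which the integrability
  conditions are stated.\<close>

lemma frechet_derivative_eq_pderivs:
  fixes f :: "(real^'n) \<times> (real^'p) \<Rightarrow> real"
  assumes "(f has_derivative frechet_derivative f (at z)) (at z)"
  shows "frechet_derivative f (at z) (v, w)
    = (\<Sum>l\<in>UNIV. pderiv_u f l z * v $ l) + (\<Sum>s\<in>UNIV. pderiv_phi f s z * w $ s)"
proof -
  let ?D = "frechet_derivative f (at z)"
  have lin: "linear ?D" using assms by (rule has_derivative_linear)
  have "linear (\<lambda>v::real^'n. (v, 0::real^'p))" "linear (\<lambda>w::real^'p. (0::real^'n, w))"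
    by (intro linearI; simp)+
  then have L: "linear (\<lambda>v. ?D (v, 0))" "linear (\<lambda>w. ?D (0, w))"
    using linear_compose[OF _ lin] by (auto simp: o_def)
  have "?D (v, w) = ?D (v, 0) + ?D (0, w)" using linear_add[OF lin, of "(v, 0)" "(0, w)"] by simp
  also have "?D (v, 0) = (\<Sum>l\<in>UNIV. v $ l *\<^sub>R ?D (axis l 1, 0))"
    by (subst basis_expansion[symmetric, of v])
      (simp add: linear_sum[OF L(1)] linear_scale[OF L(1)] scalar_mult_eq_scaleR)
  also have "?D (0, w) = (\<Sum>s\<in>UNIV. w $ s *\<^sub>R ?D (0, axis s 1))"
    by (subst basis_expansion[symmetric, of w])
      (simp add: linear_sum[OF L(2)] linear_scale[OF L(2)] scalar_mult_eq_scaleR)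
  finally show ?thesis by (simp add: pderiv_u_def pderiv_phi_def mult.commute)
qed

text \<open>Over the same base curve u = fst (Z (y s)), both Z (y s) and (u, \<beta> u) are integral
  curves of \<Sum> t_k A_kl X_l with the same time-dependent coefficients. Boundedness of A on the
  segment and the Lipschitz bound on X_l make the difference e satisfy |e'| \<le> M L |e|, so it
  vanishes by Gronwall with \<epsilon> = 0.\<close>

lemma transport_unique:
  fixes Z :: "real^'n \<Rightarrow> (real^'n) \<times> (real^'p)" and A :: "real^'n \<Rightarrow> real^'m^'m" and \<kappa> :: "'m \<Rightarrow> 'n"
    and X :: "'m \<Rightarrow> (real^'n) \<times> (real^'p) \<Rightarrow> (real^'n) \<times> (real^'p)"
  assumes Z: "smooth_on S Z" and "open S" and contA: "continuous_on S A"
    and deriv: "\<And>x k. x \<in> S \<Longrightarrow> frechet_derivative Z (at x) (axis (\<kappa> k) 1) = (\<Sum>l\<in>UNIV. (A x $ k $ l) *\<^sub>R X l (Z x))"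
    and \<beta>: "smooth_on W \<beta>"
      "\<And>u l. u \<in> W \<Longrightarrow> frechet_derivative \<beta> (at u) (fst (X l (u, \<beta> u))) = snd (X l (u, \<beta> u))"
    and fstX: "\<And>l u \<phi> \<phi>'. fst (X l (u, \<phi>)) = fst (X l (u, \<phi>'))"
    and lip: "\<And>l a b. a \<in> Q \<Longrightarrow> b \<in> Q \<Longrightarrow> norm (X l b - X l a) \<le> L * norm (b - a)" and "L \<ge> 0"
    and y: "\<And>s. y s = y0 + s *\<^sub>R (\<Sum>k\<in>UNIV. t k *\<^sub>R axis (\<kappa> k) 1)"
    and path: "\<And>s. s \<in> {0..1} \<Longrightarrow> y s \<in> S \<and> fst (Z (y s)) \<in> W \<and> Z (y s) \<in> Q \<and> (fst (Z (y s)), \<beta> (fst (Z (y s)))) \<in> Q"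
    and init: "\<beta> (fst (Z (y 0))) = snd (Z (y 0))"
  shows "\<beta> (fst (Z (y 1))) = snd (Z (y 1))"
proof -
  let ?d = "\<Sum>k\<in>UNIV. t k *\<^sub>R axis (\<kappa> k) 1 :: real^'n"
  define Y where "Y = (\<lambda>s. (fst (Z (y s)), \<beta> (fst (Z (y s)))))"
  define e where "e = (\<lambda>s. \<beta> (fst (Z (y s))) - snd (Z (y s)))"
  define e' where "e' = (\<lambda>s. \<Sum>k\<in>UNIV. \<Sum>l\<in>UNIV. (t k * A (y s) $ k $ l) *\<^sub>R (snd (X l (Y s)) - snd (X l (Z (y s)))))"
  have dy: "(y has_vector_derivative ?d) (at s)" for s
    unfolding y by (auto intro!: derivative_eq_intros)
  have DZ: "frechet_derivative Z (at x) ?d = (\<Sum>k\<in>UNIV. \<Sum>l\<in>UNIV. (t k * A x $ k $ l) *\<^sub>R X l (Z x))" if "x \<in> S" for x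
    using has_derivative_linear[OF smooth_on_has_derivative[OF Z that]]
    by (simp add: linear_sum linear_scale deriv[OF that] scaleR_sum_right)
  have de: "(e has_vector_derivative e' s) (at s)" if s: "s \<in> {0..1}" for s
  proof -
    let ?x = "y s"
    have x: "?x \<in> S" "fst (Z ?x) \<in> W" using path[OF s] by auto
    have dZ: "((\<lambda>s. Z (y s)) has_vector_derivative frechet_derivative Z (at ?x) ?d) (at s)"
      by (rule has_vector_derivative_chain_at[OF smooth_on_has_derivative[OF Z x(1)] dy])
    have D\<beta>: "(\<beta> has_derivative frechet_derivative \<beta> (at (fst (Z ?x)))) (at (fst (Z ?x)))"
      using smooth_on_has_derivative[OF \<beta>(1) x(2)] .
    have l\<beta>: "linear (frechet_derivative \<beta> (at (fst (Z ?x))))" using D\<beta> by (rule has_derivative_linear)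
    \<comment> \<open>The velocity of the base curve is given by X_l at Z; since its first component
      sees only u, it may be read at the point of the graph of \<beta>, where the equation for
      \<beta> applies.\<close>
    have fX: "fst (X l (Z ?x)) = fst (X l (Y s))" for l
      using fstX[of l "fst (Z ?x)" "snd (Z ?x)" "\<beta> (fst (Z ?x))"] by (simp add: Y_def)
    have "frechet_derivative \<beta> (at (fst (Z ?x))) (fst (frechet_derivative Z (at ?x) ?d))
        = (\<Sum>k\<in>UNIV. \<Sum>l\<in>UNIV. (t k * A ?x $ k $ l) *\<^sub>R snd (X l (Y s)))"
      using \<beta>(2)[OF x(2)] by (simp add: DZ[OF x(1)] fst_sum linear_sum[OF l\<beta>] linear_scale[OF l\<beta>] fX) (simp add: Y_def)
    moreover have "snd (frechet_derivative Z (at ?x) ?d) = (\<Sum>k\<in>UNIV. \<Sum>l\<in>UNIV. (t k * A ?x $ k $ l) *\<^sub>R snd (X l (Z ?x)))"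
      by (simp add: DZ[OF x(1)] snd_sum)
    ultimately have "e' s = frechet_derivative \<beta> (at (fst (Z ?x))) (fst (frechet_derivative Z (at ?x) ?d))
        - snd (frechet_derivative Z (at ?x) ?d)"
      by (simp add: e'_def scaleR_diff_right sum_subtractf)
    then show ?thesis
      unfolding e_def
      using has_vector_derivative_diff[OF has_vector_derivative_chain_at[OF D\<beta> has_vector_derivative_fst[OF dZ]]
          has_vector_derivative_snd[OF dZ]] by simp
  qed
  let ?a = "\<lambda>s. \<Sum>k\<in>UNIV. \<Sum>l\<in>UNIV. \<bar>t k * A (y s) $ k $ l\<bar>"
  have "continuous_on {0..1} y"
    by (rule continuous_at_imp_continuous_on) (use has_vector_derivative_continuous[OF dy] in blast)
  then have "continuous_on {0..1} (\<lambda>s. A (y s))"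
    by (rule continuous_on_compose2[OF contA]) (use path in blast)
  then have "continuous_on {0..1} ?a" by (intro continuous_intros)
  from compact_imp_bounded[OF compact_continuous_image[OF this compact_Icc]]
  obtain M where "\<And>s. s \<in> {0..1} \<Longrightarrow> norm (?a s) \<le> M" unfolding bounded_iff by blast
  then have M: "?a s \<le> M" if "s \<in> {0..1}" for s
    using abs_ge_self order_trans that unfolding real_norm_def by blast
  have "0 \<le> ?a 0" by (intro sum_nonneg) auto
  then have "M \<ge> 0" using M[of 0] by simp
  have "norm (e 1) \<le> 0 * exp ((2 * (M * L) + 1) * 1)"
  proof (rule gronwall_right[where e=e and e'=e'])
    fix s :: real assume s: "s \<in> {0..1}"
    show "(e has_vector_derivative e' s) (at s within {0..1})" using de[OF s] by (rule has_vector_derivative_at_within)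
    have n: "norm (snd (X l (Y s)) - snd (X l (Z (y s)))) \<le> L * norm (e s)" for l
    proof -
      have "norm (snd (X l (Y s) - X l (Z (y s)))) \<le> norm (X l (Y s) - X l (Z (y s)))"
        by (metis norm_snd_le prod.collapse)
      also have "\<dots> \<le> L * norm (Y s - Z (y s))" using path[OF s] by (intro lip) (auto simp: Y_def)
      also have "norm (Y s - Z (y s)) = norm (e s)"
        by (simp add: Y_def e_def norm_prod_def)
      finally show ?thesis by simp
    qed
    have "norm (e' s) \<le> (\<Sum>k\<in>UNIV. \<Sum>l\<in>UNIV. \<bar>t k * A (y s) $ k $ l\<bar> * (L * norm (e s)))"
      unfolding e'_def
      by (intro order_trans[OF norm_sum] sum_mono) (auto intro!: mult_left_mono n)
    also have "\<dots> = ?a s * (L * norm (e s))" by (simp add: sum_distrib_right)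
    also have "\<dots> \<le> M * (L * norm (e s))" using M[OF s] \<open>L \<ge> 0\<close> by (intro mult_right_mono) auto
    finally show "norm (e' s) \<le> M * L * norm (e s) + 0" by simp
  qed (use init \<open>M \<ge> 0\<close> \<open>L \<ge> 0\<close> in \<open>auto simp: e_def\<close>)
  then show ?thesis by (simp add: e_def)
qed

subsection \<open>The vector fields on the product space\<close>

definition graph_field ::
    "('m \<Rightarrow> real^'n \<Rightarrow> real^'n) \<Rightarrow> ('p \<Rightarrow> 'm \<Rightarrow> (real^'n) \<times> (real^'p) \<Rightarrow> real) \<Rightarrow>
     'm \<Rightarrow> (real^'n) \<times> (real^'p) \<Rightarrow> (real^'n) \<times> (real^'p)" where
  "graph_field r h j z = (r j (fst z), \<chi> i. h i j z)"

lemma has_derivative_vec_lambda: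
  fixes f :: "'a::real_normed_vector \<Rightarrow> 'i::finite \<Rightarrow> real"
  assumes "\<And>i. ((\<lambda>x. f x i) has_derivative (\<lambda>v. f' v i)) (at x)"
  shows "((\<lambda>x. \<chi> i. f x i) has_derivative (\<lambda>v. \<chi> i. f' v i)) (at x)"
proof -
  have "((\<lambda>x. \<Sum>i\<in>UNIV. f x i *\<^sub>R axis i 1 :: real^'i) has_derivative (\<lambda>v. \<Sum>i\<in>UNIV. f' v i *\<^sub>R axis i 1)) (at x)"
    by (intro has_derivative_sum has_derivative_scaleR_left assms)
  moreover have "(\<Sum>i\<in>UNIV. g i *\<^sub>R axis i 1) = (\<chi> i. g i)" for g :: "'i \<Rightarrow> real"
    by (simp add: vec_eq_iff axis_def if_distrib[where f="\<lambda>a. _ * a"] cong: if_cong)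
  ultimately show ?thesis by simp
qed

context
  fixes r :: "'m::finite \<Rightarrow> real^'n \<Rightarrow> real^'n" and h :: "'p::finite \<Rightarrow> 'm \<Rightarrow> (real^'n) \<times> (real^'p) \<Rightarrow> real"
    and \<Omega> :: "(real^'n) set" and \<Theta> :: "(real^'p) set"
  assumes \<Omega>: "open \<Omega>" and \<Theta>: "open \<Theta>"
    and r: "\<And>j. smooth_on \<Omega> (r j)" and h: "\<And>i j. smooth_on (\<Omega> \<times> \<Theta>) (h i j)"
begin

lemma smooth_graph_field: "smooth_on (\<Omega> \<times> \<Theta>) (graph_field r h j)"
  unfolding smooth_on_def
proof
  fix k
  have o: "open (\<Omega> \<times> \<Theta>)" using \<Omega> \<Theta> by (rule open_Times)
  have "Ck_on k (\<lambda>z. (r j (fst z), \<chi> i. h i j z)) (\<Omega> \<times> \<Theta>)"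
  proof (intro Ck_on_Pair Ck_on_vec_lambda o smooth_onD[OF h])
    show "Ck_on k (\<lambda>z. r j (fst z)) (\<Omega> \<times> \<Theta>)"
      by (rule Ck_on_compose[OF o \<Omega> Ck_on_linear[OF bounded_linear_fst o] smooth_onD[OF r]]) auto
  qed
  then show "Ck_on k (graph_field r h j) (\<Omega> \<times> \<Theta>)" by (simp add: graph_field_def[abs_def])
qed

lemma frechet_derivative_graph_field:
  assumes z: "z \<in> \<Omega> \<times> \<Theta>"
  shows "frechet_derivative (graph_field r h j) (at z) v
    = (frechet_derivative (r j) (at (fst z)) (fst v), \<chi> i. frechet_derivative (h i j) (at z) v)"
proof -
  have fz: "fst z \<in> \<Omega>" using z by auto
  have 1: "((\<lambda>z. r j (fst z)) has_derivative (\<lambda>v. frechet_derivative (r j) (at (fst z)) (fst v))) (at z)"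
    using diff_chain_at[OF bounded_linear_imp_has_derivative[OF bounded_linear_fst, of "at z"] smooth_on_has_derivative[OF r fz]]
    by (simp add: o_def)
  have 2: "((\<lambda>z. \<chi> i. h i j z) has_derivative (\<lambda>v. \<chi> i. frechet_derivative (h i j) (at z) v)) (at z)"
    by (intro has_derivative_vec_lambda smooth_on_has_derivative[OF h z])
  from frechet_derivative_at[OF has_derivative_Pair[OF 1 2], symmetric]
  show ?thesis by (simp add: graph_field_def[abs_def])
qed

text \<open>As an operator on functions of (u, \<phi>), X_j is r_j plus \<Sum>_s h^s_j
  \<partial>/\<partial>\<phi>^s. Hence the \<Theta>-part of the bracket is the left side of the
  integrability conditions, while the \<Omega>-part is the bracket of the r_j; both carry the same
  coefficients.\<close>

lemma lie_bracket_graph_field: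
  fixes c :: "'m \<Rightarrow> 'm \<Rightarrow> 'm \<Rightarrow> real^'n \<Rightarrow> real"
  assumes c: "\<And>j k u. u \<in> \<Omega> \<Longrightarrow> lie_bracket (r j) (r k) u = (\<Sum>l\<in>UNIV. c l j k u *\<^sub>R r l u)"
    and integrability: "\<And>i j k u \<phi>. u \<in> \<Omega> \<Longrightarrow> \<phi> \<in> \<Theta> \<Longrightarrow>
         (\<Sum>l\<in>UNIV. pderiv_u (h i k) l (u, \<phi>) * vf_apply (r j) (\<lambda>v. v $ l) u
                 - pderiv_u (h i j) l (u, \<phi>) * vf_apply (r k) (\<lambda>v. v $ l) u)
       + (\<Sum>s\<in>UNIV. pderiv_phi (h i k) s (u, \<phi>) * h s j (u, \<phi>)
                 - pderiv_phi (h i j) s (u, \<phi>) * h s k (u, \<phi>))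
       = (\<Sum>l\<in>UNIV. c l j k u * h i l (u, \<phi>))"
    and z: "z \<in> \<Omega> \<times> \<Theta>"
  shows "lie_bracket (graph_field r h j) (graph_field r h k) z
    = (\<Sum>l\<in>UNIV. c l j k (fst z) *\<^sub>R graph_field r h l z)"
proof -
  obtain u \<phi> where z_eq: "z = (u, \<phi>)" by (cases z)
  have u: "u \<in> \<Omega>" "\<phi> \<in> \<Theta>" using z z_eq by auto
  have coord: "vf_apply (r j) (\<lambda>v. v $ l) u = r j u $ l" for j l
  proof -
    have "((\<lambda>v::real^'n. v $ l) has_derivative (\<lambda>v. v $ l)) (at u)"
      by (rule bounded_linear_imp_has_derivative[OF bounded_linear_vec_nth])
    from frechet_derivative_at[OF this, symmetric] show ?thesis by (simp add: vf_apply_def)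
  qed
  have Dh: "frechet_derivative (h i k) (at z) (graph_field r h j z)
      = (\<Sum>l\<in>UNIV. pderiv_u (h i k) l z * r j u $ l) + (\<Sum>s\<in>UNIV. pderiv_phi (h i k) s z * h s j z)" for i j k
    unfolding graph_field_def
    by (subst frechet_derivative_eq_pderivs[OF smooth_on_has_derivative[OF h z]]) (simp add: z_eq)
  have "fst (lie_bracket (graph_field r h j) (graph_field r h k) z) = lie_bracket (r j) (r k) u"
    by (simp add: lie_bracket_def vf_apply_def frechet_derivative_graph_field[OF z])
      (simp add: graph_field_def z_eq)
  moreover have "snd (lie_bracket (graph_field r h j) (graph_field r h k) z) $ i = (\<Sum>l\<in>UNIV. c l j k u * h i l z)" for i
  proof -
    have "snd (lie_bracket (graph_field r h j) (graph_field r h k) z) $ i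
      = frechet_derivative (h i k) (at z) (graph_field r h j z) - frechet_derivative (h i j) (at z) (graph_field r h k z)"
      by (simp add: lie_bracket_def vf_apply_def frechet_derivative_graph_field[OF z])
    also have "\<dots> = (\<Sum>l\<in>UNIV. c l j k u * h i l z)"
      unfolding Dh using integrability[OF u, of i k j] by (simp add: coord z_eq sum_subtractf)
    finally show ?thesis .
  qed
  ultimately show ?thesis
    by (simp add: prod_eq_iff vec_eq_iff fst_sum snd_sum c[OF u(1)] z_eq graph_field_def)
qed

end

text \<open>The hypothesis gives c only pointwise. Independence of the frame makes the coefficients
  unique, so they agree with the smooth ones supplied by involution.\<close>

lemma smooth_structure_functions:
  fixes r :: "'m::finite \<Rightarrow> real^'n \<Rightarrow> real^'n"
  assumes "open \<Omega>" and r: "partial_frame_on \<Omega> r" and inv: "in_involution_on \<Omega> r"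
    and c: "\<And>j k u. u \<in> \<Omega> \<Longrightarrow> lie_bracket (r j) (r k) u = (\<Sum>l\<in>UNIV. c l j k u *\<^sub>R r l u)"
  shows "smooth_on \<Omega> (c l j k)"
proof -
  obtain a :: "'m \<Rightarrow> real^'n \<Rightarrow> real" where a: "smooth_on \<Omega> (a l)"
    "\<And>u. u \<in> \<Omega> \<Longrightarrow> lie_bracket (r j) (r k) u = (\<Sum>l\<in>UNIV. a l u *\<^sub>R r l u)"
    using inv unfolding in_involution_on_def by metis
  have "c l j k u = a l u" if u: "u \<in> \<Omega>" for u
  proof -
    have "(\<Sum>l\<in>UNIV. (c l j k u - a l u) *\<^sub>R r l u) = 0"
      using c[OF u, of j k] a(2)[OF u] by (simp add: scaleR_diff_left sum_subtractf)
    from independent_family_sum_eq_0[OF _ _ this] show ?thesis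
      using r u by (simp add: partial_frame_on_def)
  qed
  then show ?thesis
    using a(1) Ck_on_cong[OF \<open>open \<Omega>\<close>, of "c l j k" "a l"] by (simp add: smooth_on_def)
qed

text \<open>Gathers the component equations into one equation for the total derivative, which says
  that the graph is tangent to each X_j.\<close>

lemma solves_system_iff:
  "solves_system r h \<Theta> W \<alpha> \<longleftrightarrow> smooth_on W \<alpha> \<and> \<alpha> ` W \<subseteq> \<Theta> \<and>
    (\<forall>u\<in>W. \<forall>j. frechet_derivative \<alpha> (at u) (r j u) = snd (graph_field r h j (u, \<alpha> u)))"
proof -
  have "vf_apply (r j) (\<lambda>v. \<alpha> v $ i) u = frechet_derivative \<alpha> (at u) (r j u) $ i"
    if "smooth_on W \<alpha>" "u \<in> W" for i j u
    using frechet_derivative_at[OF bounded_linear.has_derivative[OF bounded_linear_vec_nth smooth_on_has_derivative[OF that]],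
        symmetric, of i]
    by (simp add: vf_apply_def)
  then show ?thesis unfolding solves_system_def by (auto simp: graph_field_def vec_eq_iff)
qed

text \<open>B is an arbitrary set here, because a set of velocities of curves is not visibly a
  subspace; closure under negation is taken from the span alone.\<close>

lemma direct_sum_add_eq_0:
  assumes "direct_sum_UNIV (span A) B" "a \<in> span A" "b \<in> B" "a + b = 0"
  shows "a = 0 \<and> b = 0"
proof -
  have b: "b = - a" using assms(4) by (simp add: eq_neg_iff_add_eq_0 add.commute)
  then have "b \<in> span A \<inter> B" using span_neg[OF assms(2)] assms(3) by simp
  then have "b = 0" using assms(1) unfolding direct_sum_UNIV_def by blast
  then show ?thesis using b by simp
qed

subsection \<open>Existence and uniqueness\<close>

text \<open>Projection onto the coordinate slice: in a straightening chart \<Xi> becomes the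
  fixed-point set of this map. As a map of R^n to itself it needs no separate type for points of the
  slice.\<close>

definition kill_coords :: "'n set \<Rightarrow> real^'n \<Rightarrow> real^'n" where
  "kill_coords K x = (\<chi> i. if i \<in> K then 0 else x $ i)"

lemma bounded_linear_kill_coords: "bounded_linear (kill_coords K)"
  by (intro linear_conv_bounded_linear[THEN iffD1] linearI) (auto simp: kill_coords_def vec_eq_iff)

lemma kill_coords_eq_iff: "kill_coords K x = x \<longleftrightarrow> (\<forall>k\<in>K. x $ k = 0)"
  by (auto simp: kill_coords_def vec_eq_iff)

lemma kill_coords_idem: "kill_coords K (kill_coords K x) = kill_coords K x"
  by (simp add: kill_coords_def vec_eq_iff)

lemma norm_kill_coords_le: "norm (kill_coords K x) \<le> norm x"
  unfolding norm_vec_def by (intro L2_set_mono) (auto simp: kill_coords_def)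

lemma kill_coords_decompose:
  fixes \<kappa> :: "'m::finite \<Rightarrow> 'n::finite"
  assumes "inj \<kappa>"
  shows "x = kill_coords (range \<kappa>) x + (\<Sum>k\<in>UNIV. x $ \<kappa> k *\<^sub>R axis (\<kappa> k) 1)"
proof (rule vec_eq_iff[THEN iffD2], rule allI)
  fix i
  have eq: "(\<Sum>k\<in>UNIV. x $ \<kappa> k *\<^sub>R axis (\<kappa> k) (1::real)) $ i = (\<Sum>k\<in>UNIV. if \<kappa> k = i then x $ i else 0)"
    by (auto simp: axis_def intro!: sum.cong)
  show "x $ i = (kill_coords (range \<kappa>) x + (\<Sum>k\<in>UNIV. x $ \<kappa> k *\<^sub>R axis (\<kappa> k) 1)) $ i"
  proof (cases "i \<in> range \<kappa>")
    case True
    then obtain j where "i = \<kappa> j" by blast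
    then show ?thesis using assms unfolding vector_add_component eq by (simp add: kill_coords_def inj_eq)
  next
    case False
    then have "\<kappa> k \<noteq> i" for k by blast
    then show ?thesis using False unfolding vector_add_component eq by (simp add: kill_coords_def)
  qed
qed

text \<open>Z is the exponential map started on the graph of g and written in one variable x of R^n:
  the coordinates of x indexed by \<kappa> are the flow parameters, and the remaining ones locate
  the starting point through a slice chart. The chart \<psi> is returned as well, so that points of
  \<Xi> near ubar can be recognised as slice points.\<close>

lemma adapted_coordinates:
  fixes r :: "'m::finite \<Rightarrow> real^'n \<Rightarrow> real^'n" and X :: "'m \<Rightarrow> (real^'n) \<times> (real^'p) \<Rightarrow> (real^'n) \<times> (real^'p)"
    and C :: "'m \<Rightarrow> 'm \<Rightarrow> 'm \<Rightarrow> (real^'n) \<times> (real^'p) \<Rightarrow> real"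
  assumes \<Omega>: "open \<Omega>" and \<Theta>: "open \<Theta>" and frame: "partial_frame_on \<Omega> r"
    and X: "\<And>j. smooth_on (\<Omega> \<times> \<Theta>) (X j)" and fstX: "\<And>j z. fst (X j z) = r j (fst z)"
    and C: "\<And>l j k. smooth_on (\<Omega> \<times> \<Theta>) (C l j k)"
    and bracket: "\<And>j k z. z \<in> \<Omega> \<times> \<Theta> \<Longrightarrow> lie_bracket (X j) (X k) z = (\<Sum>l\<in>UNIV. C l j k z *\<^sub>R X l z)"
    and ubar: "ubar \<in> \<Omega>" "ubar \<in> \<Xi>" and \<Xi>: "embedded_submanifold CARD('m) \<Xi>" "transversal \<Xi> r"
    and g: "smooth_on_submanifold \<Xi> g" "g ` \<Xi> \<subseteq> \<Theta>"
  obtains S x0 Z and A :: "real^'n \<Rightarrow> real^'m^'m" and \<kappa> :: "'m \<Rightarrow> 'n" and U \<psi>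
  where "open S" "x0 \<in> S" "inj \<kappa>" "smooth_on S Z" "continuous_on S A"
    "\<And>x. x \<in> S \<Longrightarrow> Z x \<in> \<Omega> \<times> \<Theta>" "\<And>x. x \<in> S \<Longrightarrow> invertible (A x)"
    "\<And>x k. x \<in> S \<Longrightarrow> frechet_derivative Z (at x) (axis (\<kappa> k) 1) = (\<Sum>l\<in>UNIV. (A x $ k $ l) *\<^sub>R X l (Z x))"
    "\<And>x. x \<in> S \<Longrightarrow> kill_coords (range \<kappa>) x = x \<Longrightarrow> fst (Z x) \<in> \<Xi> \<and> snd (Z x) = g (fst (Z x))"
    "kill_coords (range \<kappa>) x0 = x0" "Z x0 = (ubar, g ubar)"
    "open U" "ubar \<in> U" "continuous_on U \<psi>" "\<psi> ubar = x0"
    "\<And>u. u \<in> \<Xi> \<inter> U \<Longrightarrow> \<psi> u \<in> S \<Longrightarrow> kill_coords (range \<kappa>) (\<psi> u) = \<psi> u \<and> fst (Z (\<psi> u)) = u"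
    "\<And>v. frechet_derivative (\<lambda>x. fst (Z x)) (at x0) v = 0 \<Longrightarrow> v = 0"
proof -
  from bspec[OF \<Xi>(1)[unfolded embedded_submanifold_def] ubar(2)]
  obtain U and V :: "(real^'n) set" and \<psi> \<psi>' and K :: "'n set" where "ubar \<in> U" and diff: "diffeomorphism U V \<psi> \<psi>'" and "card K = CARD('m)"
    and slice: "\<psi> ` (\<Xi> \<inter> U) = {y\<in>V. \<forall>k\<in>K. y $ k = 0}"
    by blast
  \<comment> \<open>The codimension equals the number of fields, so each t_k can be stored in its
    own vanishing coordinate.\<close>
  obtain \<kappa> :: "'m \<Rightarrow> 'n" where "bij_betw \<kappa> UNIV K"
    using finite_same_card_bij[of "UNIV :: 'm set" K] \<open>card K = CARD('m)\<close> by auto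
  then have \<kappa>: "inj \<kappa>" "range \<kappa> = K" by (auto simp: bij_betw_def)
  have UV: "open U" "open V" "smooth_on U \<psi>" "smooth_on V \<psi>'" "homeomorphism U V \<psi> \<psi>'"
    using diff by (auto simp: diffeomorphism_def)
  have \<psi>: "\<psi>' (\<psi> u) = u" "\<psi> u \<in> V" if "u \<in> U" for u using UV(5) that by (auto simp: homeomorphism_def)
  have \<psi>': "\<psi> (\<psi>' y) = y" "\<psi>' y \<in> U" if "y \<in> V" for y using UV(5) that by (auto simp: homeomorphism_def)
  from bspec[OF g(1)[unfolded smooth_on_submanifold_def] ubar(2)]
  obtain UG G where UG: "open UG" "ubar \<in> UG" "smooth_on UG G" "\<And>y. y \<in> \<Xi> \<inter> UG \<Longrightarrow> G y = g y"
    by blast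
  have oD: "open (\<Omega> \<times> \<Theta>)" using \<Omega> \<Theta> by (rule open_Times)
  have w0: "(ubar, g ubar) \<in> \<Omega> \<times> \<Theta>" using ubar g by auto
  obtain N E and A0 :: "(real^'m) \<times> (real^'n) \<times> (real^'p) \<Rightarrow> real^'m^'m" where N: "open N" "(0, ubar, g ubar) \<in> N"
    and E: "smooth_on N E" "\<And>q. q \<in> N \<Longrightarrow> E q \<in> \<Omega> \<times> \<Theta>" "\<And>w. (0, w) \<in> N \<Longrightarrow> E (0, w) = w"
    and dE: "\<And>q k. q \<in> N \<Longrightarrow> frechet_derivative E (at q) (axis k 1, 0) = (\<Sum>l\<in>UNIV. (A0 q $ k $ l) *\<^sub>R X l (E q))"
    and A0: "continuous_on N A0" "\<And>q. q \<in> N \<Longrightarrow> invertible (A0 q)"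
    using involutive_exponential[OF X C oD w0 bracket] by blast
  let ?P = "kill_coords K"
  define \<tau> where "\<tau> = (\<lambda>x :: real^'n. \<chi> j. x $ \<kappa> j)"
  have bl\<tau>: "bounded_linear \<tau>"
    unfolding \<tau>_def by (intro linear_conv_bounded_linear[THEN iffD1] linearI) (auto simp: vec_eq_iff)
  have \<tau>0: "\<tau> x = 0" if "?P x = x" for x
    using that[unfolded kill_coords_eq_iff] \<kappa>(2) by (auto simp: \<tau>_def vec_eq_iff)
  define x0 where "x0 = \<psi> ubar"
  have "x0 \<in> {y\<in>V. \<forall>k\<in>K. y $ k = 0}" using \<open>ubar \<in> U\<close> ubar(2) slice by (auto simp: x0_def)
  then have x0: "x0 \<in> V" "?P x0 = x0" "\<psi>' x0 = ubar"
    using \<psi>[OF \<open>ubar \<in> U\<close>] by (auto simp: kill_coords_eq_iff x0_def)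
  define V1 where "V1 = V \<inter> \<psi>' -` UG"
  have V1: "open V1" "x0 \<in> V1" "V1 \<subseteq> V"
    using continuous_open_preimage[OF smooth_on_imp_continuous_on[OF UV(4)] UV(2) UG(1)] x0 UG(2)
    by (auto simp: V1_def)
  \<comment> \<open>g is smooth only along \<Xi>, so its local ambient extension G is used; on the
    slice Y still yields the graph of g.\<close>
  define Y where "Y = (\<lambda>y. (\<psi>' y, G (\<psi>' y)))"
  have Y: "Ck_on k Y V1" for k
    unfolding Y_def
  proof (intro Ck_on_Pair V1)
    show "Ck_on k \<psi>' V1" using smooth_onD[OF smooth_on_subset[OF UV(4) V1(3)]] .
    from Ck_on_compose[OF V1(1) UG(1) this smooth_onD[OF UG(3)]]
    show "Ck_on k (\<lambda>y. G (\<psi>' y)) V1" by (auto simp: V1_def)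
  qed
  define O0 where "O0 = ?P -` V1"
  have contP: "continuous_on T ?P" for T
    using bounded_linear_kill_coords by (rule linear_continuous_on)
  have O0: "open O0" "x0 \<in> O0"
    using open_vimage[OF V1(1) contP] V1(2) x0(2) by (auto simp: O0_def)
  \<comment> \<open>Projecting before applying Y freezes the starting point while a
    \<kappa>-coordinate varies, so that derivatives of Z in these directions are pure t-derivatives
    of the exponential map.\<close>
  define I where "I = (\<lambda>x. (\<tau> x, Y (?P x)))"
  have YP: "Ck_on k (\<lambda>x. Y (?P x)) O0" for k
    by (rule Ck_on_compose[OF O0(1) V1(1) Ck_on_linear[OF bounded_linear_kill_coords O0(1)] Y]) (auto simp: O0_def)
  have I: "Ck_on k I O0" for k
    unfolding I_def by (intro Ck_on_Pair O0 Ck_on_linear[OF bl\<tau>] YP)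
  define S where "S = O0 \<inter> I -` N"
  have Ix0: "I x0 = (0, ubar, g ubar)"
    using \<tau>0[OF x0(2)] x0 UG(2,4) ubar(2) by (simp add: I_def Y_def)
  have S: "open S" "x0 \<in> S" "S \<subseteq> O0" "I ` S \<subseteq> N"
    using continuous_open_preimage[OF Ck_on_imp_continuous_on[OF I[of 0]] O0(1) N(1)] O0(2) Ix0 N(2)
    by (auto simp: S_def)
  define Z where "Z = (\<lambda>x. E (I x))"
  have IN: "I x \<in> N" if "x \<in> S" for x using S(4) that by blast
  have Zk: "smooth_on S Z"
    unfolding smooth_on_def Z_def
    by (intro allI Ck_on_compose[OF S(1) N(1) Ck_on_subset[OF I S(3)] smooth_onD[OF E(1)] S(4)])
  have contA: "continuous_on S (\<lambda>x. A0 (I x))"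
    by (rule continuous_on_compose2[OF A0(1) continuous_on_subset[OF Ck_on_imp_continuous_on[OF I[of 0]] S(3)] S(4)])
  have deriv: "frechet_derivative Z (at x) (axis (\<kappa> k) 1) = (\<Sum>l\<in>UNIV. (A0 (I x) $ k $ l) *\<^sub>R X l (Z x))"
    if x: "x \<in> S" for x k
  proof -
    have "?P x \<in> V1" using x S(3) by (auto simp: O0_def)
    then have dY: "(Y has_derivative frechet_derivative Y (at (?P x))) (at (?P x))" by (rule Ck_on_SucD[OF Y])
    have dYP: "((\<lambda>x. Y (?P x)) has_derivative (\<lambda>v. frechet_derivative Y (at (?P x)) (?P v))) (at x)"
      using diff_chain_at[OF bounded_linear_imp_has_derivative[OF bounded_linear_kill_coords] dY]
      by (simp add: o_def)
    have "(I has_derivative (\<lambda>v. (\<tau> v, frechet_derivative Y (at (?P x)) (?P v)))) (at x)"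
      unfolding I_def by (intro has_derivative_Pair bounded_linear_imp_has_derivative[OF bl\<tau>] dYP)
    from diff_chain_at[OF this smooth_on_has_derivative[OF E(1) IN[OF x]]]
    have "(Z has_derivative (\<lambda>v. frechet_derivative E (at (I x)) (\<tau> v, frechet_derivative Y (at (?P x)) (?P v)))) (at x)"
      by (simp add: o_def Z_def)
    from frechet_derivative_at[OF this, symmetric]
    have "frechet_derivative Z (at x) (axis (\<kappa> k) 1)
        = frechet_derivative E (at (I x)) (\<tau> (axis (\<kappa> k) 1), frechet_derivative Y (at (?P x)) (?P (axis (\<kappa> k) 1)))"
      by simp
    also have "\<tau> (axis (\<kappa> k) 1) = axis k 1" using \<kappa>(1) by (auto simp: \<tau>_def axis_def vec_eq_iff inj_eq)
    also have "?P (axis (\<kappa> k) 1) = 0" using \<kappa>(2) by (auto simp: kill_coords_def axis_def vec_eq_iff)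
    also have "frechet_derivative Y (at (?P x)) 0 = 0" using linear_0[OF has_derivative_linear[OF dY]] .
    finally show ?thesis using dE[OF IN[OF x]] by (simp add: Z_def)
  qed
  have Z_eq: "Z x = Y x" if "x \<in> S" "?P x = x" for x
    using E(3)[of "Y x"] IN[OF that(1)] \<tau>0[OF that(2)] that(2) by (simp add: Z_def I_def)
  have init: "fst (Z x) = \<psi>' x \<and> \<psi>' x \<in> \<Xi> \<and> x \<in> V \<and> snd (Z x) = g (\<psi>' x)" if x: "x \<in> S" "?P x = x" for x
  proof -
    have "x \<in> V1" using x S(3) by (auto simp: O0_def)
    then have xV: "x \<in> V" "\<psi>' x \<in> UG" by (auto simp: V1_def)
    then have "x \<in> \<psi> ` (\<Xi> \<inter> U)" using x(2) slice by (simp add: kill_coords_eq_iff)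
    then have "\<psi>' x \<in> \<Xi>" using \<psi>(1) by auto
    then show ?thesis using Z_eq[OF x] UG(4) xV by (simp add: Y_def)
  qed
  have Zx0: "Z x0 = (ubar, g ubar)"
    using init[OF S(2) x0(2)] x0(3) by (simp add: prod_eq_iff)
  \<comment> \<open>A kernel vector gives q + p = 0 with q in the span of the frame and p tangent to
    \<Xi>. Transversality forces q = p = 0; then q kills the \<kappa>-coordinates of v and p kills
    the others.\<close>
  have inj: "v = 0" if v: "frechet_derivative (\<lambda>x. fst (Z x)) (at x0) v = 0" for v
  proof -
    let ?D = "frechet_derivative Z (at x0)"
    have dZ: "(Z has_derivative ?D) (at x0)" using smooth_on_has_derivative[OF Zk S(2)] .
    have lD: "linear ?D" using dZ by (rule has_derivative_linear)
    have "fst (?D v) = 0"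
      using v frechet_derivative_at[OF has_derivative_fst[OF dZ], symmetric] by simp
    define p where "p = fst (?D (?P v))"
    define q where "q = (\<Sum>l\<in>UNIV. (\<Sum>k\<in>UNIV. v $ \<kappa> k * A0 (I x0) $ k $ l) *\<^sub>R r l ubar)"
    have "?D v = ?D (?P v + (\<Sum>k\<in>UNIV. v $ \<kappa> k *\<^sub>R axis (\<kappa> k) 1))"
      by (rule arg_cong[OF kill_coords_decompose[OF \<kappa>(1), unfolded \<kappa>(2)]])
    also have "\<dots> = ?D (?P v) + (\<Sum>k\<in>UNIV. v $ \<kappa> k *\<^sub>R ?D (axis (\<kappa> k) 1))"
      by (simp only: linear_add[OF lD] linear_sum[OF lD] linear_scale[OF lD])
    finally have "?D v = ?D (?P v) + (\<Sum>k\<in>UNIV. v $ \<kappa> k *\<^sub>R ?D (axis (\<kappa> k) 1))" .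
    moreover have "fst (\<Sum>k\<in>UNIV. v $ \<kappa> k *\<^sub>R ?D (axis (\<kappa> k) 1)) = q"
      unfolding deriv[OF S(2)] q_def
      by (simp add: fst_sum fstX Zx0 scaleR_sum_right scaleR_sum_left) (rule sum.swap)
    ultimately have pq: "q + p = 0" using \<open>fst (?D v) = 0\<close> by (simp add: p_def add.commute)
    \<comment> \<open>The image of a straight line in the slice, hence a curve in \<Xi> with
      velocity p: the witness that \<open>tangent_space\<close> asks for.\<close>
    let ?\<gamma> = "\<lambda>s. fst (Z (x0 + s *\<^sub>R ?P v))"
    have line: "((\<lambda>s. x0 + s *\<^sub>R ?P v) has_vector_derivative ?P v) (at s)" for s
      by (auto intro!: derivative_eq_intros)
    have "open ((\<lambda>s. x0 + s *\<^sub>R ?P v) -` S)" by (intro open_vimage S(1) continuous_intros)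
    moreover have "0 \<in> (\<lambda>s. x0 + s *\<^sub>R ?P v) -` S" using S(2) by simp
    ultimately obtain \<epsilon> where "\<epsilon> > 0" and "ball 0 \<epsilon> \<subseteq> (\<lambda>s. x0 + s *\<^sub>R ?P v) -` S"
      using open_contains_ball by metis
    then have \<epsilon>: "x0 + s *\<^sub>R ?P v \<in> S" if "s \<in> {-\<epsilon><..<\<epsilon>}" for s
      using that by (auto simp: dist_real_def subset_iff)
    have fixed: "?P (x0 + s *\<^sub>R ?P v) = x0 + s *\<^sub>R ?P v" for s
      by (simp add: linear_add[OF bounded_linear.linear[OF bounded_linear_kill_coords]]
          linear_scale[OF bounded_linear.linear[OF bounded_linear_kill_coords]] x0(2) kill_coords_idem)
    have d\<gamma>: "(?\<gamma> has_vector_derivative p) (at 0)"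
      using has_vector_derivative_fst[OF has_vector_derivative_chain_at[of Z ?D "\<lambda>s. x0 + s *\<^sub>R ?P v" 0, OF _ line]] dZ
      by (simp add: p_def)
    have "smooth_on {-\<epsilon><..<\<epsilon>} ?\<gamma>"
      unfolding smooth_on_def
    proof
      fix k
      have "Ck_on k (\<lambda>s. x0 + s *\<^sub>R ?P v) {-\<epsilon><..<\<epsilon>}"
        by (intro Ck_on_add Ck_on_const Ck_on_scaleR Ck_on_ident) auto
      moreover have "(\<lambda>s. x0 + s *\<^sub>R ?P v) ` {-\<epsilon><..<\<epsilon>} \<subseteq> S" using \<epsilon> by blast
      ultimately have "Ck_on k (\<lambda>s. Z (x0 + s *\<^sub>R ?P v)) {-\<epsilon><..<\<epsilon>}"
        by (intro Ck_on_compose[OF open_greaterThanLessThan S(1) _ smooth_onD[OF Zk]])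
      then show "Ck_on k ?\<gamma> {-\<epsilon><..<\<epsilon>}" by (intro Ck_on_fst) auto
    qed
    moreover have "?\<gamma> ` {-\<epsilon><..<\<epsilon>} \<subseteq> \<Xi>" using init[OF \<epsilon> fixed] by auto
    moreover have "?\<gamma> 0 = ubar" by (simp add: Zx0)
    ultimately have "p \<in> tangent_space \<Xi> ubar"
      unfolding tangent_space_def using \<open>\<epsilon> > 0\<close> d\<gamma> by blast
    moreover have "q \<in> span (range (\<lambda>j. r j ubar))"
      unfolding q_def by (intro span_sum span_scale span_base) auto
    moreover have "direct_sum_UNIV (span (range (\<lambda>j. r j ubar))) (tangent_space \<Xi> ubar)"
      using \<Xi>(2) ubar(2) by (simp add: transversal_def)
    ultimately have p0: "p = 0" and q0: "q = 0" using direct_sum_add_eq_0 pq by metis+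
    have ind: "inj (\<lambda>j. r j ubar)" "independent (range (\<lambda>j. r j ubar))"
      using frame ubar(1) by (auto simp: partial_frame_on_def)
    have "(\<Sum>k\<in>UNIV. v $ \<kappa> k * A0 (I x0) $ k $ l) = 0" for l
      using independent_family_sum_eq_0[OF ind q0[unfolded q_def]] .
    \<comment> \<open>Here A acts on a row vector, so its transpose is the matrix to cancel.\<close>
    then have "(\<Sum>k\<in>UNIV. (transpose (A0 (I x0)) $ l $ k) *\<^sub>R (v $ \<kappa> k)) = 0" for l
      by (simp add: transpose_def mult.commute)
    then have v\<kappa>: "v $ \<kappa> k = 0" for k
      by (rule invertible_sum_eq_0[OF transpose_invertible[OF A0(2)[OF IN[OF S(2)]]], where d="\<lambda>k. v $ \<kappa> k"])
    \<comment> \<open>The chart carries \<gamma> back to the straight line, so its velocity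
      \<open>?P v\<close> is the image of p = 0.\<close>
    have "?P v = 0"
    proof -
      have "ubar \<in> U" by fact
      then have "(\<psi> has_derivative frechet_derivative \<psi> (at ubar)) (at (?\<gamma> 0))"
        using smooth_on_has_derivative[OF UV(3)] by (simp add: Zx0)
      from has_vector_derivative_chain_at[OF this d\<gamma>]
      have "((\<lambda>s. \<psi> (?\<gamma> s)) has_vector_derivative frechet_derivative \<psi> (at ubar) 0) (at 0)" by (simp add: p0)
      moreover have "frechet_derivative \<psi> (at ubar) 0 = 0"
        using linear_0[OF has_derivative_linear[OF smooth_on_has_derivative[OF UV(3) \<open>ubar \<in> U\<close>]]] .
      ultimately have "((\<lambda>s. \<psi> (?\<gamma> s)) has_vector_derivative 0) (at 0)" by simp
      moreover have "\<psi> (?\<gamma> s) = x0 + s *\<^sub>R ?P v" if "s \<in> {-\<epsilon><..<\<epsilon>}" for s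
        using init[OF \<epsilon>[OF that] fixed] \<psi>'(1) by auto
      ultimately have "((\<lambda>s. x0 + s *\<^sub>R ?P v) has_vector_derivative 0) (at 0)"
        using \<open>\<epsilon> > 0\<close>
        by (elim has_vector_derivative_transform_within_open[where S="{-\<epsilon><..<\<epsilon>}"]) auto
      from vector_derivative_unique_at[OF this line] show ?thesis by simp
    qed
    then show "v = 0" using kill_coords_decompose[OF \<kappa>(1), of v] v\<kappa> \<kappa>(2) by simp
  qed
  show thesis
  proof (rule that[of S x0 \<kappa> Z "\<lambda>x. A0 (I x)" U \<psi>])
    show "Z x \<in> \<Omega> \<times> \<Theta>" if "x \<in> S" for x using E(2) IN[OF that] by (simp add: Z_def)
    show "invertible (A0 (I x))" if "x \<in> S" for x using A0(2) IN[OF that] .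
    show "fst (Z x) \<in> \<Xi> \<and> snd (Z x) = g (fst (Z x))" if "x \<in> S" "kill_coords (range \<kappa>) x = x" for x
      using init that unfolding \<kappa>(2) by metis
    show "continuous_on U \<psi>" using UV(3) by (rule smooth_on_imp_continuous_on)
    show "kill_coords (range \<kappa>) (\<psi> u) = \<psi> u \<and> fst (Z (\<psi> u)) = u" if u: "u \<in> \<Xi> \<inter> U" "\<psi> u \<in> S" for u
    proof -
      have "\<psi> u \<in> {y\<in>V. \<forall>k\<in>K. y $ k = 0}" using u slice by blast
      then have P: "?P (\<psi> u) = \<psi> u" by (simp add: kill_coords_eq_iff)
      then show ?thesis using init[OF u(2) P] \<psi>(1) u(1) by (simp add: \<kappa>(2))
    qed
  qed (use S \<kappa> Zk contA deriv x0 Zx0 UV \<open>ubar \<in> U\<close> inj in \<open>simp_all add: x0_def\<close>)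
qed

section \<open>Construction of the solution and comparison with any other\<close>

theorem theorem3p5:
  fixes r :: "'m::finite \<Rightarrow> real^'n \<Rightarrow> real^'n"
    and c :: "'m \<Rightarrow> 'm \<Rightarrow> 'm \<Rightarrow> real^'n \<Rightarrow> real"
    and h :: "'p::finite \<Rightarrow> 'm \<Rightarrow> (real^'n) \<times> (real^'p) \<Rightarrow> real"
    and \<Omega> \<Xi> :: "(real^'n) set"
    and \<Theta> :: "(real^'p) set"
    and g :: "real^'n \<Rightarrow> real^'p"
    and ubar :: "real^'n"
  assumes "CARD('m) \<le> CARD('n)"
    and "open \<Omega>" and "open \<Theta>"
    and "partial_frame_on \<Omega> r" and "in_involution_on \<Omega> r"
    and "\<And>i j. smooth_on (\<Omega> \<times> \<Theta>) (h i j)"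
    and "\<And>j k u. u \<in> \<Omega> \<Longrightarrow> lie_bracket (r j) (r k) u = (\<Sum>l\<in>UNIV. c l j k u *\<^sub>R r l u)"
    and integrability:
      "\<And>i j k u \<phi>. u \<in> \<Omega> \<Longrightarrow> \<phi> \<in> \<Theta> \<Longrightarrow>
         (\<Sum>l\<in>UNIV. pderiv_u (h i k) l (u, \<phi>) * vf_apply (r j) (\<lambda>v. v $ l) u
                 - pderiv_u (h i j) l (u, \<phi>) * vf_apply (r k) (\<lambda>v. v $ l) u)
       + (\<Sum>s\<in>UNIV. pderiv_phi (h i k) s (u, \<phi>) * h s j (u, \<phi>)
                 - pderiv_phi (h i j) s (u, \<phi>) * h s k (u, \<phi>))
       = (\<Sum>l\<in>UNIV. c l j k u * h i l (u, \<phi>))"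
    and "ubar \<in> \<Omega>"
    and "\<Xi> \<subseteq> \<Omega>" and "ubar \<in> \<Xi>"
    and "embedded_submanifold CARD('m) \<Xi>" and "transversal \<Xi> r"
    and "smooth_on_submanifold \<Xi> g" and "g ` \<Xi> \<subseteq> \<Theta>"
  shows "\<exists>\<Omega>' \<alpha>. open \<Omega>' \<and> \<Omega>' \<subseteq> \<Omega> \<and> ubar \<in> \<Omega>' \<and>
           solves_system r h \<Theta> \<Omega>' \<alpha> \<and> (\<forall>u\<in>\<Xi> \<inter> \<Omega>'. \<alpha> u = g u) \<and>
           (\<forall>\<Omega>'' \<beta>. open \<Omega>'' \<and> \<Omega>'' \<subseteq> \<Omega> \<and> ubar \<in> \<Omega>'' \<and>
              solves_system r h \<Theta> \<Omega>'' \<beta> \<and> (\<forall>u\<in>\<Xi> \<inter> \<Omega>''. \<beta> u = g u) \<longrightarrow>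
              (\<exists>W. open W \<and> ubar \<in> W \<and> W \<subseteq> \<Omega>' \<inter> \<Omega>'' \<and> (\<forall>u\<in>W. \<alpha> u = \<beta> u)))"
proof -
  define X where "X = graph_field r h"
  let ?D = "\<Omega> \<times> \<Theta>"
  note frame = assms(4)
  have smr: "smooth_on \<Omega> (r j)" for j using frame by (simp add: partial_frame_on_def)
  have oD: "open ?D" using assms(2,3) by (rule open_Times)
  have X: "smooth_on ?D (X j)" for j
    unfolding X_def by (rule smooth_graph_field[OF assms(2,3) smr assms(6)])
  have fstX: "fst (X j z) = r j (fst z)" for j z by (simp add: X_def graph_field_def)
  have C: "smooth_on ?D (\<lambda>z. c l j k (fst z))" for l j k
    unfolding smooth_on_def
  proof
    fix n
    show "Ck_on n (\<lambda>z. c l j k (fst z)) ?D"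
      by (rule Ck_on_compose[OF oD assms(2) Ck_on_linear[OF bounded_linear_fst oD]
            smooth_onD[OF smooth_structure_functions[OF assms(2,4,5,7)]]]) auto
  qed
  have bracket: "lie_bracket (X j) (X k) z = (\<Sum>l\<in>UNIV. c l j k (fst z) *\<^sub>R X l z)" if "z \<in> ?D" for j k z
    unfolding X_def by (rule lie_bracket_graph_field[OF assms(2,3) smr assms(6,7) integrability that])
  show ?thesis
  proof (rule adapted_coordinates[OF assms(2,3,4) X fstX C bracket assms(9,11,12,13,14,15)])
    fix S x0 Z and A :: "real^'n \<Rightarrow> real^'m^'m" and \<kappa> :: "'m \<Rightarrow> 'n" and U \<psi>
    assume S: "open S" "x0 \<in> S" and \<kappa>: "inj \<kappa>" and Z: "smooth_on S Z" and contA: "continuous_on S A"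
        and ZD: "\<And>x. x \<in> S \<Longrightarrow> Z x \<in> ?D" and invA: "\<And>x. x \<in> S \<Longrightarrow> invertible (A x)"
        and deriv: "\<And>x k. x \<in> S \<Longrightarrow> frechet_derivative Z (at x) (axis (\<kappa> k) 1) = (\<Sum>l\<in>UNIV. (A x $ k $ l) *\<^sub>R X l (Z x))"
        and initial: "\<And>x. x \<in> S \<Longrightarrow> kill_coords (range \<kappa>) x = x \<Longrightarrow> fst (Z x) \<in> \<Xi> \<and> snd (Z x) = g (fst (Z x))"
        and Px0: "kill_coords (range \<kappa>) x0 = x0" and Zx0: "Z x0 = (ubar, g ubar)"
        and U: "open U" "ubar \<in> U" and \<psi>: "continuous_on U \<psi>" "\<psi> ubar = x0"
          "\<And>u. u \<in> \<Xi> \<inter> U \<Longrightarrow> \<psi> u \<in> S \<Longrightarrow> kill_coords (range \<kappa>) (\<psi> u) = \<psi> u \<and> fst (Z (\<psi> u)) = u"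
        and inj: "\<And>v. frechet_derivative (\<lambda>x. fst (Z x)) (at x0) v = 0 \<Longrightarrow> v = 0"
    let ?P = "kill_coords (range \<kappa>)"
    let ?f = "\<lambda>x. fst (Z x)"
    have f: "smooth_on S ?f"
      using Z S(1) by (auto simp: smooth_on_def intro: Ck_on_fst)
    obtain U' V' \<theta> where U': "open U'" "U' \<subseteq> S" "x0 \<in> U'" and V': "open V'"
      and hom: "homeomorphism U' V' ?f \<theta>" and \<theta>: "smooth_on V' \<theta>"
      using smooth_inverse_function[OF f S inj] by blast
    have \<theta>f: "\<theta> (?f x) = x" "?f x \<in> V'" if "x \<in> U'" for x using hom that by (auto simp: homeomorphism_def)
    have f\<theta>: "?f (\<theta> u) = u" "\<theta> u \<in> U'" if "u \<in> V'" for u using hom that by (auto simp: homeomorphism_def)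
    define \<alpha> where "\<alpha> = (\<lambda>u. snd (Z (\<theta> u)))"
    have Z\<theta>: "Z (\<theta> u) = (u, \<alpha> u)" if "u \<in> V'" for u
      using f\<theta>(1)[OF that] by (simp add: \<alpha>_def prod_eq_iff)
    have \<theta>S: "\<theta> ` V' \<subseteq> S" using f\<theta>(2) U'(2) by blast
    have \<alpha>: "smooth_on V' \<alpha>"
      unfolding smooth_on_def \<alpha>_def
      by (intro allI Ck_on_snd V' Ck_on_compose[OF V' S(1) smooth_onD[OF \<theta>] smooth_onD[OF Z] \<theta>S])
    have pde: "frechet_derivative \<alpha> (at u) (r j u) = snd (X j (u, \<alpha> u))" if u: "u \<in> V'" for u j
    proof -
      let ?x = "\<theta> u" and ?D\<alpha> = "frechet_derivative \<alpha> (at u)"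
      have x: "?x \<in> U'" "?x \<in> S" using f\<theta>(2)[OF u] U'(2) by auto
      let ?DZ = "frechet_derivative Z (at ?x)"
      have dZ: "(Z has_derivative ?DZ) (at ?x)" using smooth_on_has_derivative[OF Z x(2)] .
      have d\<alpha>: "(\<alpha> has_derivative ?D\<alpha>) (at u)" using smooth_on_has_derivative[OF \<alpha> u] .
      have "((\<lambda>x. \<alpha> (?f x)) has_derivative (\<lambda>v. ?D\<alpha> (fst (?DZ v)))) (at ?x)"
        using diff_chain_at[OF has_derivative_fst[OF dZ], of \<alpha> ?D\<alpha>] d\<alpha> f\<theta>(1)[OF u] by (simp add: o_def)
      then have "((\<lambda>x. snd (Z x)) has_derivative (\<lambda>v. ?D\<alpha> (fst (?DZ v)))) (at ?x)"
        by (rule has_derivative_transform_within_open[OF _ U'(1) x(1)]) (simp add: \<alpha>_def \<theta>f(1))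
      from has_derivative_unique[OF this has_derivative_snd[OF dZ]]
      \<comment> \<open>Obtained by differentiating \<alpha> (fst (Z x)) = snd (Z x). In the
        direction \<kappa> k it yields the system only in the combination with coefficients A_kl;
        invertibility of A separates the fields.\<close>
      have "?D\<alpha> (fst (?DZ v)) = snd (?DZ v)" for v by metis
      note eq = this
      have "?D\<alpha> (\<Sum>l\<in>UNIV. (A ?x $ k $ l) *\<^sub>R r l u) = (\<Sum>l\<in>UNIV. (A ?x $ k $ l) *\<^sub>R snd (X l (u, \<alpha> u)))" for k
        using eq[of "axis (\<kappa> k) 1"] by (simp add: deriv[OF x(2)] Z\<theta>[OF u] fst_sum snd_sum fstX)
      then have "(\<Sum>l\<in>UNIV. (A ?x $ k $ l) *\<^sub>R (?D\<alpha> (r l u) - snd (X l (u, \<alpha> u)))) = 0" for k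
        using has_derivative_linear[OF d\<alpha>] by (simp add: linear_sum linear_scale scaleR_diff_right sum_subtractf)
      from invertible_sum_eq_0[OF invA[OF x(2)] this] show ?thesis by simp
    qed
    obtain \<delta>0 where \<delta>0: "\<delta>0 > 0" "ball x0 \<delta>0 \<subseteq> U'" using U'(1,3) open_contains_ball by blast
    let ?B = "ball x0 \<delta>0"
    \<comment> \<open>The condition on \<psi> puts \<psi> u inside U' for u in \<Xi>. Injectivity of
      fst Z there gives \<theta> u = \<psi> u, a slice point, where the \<Theta>-part of Z is g
      u.\<close>
    define \<Omega>' where "\<Omega>' = (V' \<inter> \<theta> -` ?B) \<inter> (U \<inter> \<psi> -` ?B)"
    have op: "open \<Omega>'"
      unfolding \<Omega>'_def
      by (intro open_Int continuous_open_preimage[OF smooth_on_imp_continuous_on[OF \<theta>] V' open_ball]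
          continuous_open_preimage[OF \<psi>(1) U(1) open_ball])
    have fx0: "?f x0 = ubar" by (simp add: Zx0)
    have \<theta>ubar: "ubar \<in> V'" "\<theta> ubar = x0" using \<theta>f[OF U'(3)] fx0 by auto
    have ub: "ubar \<in> \<Omega>'" using \<theta>ubar U \<psi>(2) \<delta>0 by (simp add: \<Omega>'_def)
    have sub: "\<Omega>' \<subseteq> V'" by (auto simp: \<Omega>'_def)
    have uD: "(u, \<alpha> u) \<in> ?D" if "u \<in> V'" for u
      using ZD[of "\<theta> u"] Z\<theta>[OF that] \<theta>S that by auto
    have sol: "solves_system r h \<Theta> \<Omega>' \<alpha>"
      unfolding solves_system_iff using smooth_on_subset[OF \<alpha> sub] pde uD sub by (auto simp: X_def)
    have agree: "\<alpha> u = g u" if u: "u \<in> \<Xi> \<inter> \<Omega>'" for u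
    proof -
      have \<psi>u: "\<psi> u \<in> U'" "\<psi> u \<in> S" "u \<in> \<Xi> \<inter> U" using u \<delta>0(2) U'(2) by (auto simp: \<Omega>'_def)
      have "?P (\<psi> u) = \<psi> u" "?f (\<psi> u) = u" using \<psi>(3)[OF \<psi>u(3,2)] by auto
      then show ?thesis using initial[OF \<psi>u(2)] \<theta>f(1)[OF \<psi>u(1)] by (simp add: \<alpha>_def)
    qed
    have unique: "\<exists>W. open W \<and> ubar \<in> W \<and> W \<subseteq> \<Omega>' \<inter> \<Omega>'' \<and> (\<forall>u\<in>W. \<alpha> u = \<beta> u)"
      if o: "open \<Omega>''" "ubar \<in> \<Omega>''" and \<beta>: "solves_system r h \<Theta> \<Omega>'' \<beta>" and \<beta>g: "\<And>u. u \<in> \<Xi> \<inter> \<Omega>'' \<Longrightarrow> \<beta> u = g u"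
      for \<Omega>'' \<beta>
    proof -
      have \<beta>s: "smooth_on \<Omega>'' \<beta>" using \<beta> by (simp add: solves_system_def)
      have \<beta>pde: "frechet_derivative \<beta> (at u) (fst (X l (u, \<beta> u))) = snd (X l (u, \<beta> u))" if "u \<in> \<Omega>''" for u l
        using \<beta> that unfolding solves_system_iff by (simp add: fstX X_def graph_field_def)
      let ?z0 = "(ubar, g ubar)"
      have z0: "?z0 \<in> ?D" using ZD[OF S(2)] Zx0 by simp
      have "\<exists>\<rho> L. \<rho> > 0 \<and> L \<ge> 0 \<and> (\<forall>a\<in>ball ?z0 \<rho>. \<forall>b\<in>ball ?z0 \<rho>. norm (X l b - X l a) \<le> L * norm (b - a))" for l
        by (rule Ck_on_locally_lipschitz[OF smooth_onD[OF X] oD z0, of l]) blast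
      then obtain \<rho> L where \<rho>L: "\<And>l. \<rho> l > 0" "\<And>l. L l \<ge> 0"
        "\<And>l a b. a \<in> ball ?z0 (\<rho> l) \<Longrightarrow> b \<in> ball ?z0 (\<rho> l) \<Longrightarrow> norm (X l b - X l a) \<le> L l * norm (b - a)"
        by metis
      \<comment> \<open>There are finitely many fields, so the least radius and the sum of the
        constants serve all of them.\<close>
      define Q where "Q = ball ?z0 (Min (range \<rho>))"
      define M where "M = sum L UNIV"
      have M: "M \<ge> 0" "L l \<le> M" for l
        using \<rho>L(2) by (auto simp: M_def intro!: sum_nonneg member_le_sum)
      have lip: "norm (X l b - X l a) \<le> M * norm (b - a)" if "a \<in> Q" "b \<in> Q" for l a b
      proof -
        have "Q \<subseteq> ball ?z0 (\<rho> l)" unfolding Q_def by (intro subset_ball) simp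
        then have "norm (X l b - X l a) \<le> L l * norm (b - a)" using that by (intro \<rho>L(3)) auto
        also have "\<dots> \<le> M * norm (b - a)" using M(2) by (intro mult_right_mono) auto
        finally show ?thesis .
      qed
      have Q: "open Q" "?z0 \<in> Q" using \<rho>L(1) by (auto simp: Q_def)
      have \<beta>0: "\<beta> ubar = g ubar" using \<beta>g o(2) assms(11) by blast
      have contf: "continuous_on S ?f" using f by (rule smooth_on_imp_continuous_on)
      \<comment> \<open>S1, S2 and S3 successively impose what the path in
        \<open>transport_unique\<close> requires: the base point lies in both domains, and Z and the
        graph of \<beta> lie in Q. All are open conditions, and x0 meets the last because \<beta>
        ubar = g ubar.\<close>
      define S1 where "S1 = S \<inter> ?f -` (\<Omega>' \<inter> \<Omega>'')"
      have S1: "open S1" "x0 \<in> S1"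
        using continuous_open_preimage[OF contf S(1) open_Int[OF op o(1)]] o(2) ub S(2)
        by (simp_all add: S1_def Zx0)
      define S2 where "S2 = S1 \<inter> Z -` Q"
      have S2: "open S2" "x0 \<in> S2"
        using continuous_open_preimage[OF continuous_on_subset[OF smooth_on_imp_continuous_on[OF Z]] S1(1) Q(1)] S1(2) Q(2)
        by (simp_all add: S2_def S1_def Zx0)
      let ?b = "\<lambda>x. (?f x, \<beta> (?f x))"
      have "continuous_on S2 (\<lambda>x. \<beta> (?f x))"
        by (rule continuous_on_compose2[OF smooth_on_imp_continuous_on[OF \<beta>s] continuous_on_subset[OF contf]])
          (auto simp: S2_def S1_def)
      then have contb: "continuous_on S2 ?b"
        by (intro continuous_on_Pair continuous_on_subset[OF contf]) (auto simp: S2_def S1_def)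
      define S3 where "S3 = S2 \<inter> ?b -` Q"
      have S3: "open S3" "x0 \<in> S3"
        using continuous_open_preimage[OF contb S2(1) Q(1)] S2(2) Q(2) by (auto simp: S3_def Zx0 \<beta>0)
      obtain \<delta> where \<delta>: "\<delta> > 0" "ball x0 \<delta> \<subseteq> S3" using S3 open_contains_ball by blast
      define W where "W = \<Omega>' \<inter> (V' \<inter> \<theta> -` ball x0 \<delta>)"
      have W: "open W" "ubar \<in> W"
        using continuous_open_preimage[OF smooth_on_imp_continuous_on[OF \<theta>] V' open_ball, of x0 \<delta>] op ub \<theta>ubar \<delta>(1)
        by (auto simp: W_def)
      have WS3: "\<theta> u \<in> S3" "u \<in> V'" if "u \<in> W" for u using that \<delta>(2) by (auto simp: W_def)
      have "\<alpha> u = \<beta> u" if u: "u \<in> W" for u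
      proof -
        let ?x = "\<theta> u"
        let ?d = "\<Sum>k\<in>UNIV. ?x $ \<kappa> k *\<^sub>R axis (\<kappa> k) 1"
        \<comment> \<open>The path starts at the slice point below \<theta> u, where \<beta> and the
          \<Theta>-part of Z both equal g, and moves only in flow directions up to \<theta>
          u.\<close>
        let ?y = "\<lambda>s. ?P ?x + s *\<^sub>R ?d"
        have dec: "?x = ?P ?x + ?d" by (rule kill_coords_decompose[OF \<kappa>])
        have xB: "?x \<in> ball x0 \<delta>" using u by (simp add: W_def)
        \<comment> \<open>The projection fixes x0 and does not increase norms, so it preserves the
          ball; by convexity the whole segment stays inside.\<close>
        have PxB: "?P ?x \<in> ball x0 \<delta>"
        proof -
          have "norm (?P (?x - x0)) \<le> norm (?x - x0)" by (rule norm_kill_coords_le)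
          moreover have "?P (?x - x0) = ?P ?x - x0"
            by (simp add: linear_diff[OF bounded_linear.linear[OF bounded_linear_kill_coords]] Px0)
          ultimately show ?thesis using xB by (simp add: dist_norm norm_minus_commute[of x0])
        qed
        have yS: "?y s \<in> S3" if "s \<in> {0..1}" for s
        proof -
          have "?y s = (1 - s) *\<^sub>R ?P ?x + s *\<^sub>R (?P ?x + ?d)" by (simp add: algebra_simps)
          also have "\<dots> \<in> ball x0 \<delta>"
            unfolding dec[symmetric] using convexD[OF convex_ball PxB xB, of "1 - s" s] that by simp
          finally show ?thesis using \<delta>(2) by blast
        qed
        have "\<beta> (fst (Z (?y 1))) = snd (Z (?y 1))"
        proof (rule transport_unique[OF Z S(1) contA deriv \<beta>s \<beta>pde _ lip M(1), where y="?y" and ?y0.0="?P ?x" and t="\<lambda>k. ?x $ \<kappa> k"])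
          show "fst (X l (u, \<phi>)) = fst (X l (u, \<phi>'))" for l u \<phi> \<phi>' by (simp add: fstX)
          show "?y s \<in> S \<and> fst (Z (?y s)) \<in> \<Omega>'' \<and> Z (?y s) \<in> Q \<and> (fst (Z (?y s)), \<beta> (fst (Z (?y s)))) \<in> Q"
            if "s \<in> {0..1}" for s
            using yS[OF that] by (simp add: S3_def S2_def S1_def)
          have "?P ?x \<in> S" "?f (?P ?x) \<in> \<Omega>''" using yS[of 0] by (auto simp: S3_def S2_def S1_def)
          then show "\<beta> (fst (Z (?y 0))) = snd (Z (?y 0))"
            using initial[of "?P ?x"] \<beta>g by (auto simp: kill_coords_idem)
        qed simp_all
        then have "\<beta> (?f ?x) = snd (Z ?x)" using dec by simp
        then show ?thesis using f\<theta>(1)[OF WS3(2)[OF u]] by (simp add: \<alpha>_def)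
      qed
      moreover have "W \<subseteq> \<Omega>' \<inter> \<Omega>''"
        using WS3 f\<theta>(1) by (force simp: W_def S3_def S2_def S1_def)
      ultimately show ?thesis using W by blast
    qed
    show ?thesis
    proof (rule exI[of _ \<Omega>'], rule exI[of _ \<alpha>], intro conjI allI impI ballI)
      show "\<Omega>' \<subseteq> \<Omega>" using uD sub by auto
      show "\<alpha> u = g u" if "u \<in> \<Xi> \<inter> \<Omega>'" for u using agree[OF that] .
      show "\<exists>W. open W \<and> ubar \<in> W \<and> W \<subseteq> \<Omega>' \<inter> \<Omega>'' \<and> (\<forall>u\<in>W. \<alpha> u = \<beta> u)"
        if "open \<Omega>'' \<and> \<Omega>'' \<subseteq> \<Omega> \<and> ubar \<in> \<Omega>'' \<and> solves_system r h \<Theta> \<Omega>'' \<beta> \<and> (\<forall>u\<in>\<Xi> \<inter> \<Omega>''. \<beta> u = g u)"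
        for \<Omega>'' \<beta>
        using that by (intro unique) auto
    qed (fact op ub sol)+
  qed
qed

end
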